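(* Let $n\ge 1$, let $X=\mathbb{R}^n$ and $Y=\mathbb{S}^{n-1}\times\mathbb{R}$, and let $K\colon X\times Y\to\mathbb{Z}$ be the indicator function of the set $\{(x,(\xi,t))\in X\times Y : x\cdot\xi\le t\}$. Then the sublevelset Euler integral transform $$\mathcal{R}_K\colon \mathrm{CF}_c(X)\to \mathrm{CF}(Y),\qquad (\mathcal{R}_K h)(\xi,t)=\int_X h(x)\,K(x,(\xi,t))\,d\chi(x),$$ is invertible, in the following sense: there exist a kernel $K'\in\mathrm{CF}(Y\times X)$ and constants $\lambda\neq\mu$ such that for every $h\in \mathrm{CF}_c(X)$, $$(\mathcal{R}_{K'}\circ\mathcal{R}_K)h=(\mu-\lambda)\,h+\lambda\left(\int_X h\,d\chi\right)\mathbf{1}_X ,$$ so that $h$ can be recovered exactly from $\mathcal{R}_K h$ (in particular $\mathcal{R}_K$ is injective on $\mathrm{CF}_c(X)$).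
   Context: Fix an o-minimal structure expanding the real field; "definable" (equivalently "constructible") refers to this structure. The reader may take definable to mean semialgebraic. For a definable set $X$ in Euclidean space, $\mathrm{CF}(X)$ denotes the group of constructible functions on $X$: functions $h\colon X\to\mathbb{Z}$ whose level sets are definable and form a locally finite family. $\mathrm{CF}_c(X)$ denotes the subgroup of those with compact support (such a function takes only finitely many values). $\mathbf{1}_X$ is the constant function $1$ on $X$. The Euler characteristic $\chi$ of a definable set is the combinatorial (compactly supported) one: if a definable set $A$ is definably triangulated as a finite disjoint union of open simplices $\sigma$, then $\chi(A)=\sum_\sigma (-1)^{\dim\sigma}$. It is well defined, additive, and invariant under definable homeomorphism. The Euler integral is the additive functional determined by $\int_X \mathbf{1}_\sigma\,d\chi=(-1)^{\dim\sigma}$ for each open definable simplex $\sigma$. Thus, for $h$ with finitely many values and definable level sets, $\int_X h\,d\chi=\sum_{c\in\mathbb{Z}} c\,\chi(\{h=c\})$. For definable sets $X,Y$ and a kernel $K\in\mathrm{CF}(X\times Y)$, the Radon transform with kernel $K$ is $(\mathcal{R}_K h)(y)=\int_X h(x)K(x,y)\,d\chi(x)$. Likewise, for $K'\in \mathrm{CF}(Y\times X)$, $(\mathcal{R}_{K'}g)(x)=\int_Y g(y)K'(y,x)\,d\chi(y)$. $\mathbb{S}^{n-1}$ is the unit sphere in $\mathbb{R}^n$ and $x\cdot\xi$ is the standard inner product. *)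

theory Defs
  imports "HOL-Analysis.Analysis"
begin

text \<open>
  O-minimal structures expanding the real field. The set \<open>S m\<close> consists of the definable subsets of
  the \<open>m\<close>-th power of the reals, whose points are represented as lists of length \<open>m\<close>. Since \<open>S 1\<close>
  consists of all finite unions of points and intervals, definability is with real parameters.
\<close>

locale o_minimal_field_expansion =
  fixes S :: "nat \<Rightarrow> real list set set"
  assumes subset_space: "A \<in> S m \<Longrightarrow> A \<subseteq> {x. length x = m}"
    and empty_mem: "{} \<in> S m"
    and Un_mem: "A \<in> S m \<Longrightarrow> B \<in> S m \<Longrightarrow> A \<union> B \<in> S m"
    and compl_mem: "A \<in> S m \<Longrightarrow> {x. length x = m} - A \<in> S m"
    and cylinder_right: "A \<in> S m \<Longrightarrow> {x @ [a] | x a. x \<in> A} \<in> S (Suc m)"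
    and cylinder_left: "A \<in> S m \<Longrightarrow> {a # x | x a. x \<in> A} \<in> S (Suc m)"
    and diagonal_mem: "i < j \<Longrightarrow> j < m \<Longrightarrow> {x. length x = m \<and> x ! i = x ! j} \<in> S m"
    and projection_mem: "A \<in> S (Suc m) \<Longrightarrow> butlast ` A \<in> S m"
    and less_mem: "{[x, y] | x y. x < y} \<in> S 2"
    and add_mem: "{[x, y, x + y] | x y. True} \<in> S 3"
    and mult_mem: "{[x, y, x * y] | x y. True} \<in> S 3"
    and o_minimal: "A \<in> S 1 \<longleftrightarrow>
      (\<exists>F. finite F \<and> (\<forall>I\<in>F. is_interval I) \<and> A = (\<lambda>x. [x]) ` \<Union>F)"

text \<open>
  Subsets of a Euclidean space are identified with sets of coordinate lists along an enumeration of
  the standard basis; which enumeration is used is immaterial, as the sets \<open>S m\<close> of an o-minimal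
  structure are stable under permuting coordinates.
\<close>

definition definable :: "(nat \<Rightarrow> real list set set) \<Rightarrow> 'a::euclidean_space set \<Rightarrow> bool" where
  "definable S A \<longleftrightarrow> (\<exists>bs. distinct bs \<and> set bs = (Basis :: 'a set) \<and>
     (\<lambda>x. map (\<lambda>b. x \<bullet> b) bs) ` A \<in> S (length bs))"

text \<open>
  A definable open simplex of dimension \<open>d\<close> is the image of an open simplex (a point if \<open>d = 0\<close>)
  under a homeomorphism with definable graph.
\<close>

definition definable_open_simplex ::
    "(nat \<Rightarrow> real list set set) \<Rightarrow> nat \<Rightarrow> 'a::euclidean_space set \<Rightarrow> bool" where
  "definable_open_simplex S d \<sigma> \<longleftrightarrow> (\<exists>(T :: 'a set) f g. int d simplex T \<and>
     homeomorphism (rel_interior T) \<sigma> f g \<and> definable S {(x, f x) | x. x \<in> rel_interior T})"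

definition euler_char :: "(nat \<Rightarrow> real list set set) \<Rightarrow> 'a::euclidean_space set \<Rightarrow> int" where
  "euler_char S A = (THE k. \<exists>P d. finite P \<and> partition_on A P \<and>
     (\<forall>\<sigma>\<in>P. definable_open_simplex S (d \<sigma>) \<sigma>) \<and> k = (\<Sum>\<sigma>\<in>P. (-1) ^ d \<sigma>))"

text \<open>
  Functions on \<open>X\<close> are extensional, that is, they take the value \<open>undefined\<close> outside of \<open>X\<close>, so that
  equality of functions is equality on \<open>X\<close>.
\<close>

definition CF :: "(nat \<Rightarrow> real list set set) \<Rightarrow> 'a::euclidean_space set \<Rightarrow> ('a \<Rightarrow> int) set" where
  "CF S X = {h \<in> X \<rightarrow>\<^sub>E UNIV. (\<forall>c. definable S {x \<in> X. h x = c}) \<and>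
     locally_finite_in (top_of_set X) (range (\<lambda>c. {x \<in> X. h x = c}))}"

definition CFc :: "(nat \<Rightarrow> real list set set) \<Rightarrow> 'a::euclidean_space set \<Rightarrow> ('a \<Rightarrow> int) set" where
  "CFc S X = {h \<in> CF S X. compact (X \<inter> closure {x \<in> X. h x \<noteq> 0})}"

definition euler_integrable ::
    "(nat \<Rightarrow> real list set set) \<Rightarrow> 'a::euclidean_space set \<Rightarrow> ('a \<Rightarrow> int) \<Rightarrow> bool" where
  "euler_integrable S X h \<longleftrightarrow> finite (h ` X) \<and> (\<forall>c. definable S {x \<in> X. h x = c})"

text \<open>Only meaningful for functions satisfying \<^const>\<open>euler_integrable\<close>.\<close>

definition euler_integral ::
    "(nat \<Rightarrow> real list set set) \<Rightarrow> 'a::euclidean_space set \<Rightarrow> ('a \<Rightarrow> int) \<Rightarrow> int" where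
  "euler_integral S X h = (\<Sum>c\<in>h ` X. c * euler_char S {x \<in> X. h x = c})"

definition radon_defined :: "(nat \<Rightarrow> real list set set) \<Rightarrow> 'a::euclidean_space set \<Rightarrow>
    'b::euclidean_space set \<Rightarrow> ('a \<times> 'b \<Rightarrow> int) \<Rightarrow> ('a \<Rightarrow> int) \<Rightarrow> bool" where
  "radon_defined S X Y K h \<longleftrightarrow> (\<forall>y\<in>Y. euler_integrable S X (\<lambda>x. h x * K (x, y)))"

definition radon :: "(nat \<Rightarrow> real list set set) \<Rightarrow> 'a::euclidean_space set \<Rightarrow>
    'b::euclidean_space set \<Rightarrow> ('a \<times> 'b \<Rightarrow> int) \<Rightarrow> ('a \<Rightarrow> int) \<Rightarrow> 'b \<Rightarrow> int" where
  "radon S X Y K h = (\<lambda>y\<in>Y. euler_integral S X (\<lambda>x. h x * K (x, y)))"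

end

theory Submission
  imports Defs "HOL-Homology.Invariance_of_Domain"
begin

text \<open>
  The kernel \<open>K'\<close> is the indicator function of \<open>{((\<xi>, t), x). t = x \<bullet> \<xi>}\<close>. For fixed \<open>x\<close> and \<open>x'\<close>, the
  integral of \<open>K (x, y) * K' (y, x')\<close> over \<open>y\<close> is the Euler characteristic of \<open>{\<xi>. (x - x') \<bullet> \<xi> \<le> 0}\<close> in the
  unit sphere, which is that of a closed hemisphere, \<open>\<lambda> = 1\<close>, if \<open>x \<noteq> x'\<close>, and that of the sphere,
  \<open>\<mu> = 1 - (-1)^n \<noteq> 1\<close>, if \<open>x = x'\<close>. Hence the inversion formula follows from Fubini's theorem. A point outside
  of the supports shows that the transform determines \<open>\<integral> h d\<chi>\<close>, and hence \<open>h\<close>.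

  The Euler characteristic is shown to be well defined by comparing it with an iterated integral over
  the coordinates. Such integrals are additive and, by the Fubini theorem, invariant under definable
  bijections; they take the value \<open>(-1)^d\<close> on open \<open>d\<close>-simplices. The Fubini theorem reduces to the
  plane, and there to graphs of, and regions above, functions that are constant or injective.
  Existence of decompositions is the cell decomposition theorem. As the ground field is that of the real numbers, it
  can be obtained from the Baire category theorem and invariance of domain: if an open set is covered by
  countably many finite unions of cells, then one of these contains an open cell. This replaces
  the usual induction via the monotonicity theorem.
\<close>

section \<open>Definability calculus\<close>

text \<open>Two obstacles shape the development. The Euler characteristic is a \<open>THE\<close>
  over all partitions into definable simplices, so every partition has to give the same sum.
  Comparing two partitions directly would call for common refinements; an iterated integral is fixed
  by the set alone, and each partition computes it. Moreover, the cardinality of a fiber cannot be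
  quantified in a formula before it is bounded, so the bound has to come from topology: a finite
  fiber is coded by rational data, of which there are only countably many, and one code then holds
  on a whole open set. Category is available in dimension \<open>m\<close> only once the definable
  sets there have been cut into cells. Hence decomposition, uniform finiteness and piecewise
  continuity are proved together, by induction on \<open>m\<close>. Neighborhoods are coordinate
  boxes and endpoints of intervals are compressed into [-1, 1], which keeps all notions expressible
  by formulas in real variables. The kernel \<open>K'\<close> lives on the hyperplanes through the
  point to be recovered, where t is a function of the direction; this turns the composed kernel into
  a set of directions.\<close>

abbreviation vcons :: "real \<Rightarrow> (nat \<Rightarrow> real) \<Rightarrow> nat \<Rightarrow> real" (infixr \<open>##\<close> 65) where
  "a ## x \<equiv> case_nat a x"

text \<open>
  Points of the \<open>m\<close>-th power of the reals are sequences vanishing from index \<open>m\<close> on, so that all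
  dimensions share one type and one topology.
\<close>

definition eucl :: "nat \<Rightarrow> (nat \<Rightarrow> real) set" where
  "eucl m = {x. \<forall>i\<ge>m. x i = 0}"

definition trunc :: "nat \<Rightarrow> (nat \<Rightarrow> real) \<Rightarrow> nat \<Rightarrow> real" where
  "trunc m e = (\<lambda>i. if i < m then e i else 0)"

lemma trunc_in_eucl [simp]: "trunc m e \<in> eucl m"
  by (auto simp: trunc_def eucl_def)

lemma trunc_eucl [simp]: "x \<in> eucl m \<Longrightarrow> trunc m x = x"
  by (auto simp: trunc_def eucl_def fun_eq_iff)

lemma trunc_apply: "trunc m e i = (if i < m then e i else 0)"
  by (simp add: trunc_def)

lemma vcons_collapse [simp]: "e 0 ## (\<lambda>i. e (Suc i)) = e"
  by (auto simp: fun_eq_iff split: nat.split)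

lemma vcons_eq_iff [simp]: "a ## x = b ## y \<longleftrightarrow> a = b \<and> x = y"
  by (metis (no_types, lifting) ext nat.case)

lemma vcons_in_eucl [simp]: "a ## x \<in> eucl (Suc m) \<longleftrightarrow> x \<in> eucl m"
proof -
  have "(\<forall>i\<ge>Suc m. (a ## x) i = 0) \<longleftrightarrow> (\<forall>i\<ge>m. x i = 0)"
    by (metis Suc_le_mono Suc_le_D nat.case(2))
  then show ?thesis by (simp add: eucl_def)
qed

lemma tail_in_eucl: "x \<in> eucl (Suc m) \<Longrightarrow> (\<lambda>i. x (Suc i)) \<in> eucl m"
  by (auto simp: eucl_def)

lemma eucl_Suc_cases:
  assumes "x \<in> eucl (Suc m)"
  obtains a y where "x = a ## y" "y \<in> eucl m"
  using tail_in_eucl[OF assms] vcons_collapse[of x] by metis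

lemma eucl_0: "eucl 0 = {\<lambda>i. 0}"
  by (auto simp: eucl_def)

lemma Bex_eucl_Suc: "(\<exists>x\<in>eucl (Suc m). P x) \<longleftrightarrow> (\<exists>a. \<exists>y\<in>eucl m. P (a ## y))"
  by (metis eucl_Suc_cases vcons_in_eucl)

lemma eucl_eqI: "x \<in> eucl m \<Longrightarrow> y \<in> eucl m \<Longrightarrow> (\<And>i. i < m \<Longrightarrow> x i = y i) \<Longrightarrow> x = y"
  unfolding eucl_def by (rule ext) (metis (mono_tags, lifting) mem_Collect_eq not_less)

context o_minimal_field_expansion
begin

text \<open>
  Formulas are predicates on environments \<open>e\<close> that depend on finitely many entries. A quantifier
  binds \<open>e 0\<close> and shifts the other entries, as with de Bruijn indices.
\<close>

definition def_pred_at :: "nat \<Rightarrow> ((nat \<Rightarrow> real) \<Rightarrow> bool) \<Rightarrow> bool" where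
  "def_pred_at n P \<longleftrightarrow> (\<exists>A\<in>S n. \<forall>e. P e \<longleftrightarrow> map e [0..<n] \<in> A)"

definition def_pred :: "((nat \<Rightarrow> real) \<Rightarrow> bool) \<Rightarrow> bool" where
  "def_pred P \<longleftrightarrow> (\<exists>n. def_pred_at n P)"

text \<open>The graph is laid out with the value at index 0 and the arguments shifted up by one, so
  that a quantifier over the value binds index 0.\<close>

definition def_fun :: "((nat \<Rightarrow> real) \<Rightarrow> real) \<Rightarrow> bool" where
  "def_fun u \<longleftrightarrow> def_pred (\<lambda>e. e 0 = u (\<lambda>i. e (Suc i)))"

text \<open>The finite range is part of the notion: it turns statements about values into finite
  disjunctions of formulas about levels.\<close>

definition def_int :: "((nat \<Rightarrow> real) \<Rightarrow> int) \<Rightarrow> bool" where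
  "def_int g \<longleftrightarrow> finite (range g) \<and> (\<forall>k. def_pred (\<lambda>e. g e = k))"

section \<open>Formulas in a fixed number of variables\<close>

lemma def_pred_at_cong:
  assumes "def_pred_at n P" "\<And>i. i < n \<Longrightarrow> e i = e' i"
  shows "P e \<longleftrightarrow> P e'"
proof -
  have "map e [0..<n] = map e' [0..<n]" using assms(2) by auto
  then show ?thesis using assms(1) unfolding def_pred_at_def by metis
qed

lemma def_pred_at_Suc:
  assumes "def_pred_at n P"
  shows "def_pred_at (Suc n) P"
proof -
  obtain A where A: "A \<in> S n" "\<And>e. P e \<longleftrightarrow> map e [0..<n] \<in> A"
    using assms unfolding def_pred_at_def by auto
  show ?thesis
    unfolding def_pred_at_def
    by (rule bexI[OF _ cylinder_right[OF A(1)]]) (auto simp: A(2))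
qed

lemma def_pred_at_mono:
  assumes "def_pred_at n P" "n \<le> m" shows "def_pred_at m P"
  using assms(2,1) by (induction m rule: dec_induct) (auto intro: def_pred_at_Suc)

lemma def_pred_at_not:
  assumes "def_pred_at n P" shows "def_pred_at n (\<lambda>e. \<not> P e)"
proof -
  obtain A where A: "A \<in> S n" "\<And>e. P e \<longleftrightarrow> map e [0..<n] \<in> A"
    using assms unfolding def_pred_at_def by auto
  show ?thesis unfolding def_pred_at_def
    by (rule bexI[OF _ compl_mem[OF A(1)]]) (simp add: A(2))
qed

lemma def_pred_at_disj:
  assumes "def_pred_at n P" "def_pred_at n Q" shows "def_pred_at n (\<lambda>e. P e \<or> Q e)"
proof -
  obtain A where A: "A \<in> S n" "\<And>e. P e \<longleftrightarrow> map e [0..<n] \<in> A"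
    using assms unfolding def_pred_at_def by auto
  obtain B where B: "B \<in> S n" "\<And>e. Q e \<longleftrightarrow> map e [0..<n] \<in> B"
    using assms unfolding def_pred_at_def by auto
  show ?thesis unfolding def_pred_at_def
    by (rule bexI[OF _ Un_mem[OF A(1) B(1)]]) (simp add: A(2) B(2))
qed

lemma def_pred_at_conj:
  assumes "def_pred_at n P" "def_pred_at n Q" shows "def_pred_at n (\<lambda>e. P e \<and> Q e)"
  using def_pred_at_not[OF def_pred_at_disj[OF assms[THEN def_pred_at_not]]] by simp

lemma def_pred_at_False: "def_pred_at n (\<lambda>e. False)"
  unfolding def_pred_at_def using empty_mem by auto

lemma def_pred_at_True: "def_pred_at n (\<lambda>e. True)"
  using def_pred_at_not[OF def_pred_at_False] by simp

lemma def_pred_at_Suc_tail: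
  assumes "def_pred_at n P"
  shows "def_pred_at (Suc n) (\<lambda>e. P (\<lambda>i. e (Suc i)))"
proof -
  obtain A where A: "A \<in> S n" "\<And>e. P e \<longleftrightarrow> map e [0..<n] \<in> A"
    using assms unfolding def_pred_at_def by auto
  show ?thesis
    unfolding def_pred_at_def
    by (rule bexI[OF _ cylinder_left[OF A(1)]]) (auto simp: A(2) map_upt_Suc simp del: upt_Suc)
qed

lemma def_pred_at_shift: "def_pred_at n P \<Longrightarrow> def_pred_at (k + n) (\<lambda>e. P (\<lambda>i. e (k + i)))"
  by (induction k) (auto dest: def_pred_at_Suc_tail)

lemma def_pred_at_eq:
  assumes "i < n" "j < n" shows "def_pred_at n (\<lambda>e. e i = e j)"
proof -
  have *: "def_pred_at n (\<lambda>e. e i = e j)" if "i < j" "j < n" for i j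
    unfolding def_pred_at_def using that
    by (intro bexI[OF _ diagonal_mem[of i j n]]) auto
  consider "i < j" | "i = j" | "j < i" by linarith
  then show ?thesis
    using *[of i j] *[of j i] assms by cases (auto simp: def_pred_at_True eq_commute)
qed

text \<open>The axioms project along the last coordinate, so the variable bound here is the one at
  index \<open>n\<close>; \<open>def_pred_ex\<close> passes to the de Bruijn form.\<close>

lemma def_pred_at_proj:
  assumes "def_pred_at (Suc n) P"
  shows "def_pred_at n (\<lambda>e. \<exists>a. P (e(n := a)))"
proof -
  obtain A where A: "A \<in> S (Suc n)" "\<And>e. P e \<longleftrightarrow> map e [0..<Suc n] \<in> A"
    using assms unfolding def_pred_at_def by auto
  have "(\<exists>a. P (e(n := a))) \<longleftrightarrow> map e [0..<n] \<in> butlast ` A" for e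
  proof
    assume "\<exists>a. P (e(n := a))"
    then obtain a where "map (e(n := a)) [0..<Suc n] \<in> A" using A(2) by blast
    then have "butlast (map (e(n := a)) [0..<Suc n]) \<in> butlast ` A" by blast
    moreover have "butlast (map (e(n := a)) [0..<Suc n]) = map e [0..<n]" by simp
    ultimately show "map e [0..<n] \<in> butlast ` A" by simp
  next
    assume "map e [0..<n] \<in> butlast ` A"
    then obtain l where l: "l \<in> A" "butlast l = map e [0..<n]" by auto
    have len: "length l = Suc n" using subset_space[OF A(1)] l(1) by auto
    then have "l = butlast l @ [last l]" by (metis append_butlast_last_id list.size(3) nat.distinct(1))
    also have "\<dots> = map (e(n := last l)) [0..<Suc n]" using l(2) by auto
    finally have "P (e(n := last l))" using A(2) l(1) by metis
    then show "\<exists>a. P (e(n := a))" by blast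
  qed
  then show ?thesis
    unfolding def_pred_at_def using projection_mem[OF A(1)] by blast
qed

text \<open>Binding \<open>n\<close> trailing variables at once is phrased by a second environment
  that agrees below \<open>k\<close>. Entries from \<open>k + n\<close> on do not affect
  \<open>P\<close>, so this amounts to \<open>n\<close> nested projections.\<close>

lemma def_pred_at_projs:
  "def_pred_at (k + n) P \<Longrightarrow> def_pred_at k (\<lambda>e. \<exists>e'. (\<forall>i<k. e' i = e i) \<and> P e')"
proof (induction n arbitrary: P)
  case 0
  have "(\<exists>e'. (\<forall>i<k. e' i = e i) \<and> P e') \<longleftrightarrow> P e" for e
    using def_pred_at_cong[OF 0, of e] by (metis add_0_right)
  then show ?case using 0 by simp
next
  case (Suc n)
  have "def_pred_at (k + n) (\<lambda>e. \<exists>a. P (e(k + n := a)))"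
    using Suc.prems def_pred_at_proj by simp
  from Suc.IH[OF this]
  have "def_pred_at k (\<lambda>e. \<exists>e'. (\<forall>i<k. e' i = e i) \<and> (\<exists>a. P (e'(k + n := a))))" .
  moreover have "(\<exists>e'. (\<forall>i<k. e' i = e i) \<and> (\<exists>a. P (e'(k + n := a)))) \<longleftrightarrow>
      (\<exists>e'. (\<forall>i<k. e' i = e i) \<and> P e')" for e
  proof safe
    fix e' a assume "\<forall>i<k. e' i = e i" "P (e'(k + n := a))"
    then show "\<exists>e'. (\<forall>i<k. e' i = e i) \<and> P e'"
      by (intro exI[of _ "e'(k + n := a)"]) auto
  next
    fix e' assume "\<forall>i<k. e' i = e i" "P e'"
    then show "\<exists>e'. (\<forall>i<k. e' i = e i) \<and> (\<exists>a. P (e'(k + n := a)))"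
      by (intro exI[of _ e']) (auto intro!: exI[of _ "e' (k + n)"])
  qed
  ultimately show ?case by simp
qed

lemma def_pred_at_all_less:
  "(\<And>i. i < n \<Longrightarrow> def_pred_at k (P i)) \<Longrightarrow> def_pred_at k (\<lambda>e. \<forall>i<n::nat. P i e)"
proof (induction n)
  case 0 then show ?case by (simp add: def_pred_at_True)
next
  case (Suc n)
  then have "def_pred_at k (\<lambda>e. P n e \<and> (\<forall>i<n. P i e))"
    by (intro def_pred_at_conj) auto
  then show ?case by (simp add: All_less_Suc)
qed

text \<open>The axioms give cylinders, diagonals and projections; permuting and repeating
  coordinates has to be derived. \<open>P\<close> is placed on a fresh block of coordinates from
  \<open>k\<close> on, the block is tied to the coordinates \<open>\<sigma> i\<close> by diagonals,
  and then it is projected away.\<close>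

lemma def_pred_at_subst:
  assumes P: "def_pred_at n P" and \<sigma>: "\<And>i. i < n \<Longrightarrow> \<sigma> i < k"
  shows "def_pred_at k (\<lambda>e. P (\<lambda>i. e (\<sigma> i)))"
proof -
  let ?Q = "\<lambda>e. (\<forall>i<n. e (\<sigma> i) = e (k + i)) \<and> P (\<lambda>i. e (k + i))"
  have "def_pred_at (k + n) ?Q"
    by (intro def_pred_at_conj def_pred_at_all_less def_pred_at_eq def_pred_at_shift P)
      (use \<sigma> in \<open>auto intro: trans_less_add1\<close>)
  from def_pred_at_projs[OF this]
  have "def_pred_at k (\<lambda>e. \<exists>e'. (\<forall>i<k. e' i = e i) \<and> ?Q e')" .
  moreover have "(\<exists>e'. (\<forall>i<k. e' i = e i) \<and> ?Q e') \<longleftrightarrow> P (\<lambda>i. e (\<sigma> i))" for e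
  proof
    assume "\<exists>e'. (\<forall>i<k. e' i = e i) \<and> ?Q e'"
    then obtain e' where e': "\<forall>i<k. e' i = e i" "?Q e'" by blast
    have "P (\<lambda>i. e' (k + i)) \<longleftrightarrow> P (\<lambda>i. e (\<sigma> i))"
      by (rule def_pred_at_cong[OF P]) (use e' \<sigma> in \<open>metis\<close>)
    then show "P (\<lambda>i. e (\<sigma> i))" using e' by simp
  next
    assume "P (\<lambda>i. e (\<sigma> i))"
    then show "\<exists>e'. (\<forall>i<k. e' i = e i) \<and> ?Q e'"
      using \<sigma> by (intro exI[of _ "\<lambda>j. if j < k then e j else e (\<sigma> (j - k))"]) auto
  qed
  ultimately show ?thesis by simp
qed

section \<open>Closure rules for formulas\<close>

named_theorems dintros

lemma def_pred_subst:
  assumes "def_pred P" shows "def_pred (\<lambda>e. P (\<lambda>i. e (\<sigma> i)))"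
proof -
  obtain n where n: "def_pred_at n P" using assms def_pred_def by blast
  have "def_pred_at (Suc (Max (\<sigma> ` {..n}))) (\<lambda>e. P (\<lambda>i. e (\<sigma> i)))"
    by (rule def_pred_at_subst[OF n]) (auto simp: less_Suc_eq_le)
  then show ?thesis using def_pred_def by blast
qed

lemma def_pred_at_two:
  assumes "def_pred P" "def_pred Q"
  obtains n where "def_pred_at n P" "def_pred_at n Q"
proof -
  obtain k l where "def_pred_at k P" "def_pred_at l Q" using assms def_pred_def by blast
  then show thesis
    using that[of "max k l"] by (meson def_pred_at_mono max.cobounded1 max.cobounded2)
qed

lemma def_pred_conj [dintros]: "def_pred P \<Longrightarrow> def_pred Q \<Longrightarrow> def_pred (\<lambda>e. P e \<and> Q e)"
  unfolding def_pred_def[of "\<lambda>e. P e \<and> Q e"]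
  by (rule def_pred_at_two[of P Q], assumption+) (rule exI, rule def_pred_at_conj)

lemma def_pred_disj [dintros]: "def_pred P \<Longrightarrow> def_pred Q \<Longrightarrow> def_pred (\<lambda>e. P e \<or> Q e)"
  unfolding def_pred_def[of "\<lambda>e. P e \<or> Q e"]
  by (rule def_pred_at_two[of P Q], assumption+) (rule exI, rule def_pred_at_disj)

lemma def_pred_not [dintros]:
  assumes "def_pred P" shows "def_pred (\<lambda>e. \<not> P e)"
proof -
  obtain n where "def_pred_at n P" using assms def_pred_def by blast
  from def_pred_at_not[OF this] show ?thesis unfolding def_pred_def by (rule exI)
qed

lemma def_pred_imp [dintros]:
  assumes "def_pred P" "def_pred Q" shows "def_pred (\<lambda>e. P e \<longrightarrow> Q e)"
  using def_pred_disj[OF def_pred_not[OF assms(1)] assms(2)] by simp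

lemma def_pred_iff [dintros]:
  assumes "def_pred P" "def_pred Q" shows "def_pred (\<lambda>e. P e \<longleftrightarrow> Q e)"
  by (rule back_subst[of def_pred, OF def_pred_conj[OF def_pred_imp[OF assms] def_pred_imp[OF assms(2,1)]]])
    auto

lemma def_pred_const [dintros]: "def_pred (\<lambda>e. c)"
  by (cases c) (auto simp: def_pred_def def_pred_at_True def_pred_at_False)

lemma def_pred_ball [dintros]:
  "finite I \<Longrightarrow> (\<And>i. i \<in> I \<Longrightarrow> def_pred (P i)) \<Longrightarrow> def_pred (\<lambda>e. \<forall>i\<in>I. P i e)"
  by (induction I rule: finite_induct) (auto intro!: dintros)

lemma def_pred_bex [dintros]:
  "finite I \<Longrightarrow> (\<And>i. i \<in> I \<Longrightarrow> def_pred (P i)) \<Longrightarrow> def_pred (\<lambda>e. \<exists>i\<in>I. P i e)"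
  by (induction I rule: finite_induct) (auto intro!: dintros)

lemma def_pred_all_less [dintros]:
  "(\<And>i. i < n \<Longrightarrow> def_pred (P i)) \<Longrightarrow> def_pred (\<lambda>e. \<forall>i<n::nat. P i e)"
  using def_pred_ball[of "{..<n}" P] by (simp add: Ball_def)

text \<open>The bound variable is moved from index 0 to index \<open>n\<close>, where projection
  reaches it. A formula in \<open>Suc n\<close> variables whose index 0 is bound reads only the
  indices below \<open>n\<close> of the outer environment, so overwriting index \<open>n\<close>
  does no harm.\<close>

lemma def_pred_ex [dintros]:
  assumes "def_pred (\<lambda>e. P (\<lambda>i. e (Suc i)) (e 0))"
  shows "def_pred (\<lambda>e. \<exists>a. P e a)"
proof -
  obtain n where "def_pred_at n (\<lambda>e. P (\<lambda>i. e (Suc i)) (e 0))" using assms def_pred_def by blast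
  then have n: "def_pred_at (Suc n) (\<lambda>e. P (\<lambda>i. e (Suc i)) (e 0))"
    by (rule def_pred_at_mono) simp
  have "def_pred_at (Suc n) (\<lambda>e. P (\<lambda>i. e (case Suc i of 0 \<Rightarrow> n | Suc j \<Rightarrow> j)) (e (case 0 of 0 \<Rightarrow> n | Suc j \<Rightarrow> j)))"
    by (rule def_pred_at_subst[OF n, of "\<lambda>i. case i of 0 \<Rightarrow> n | Suc j \<Rightarrow> j"]) (auto split: nat.split)
  from def_pred_at_proj[OF this] have "def_pred_at n (\<lambda>e. \<exists>a. P (e(n := a)) a)"
    by (simp add: fun_upd_def)
  moreover have "P (e(n := a)) a \<longleftrightarrow> P e a" for e a
  proof -
    have "P (\<lambda>i. (a ## e(n := a)) (Suc i)) ((a ## e(n := a)) 0) \<longleftrightarrow>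
        P (\<lambda>i. (a ## e) (Suc i)) ((a ## e) 0)"
      by (rule def_pred_at_cong[OF n]) (auto split: nat.split)
    then show ?thesis by (simp add: fun_upd_def)
  qed
  ultimately show ?thesis by (auto simp: def_pred_def)
qed

lemma def_pred_all [dintros]:
  assumes "def_pred (\<lambda>e. P (\<lambda>i. e (Suc i)) (e 0))"
  shows "def_pred (\<lambda>e. \<forall>a. P e a)"
  using def_pred_not[OF def_pred_ex[of "\<lambda>e a. \<not> P e a"]] def_pred_not[OF assms] by simp

lemma def_pred_ex1 [dintros]:
  assumes "def_pred (\<lambda>e. P (\<lambda>i. e (Suc i)) (e 0))"
  shows "def_pred (\<lambda>e. \<exists>!a. P e a)"
proof -
  have P': "def_pred (\<lambda>e. P (\<lambda>i. e (Suc (Suc i))) (e 0))"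
    using def_pred_subst[OF assms, of "case_nat 0 (\<lambda>i. Suc (Suc i))"] by simp
  have eq: "def_pred (\<lambda>e. e 0 = e (Suc 0))"
    unfolding def_pred_def by (rule exI[of _ 2], rule def_pred_at_eq) auto
  show ?thesis
    unfolding Ex1_def by (intro def_pred_ex def_pred_conj def_pred_all def_pred_imp assms P' eq)
qed

section \<open>Definable functions and substitution of terms\<close>

lemma def_fun_subst: "def_fun u \<Longrightarrow> def_fun (\<lambda>e. u (\<lambda>i. e (\<sigma> i)))"
  unfolding def_fun_def
  by (drule def_pred_subst[where \<sigma> = "case_nat 0 (\<lambda>i. Suc (\<sigma> i))"]) simp

text \<open>A term is inserted by quantifying over its graph.\<close>

lemma def_pred_insert:
  assumes "def_pred Q" "def_fun u"
  shows "def_pred (\<lambda>e. Q (u e ## e))"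
proof -
  have "def_pred (\<lambda>e. \<exists>a. a = u e \<and> Q (a ## e))"
    by (intro dintros) (use assms in \<open>simp_all add: def_fun_def\<close>)
  then show ?thesis by simp
qed

text \<open>Terms are inserted one at a time. The original variables are kept behind the inserted
  values, so that each further term can still read them.\<close>

lemma def_pred_comp_less:
  "def_pred Q \<Longrightarrow> (\<And>i. i < n \<Longrightarrow> def_fun (T i)) \<Longrightarrow>
    def_pred (\<lambda>e. Q (\<lambda>i. if i < n then T i e else e (i - n)))"
proof (induction n arbitrary: Q)
  case (Suc n)
  \<comment> \<open>\<open>def_pred_insert\<close> puts the new value at index 0, while it belongs
    at index \<open>n\<close>; \<open>?Q3\<close> is the renaming that moves it there. In
    \<open>?Q2\<close> the term \<open>T n\<close> reads the original environment, which starts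
    after the first \<open>n\<close> entries.\<close>
  let ?Q3 = "\<lambda>z. Q (\<lambda>i. z (if i < n then Suc i else if i = n then 0 else i))"
  let ?Q2 = "\<lambda>y. ?Q3 (T n (\<lambda>i. y (i + n)) ## y)"
  have "def_pred ?Q2"
    by (rule def_pred_insert[where Q = ?Q3, OF def_pred_subst[OF Suc.prems(1)]
          def_fun_subst[OF Suc.prems(2)]]) simp
  then have "def_pred (\<lambda>e. ?Q2 (\<lambda>i. if i < n then T i e else e (i - n)))"
    by (rule Suc.IH) (use Suc.prems in auto)
  moreover have "(\<lambda>i. (T n (\<lambda>i. if i + n < n then T (i + n) e else e (i + n - n)) ##
       (\<lambda>i. if i < n then T i e else e (i - n))) (if i < n then Suc i else if i = n then 0 else i))
     = (\<lambda>i. if i < Suc n then T i e else e (i - Suc n))" for e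
    by (auto simp: fun_eq_iff less_Suc_eq split: nat.split)
  ultimately show ?case by simp
qed simp

text \<open>\<open>Q\<close> reads finitely many entries, so finitely many of the \<open>T i\<close>
  matter and the tail left by \<open>def_pred_comp_less\<close> is invisible to it.\<close>

lemma def_pred_comp:
  assumes "def_pred Q" "\<And>i. def_fun (T i)"
  shows "def_pred (\<lambda>e. Q (\<lambda>i. T i e))"
proof -
  obtain n where n: "def_pred_at n Q" using assms def_pred_def by blast
  have "Q (\<lambda>i. T i e) = Q (\<lambda>i. if i < n then T i e else e (i - n))" for e
    by (rule def_pred_at_cong[OF n]) auto
  then show ?thesis using def_pred_comp_less[OF assms, of n] by simp
qed

lemma def_fun_var [dintros]: "def_fun (\<lambda>e. e i)"
proof -
  have "def_pred_at (Suc (Suc i)) (\<lambda>e. e 0 = e (Suc i))" by (rule def_pred_at_eq) auto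
  then show ?thesis by (auto simp: def_fun_def def_pred_def)
qed

lemma def_fun_comp:
  assumes "def_fun u" "\<And>i. def_fun (T i)"
  shows "def_fun (\<lambda>e. u (\<lambda>i. T i e))"
proof -
  have "def_pred (\<lambda>e. (\<lambda>y. y 0 = u (\<lambda>i. y (Suc i))) (\<lambda>i. (case i of 0 \<Rightarrow> (\<lambda>e. e 0) | Suc j \<Rightarrow> (\<lambda>e. T j (\<lambda>i. e (Suc i)))) e))"
    by (rule def_pred_comp)
      (use assms in \<open>auto simp: def_fun_def[of u] def_fun_subst intro: dintros split: nat.split\<close>)
  then show ?thesis by (simp add: def_fun_def)
qed

text \<open>This is where real parameters enter: by \<open>o_minimal\<close> every singleton is
  definable.\<close>

lemma def_fun_const [dintros]: "def_fun (\<lambda>e. c)"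
proof -
  have "{[c]} \<in> S 1"
    unfolding o_minimal by (rule exI[of _ "{{c}}"]) (auto simp: is_interval_def)
  then have "def_pred_at 1 (\<lambda>e. e 0 = c)"
    unfolding def_pred_at_def by (rule bexI[rotated]) simp
  then show ?thesis by (auto simp: def_fun_def def_pred_def)
qed

lemma def_pred_less [dintros]:
  assumes "def_fun u" "def_fun v" shows "def_pred (\<lambda>e. u e < v e)"
proof -
  have "def_pred_at 2 (\<lambda>e. e 0 < e 1)"
    unfolding def_pred_at_def
    by (rule bexI[OF _ less_mem]) (auto simp: numeral_2_eq_2)
  then have "def_pred (\<lambda>e. e 0 < e 1)" by (auto simp: def_pred_def)
  from def_pred_comp[OF this, of "\<lambda>i. if i = 0 then u else v"] assms show ?thesis by simp
qed

lemma def_pred_eq [dintros]: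
  assumes "def_fun u" "def_fun v" shows "def_pred (\<lambda>e. u e = v e)"
proof -
  have "def_pred (\<lambda>e. \<not> u e < v e \<and> \<not> v e < u e)" by (intro dintros assms)
  then show ?thesis by (simp add: order_eq_iff not_less conj_commute)
qed

lemma def_pred_le [dintros]:
  assumes "def_fun u" "def_fun v" shows "def_pred (\<lambda>e. u e \<le> v e)"
proof -
  have "def_pred (\<lambda>e. \<not> v e < u e)" by (intro dintros assms)
  then show ?thesis by (simp add: not_less)
qed

lemma def_fun_add [dintros]:
  assumes "def_fun u" "def_fun v" shows "def_fun (\<lambda>e. u e + v e)"
proof -
  have "def_pred_at 3 (\<lambda>e. e 2 = e 0 + e 1)"
    unfolding def_pred_at_def
    by (rule bexI[OF _ add_mem]) (auto simp: numeral_3_eq_3 numeral_2_eq_2)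
  then have "def_pred (\<lambda>e. e 2 = e 0 + e 1)" by (auto simp: def_pred_def)
  from def_pred_subst[OF this, of "\<lambda>i. if i = 2 then 0 else Suc i"]
  have "def_fun (\<lambda>e. e 0 + e 1)" by (simp add: def_fun_def)
  from def_fun_comp[OF this, of "\<lambda>i. if i = 0 then u else v"] assms show ?thesis by simp
qed

lemma def_fun_mult [dintros]:
  assumes "def_fun u" "def_fun v" shows "def_fun (\<lambda>e. u e * v e)"
proof -
  have "def_pred_at 3 (\<lambda>e. e 2 = e 0 * e 1)"
    unfolding def_pred_at_def
    by (rule bexI[OF _ mult_mem]) (auto simp: numeral_3_eq_3 numeral_2_eq_2)
  then have "def_pred (\<lambda>e. e 2 = e 0 * e 1)" by (auto simp: def_pred_def)
  from def_pred_subst[OF this, of "\<lambda>i. if i = 2 then 0 else Suc i"]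
  have "def_fun (\<lambda>e. e 0 * e 1)" by (simp add: def_fun_def)
  from def_fun_comp[OF this, of "\<lambda>i. if i = 0 then u else v"] assms show ?thesis by simp
qed

lemma def_fun_uminus [dintros]: "def_fun u \<Longrightarrow> def_fun (\<lambda>e. - u e)"
  using def_fun_mult[OF def_fun_const[of "-1"], of u] by simp

lemma def_fun_diff [dintros]:
  assumes "def_fun u" "def_fun v" shows "def_fun (\<lambda>e. u e - v e)"
  using def_fun_add[OF assms(1) def_fun_uminus[OF assms(2)]] by simp

lemma def_fun_sum [dintros]:
  "(\<And>i. i \<in> I \<Longrightarrow> def_fun (u i)) \<Longrightarrow> def_fun (\<lambda>e. \<Sum>i\<in>I. u i e)"
  by (induction I rule: infinite_finite_induct) (auto intro!: dintros)

lemma def_fun_iff_graph: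
  assumes "def_pred (\<lambda>e. R (\<lambda>i. e (Suc i)) (e 0))" "\<And>e a. R e a \<longleftrightarrow> a = u e"
  shows "def_fun u"
  using assms by (simp add: def_fun_def)

lemma def_fun_If [dintros]:
  assumes "def_pred P" "def_fun u" "def_fun v"
  shows "def_fun (\<lambda>e. if P e then u e else v e)"
  by (rule def_fun_iff_graph[where R = "\<lambda>e a. P e \<and> a = u e \<or> \<not> P e \<and> a = v e"])
    (auto intro!: dintros assms(1)[THEN def_pred_subst] assms(2,3)[THEN def_fun_subst])

lemma def_fun_abs [dintros]: "def_fun u \<Longrightarrow> def_fun (\<lambda>e. \<bar>u e\<bar>)"
  unfolding abs_if by (intro dintros)

lemma def_fun_inverse [dintros]:
  assumes "def_fun u" shows "def_fun (\<lambda>e. inverse (u e))"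
  \<comment> \<open>The first disjunct is the convention that the inverse of 0 is 0.\<close>
  by (rule def_fun_iff_graph[where R = "\<lambda>e a. u e = 0 \<and> a = 0 \<or> u e * a = 1"])
    (auto intro!: dintros assms[THEN def_fun_subst] simp: inverse_eq_divide eq_divide_eq mult.commute split: if_splits)

lemma def_fun_divide [dintros]: "def_fun u \<Longrightarrow> def_fun v \<Longrightarrow> def_fun (\<lambda>e. u e / v e)"
  unfolding divide_inverse by (intro dintros)

text \<open>Where no value satisfies \<open>R\<close>, the description is the same real number in
  all environments, namely \<open>THE a. False\<close>. With this constant as default the partial
  graph becomes total.\<close>

lemma def_fun_The:
  assumes "def_pred (\<lambda>e. R (\<lambda>i. e (Suc i)) (e 0))" "\<And>e a b. R e a \<Longrightarrow> R e b \<Longrightarrow> a = b"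
  shows "def_fun (\<lambda>e. THE a. R e a)"
proof (rule def_fun_iff_graph[where R = "\<lambda>e a. R e a \<or> (\<forall>a. \<not> R e a) \<and> a = (THE a. False)"])
  have "def_pred (\<lambda>e. R (\<lambda>i. e (Suc (Suc i))) (e 0))"
    using def_pred_subst[OF assms(1), of "case_nat 0 (\<lambda>i. Suc (Suc i))"] by simp
  then show "def_pred (\<lambda>e. R (\<lambda>i. e (Suc i)) (e 0) \<or> (\<forall>a. \<not> R (\<lambda>i. e (Suc i)) a) \<and> e 0 = (THE a. False))"
    by (intro dintros assms(1)) auto
next
  fix e a
  show "R e a \<or> (\<forall>a. \<not> R e a) \<and> a = (THE a. False) \<longleftrightarrow> a = (THE a. R e a)"
  proof (cases "\<exists>b. R e b")
    case True
    then obtain b where b: "R e b" by blast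
    then have "(THE a. R e a) = b" using assms(2) by blast
    then show ?thesis using b assms(2) by blast
  qed simp
qed

text \<open>A vector is bound coordinate by coordinate, the head outermost. Behind the
  \<open>m\<close> inner binders the head is found at index \<open>m\<close>, so the induction needs
  the rotation \<open>?\<sigma>\<close>, which brings it to the front.\<close>

lemma def_pred_ex_vec [dintros]:
  "def_pred (\<lambda>e. P (\<lambda>i. e (i + m)) (trunc m e)) \<Longrightarrow> def_pred (\<lambda>e. \<exists>x\<in>eucl m. P e x)"
proof (induction m arbitrary: P)
  case 0
  then show ?case by (simp add: eucl_0 trunc_def)
next
  case (Suc m)
  let ?\<sigma> = "\<lambda>i. if i = 0 then m else if i \<le> m then i - 1 else i"
  have eq: "(\<lambda>i. e (Suc (i + m))) = (\<lambda>i. e (?\<sigma> (i + Suc m)))"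
    "e m ## trunc m e = trunc (Suc m) (\<lambda>i. e (?\<sigma> i))" for e
    by (auto simp: fun_eq_iff trunc_def split: nat.split)
  have "def_pred (\<lambda>e. P (\<lambda>i. e (Suc (i + m))) (e m ## trunc m e))"
    unfolding eq using def_pred_subst[OF Suc.prems, of ?\<sigma>] .
  then have "def_pred (\<lambda>e. \<exists>y\<in>eucl m. P (\<lambda>i. e (Suc i)) (e 0 ## y))"
    using Suc.IH[of "\<lambda>e y. P (\<lambda>i. e (Suc i)) (e 0 ## y)"] by simp
  then have "def_pred (\<lambda>e. \<exists>a. \<exists>y\<in>eucl m. P e (a ## y))" by (rule def_pred_ex)
  then show ?case by (simp add: Bex_eucl_Suc)
qed

lemma def_pred_all_vec [dintros]:
  assumes "def_pred (\<lambda>e. P (\<lambda>i. e (i + m)) (trunc m e))"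
  shows "def_pred (\<lambda>e. \<forall>x\<in>eucl m. P e x)"
  using def_pred_not[OF def_pred_ex_vec[of "\<lambda>e x. \<not> P e x"]] def_pred_not[OF assms] by simp

section \<open>Definable sets and integer-valued functions\<close>

definition def_set :: "nat \<Rightarrow> (nat \<Rightarrow> real) set \<Rightarrow> bool" where
  "def_set m A \<longleftrightarrow> A \<subseteq> eucl m \<and> def_pred (\<lambda>e. trunc m e \<in> A)"

lemma def_set_subset: "def_set m A \<Longrightarrow> A \<subseteq> eucl m"
  by (simp add: def_set_def)

lemma def_pred_mem:
  assumes "def_set m A" "\<And>e. V e \<in> eucl m" "\<And>i. i < m \<Longrightarrow> def_fun (\<lambda>e. V e i)"
  shows "def_pred (\<lambda>e. V e \<in> A)"
proof -
  have "def_fun (\<lambda>e. if i < m then V e i else 0)" for i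
    using assms(3)[of i] by (cases "i < m") (auto intro: dintros)
  from def_pred_comp[of "\<lambda>e. trunc m e \<in> A", OF _ this] assms(1)
  have "def_pred (\<lambda>e. trunc m (\<lambda>i. if i < m then V e i else 0) \<in> A)"
    by (simp add: def_set_def)
  moreover have "trunc m (\<lambda>i. if i < m then V e i else 0) = V e" for e
    using trunc_eucl[OF assms(2)[of e]] by (auto simp: trunc_def fun_eq_iff)
  ultimately show ?thesis by simp
qed

lemma def_setI:
  assumes "def_pred (\<lambda>e. P (trunc m e))"
  shows "def_set m {x \<in> eucl m. P x}"
  using assms by (auto simp: def_set_def)

lemma def_fun_trunc [dintros]: "def_fun (\<lambda>e. trunc m (\<lambda>i. e (\<sigma> i)) j)"
  unfolding trunc_def by (intro dintros)

lemma def_fun_vcons [dintros]: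
  "def_fun u \<Longrightarrow> (\<And>i. def_fun (\<lambda>e. V e i)) \<Longrightarrow> def_fun (\<lambda>e. (u e ## V e) j)"
  by (cases j) auto

text \<open>Any set of integers may serve as \<open>P\<close>, since only its members in the finite
  range of \<open>g\<close> count.\<close>

lemma def_int_pred:
  assumes "def_int g" shows "def_pred (\<lambda>e. P (g e))"
proof -
  have "def_pred (\<lambda>e. \<exists>k\<in>range g \<inter> {k. P k}. g e = k)"
    using assms by (intro dintros) (auto simp: def_int_def)
  then show ?thesis by (rule back_subst[of def_pred]) auto
qed

lemma def_int_comp:
  assumes "def_int g" "\<And>i. def_fun (T i)" shows "def_int (\<lambda>e. g (\<lambda>i. T i e))"
  unfolding def_int_def
proof safe
  have "range (\<lambda>e. g (\<lambda>i. T i e)) \<subseteq> range g" by auto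
  then show "finite (range (\<lambda>e. g (\<lambda>i. T i e)))"
    using assms(1) finite_subset by (auto simp: def_int_def)
  fix k show "def_pred (\<lambda>e. g (\<lambda>i. T i e) = k)"
    using def_pred_comp[of "\<lambda>e. g e = k" T] assms by (auto simp: def_int_def)
qed

lemma def_int_subst: "def_int g \<Longrightarrow> def_int (\<lambda>e. g (\<lambda>i. e (\<sigma> i)))"
  by (rule def_int_comp) (auto intro: dintros)

lemma def_int_const [dintros]: "def_int (\<lambda>e. c)"
  unfolding def_int_def by (auto intro: dintros)

text \<open>On finite ranges the levels of any combination are finite unions of intersections of
  levels, whatever the operation.\<close>

lemma def_int_binary:
  assumes "def_int g" "def_int h" shows "def_int (\<lambda>e. F (g e) (h e))"
  unfolding def_int_def
proof safe
  have "range (\<lambda>e. F (g e) (h e)) \<subseteq> (\<lambda>(i, j). F i j) ` (range g \<times> range h)" by auto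
  then show "finite (range (\<lambda>e. F (g e) (h e)))"
    by (rule finite_subset) (use assms in \<open>simp add: def_int_def\<close>)
  fix k
  have "def_pred (\<lambda>e. \<exists>i\<in>range g. g e = i \<and> F i (h e) = k)"
    using assms by (intro dintros def_int_pred) (auto simp: def_int_def)
  then show "def_pred (\<lambda>e. F (g e) (h e) = k)" by (rule back_subst[of def_pred]) auto
qed

lemma def_int_add [dintros]: "def_int g \<Longrightarrow> def_int h \<Longrightarrow> def_int (\<lambda>e. g e + h e)"
  by (rule def_int_binary)

lemma def_int_diff [dintros]: "def_int g \<Longrightarrow> def_int h \<Longrightarrow> def_int (\<lambda>e. g e - h e)"
  by (rule def_int_binary)

lemma def_int_mult [dintros]: "def_int g \<Longrightarrow> def_int h \<Longrightarrow> def_int (\<lambda>e. g e * h e)"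
  by (rule def_int_binary)

lemma def_int_sum [dintros]:
  "(\<And>i. i \<in> I \<Longrightarrow> def_int (g i)) \<Longrightarrow> def_int (\<lambda>e. \<Sum>i\<in>I. g i e)"
  by (induction I rule: infinite_finite_induct) (auto intro!: dintros)

lemma def_int_of_bool [dintros]: "def_pred P \<Longrightarrow> def_int (\<lambda>e. of_bool (P e))"
  unfolding def_int_def
proof safe
  assume P: "def_pred P"
  have "range (\<lambda>e. of_bool (P e)) \<subseteq> {0, 1::int}" by auto
  then show "finite (range (\<lambda>e. of_bool (P e) :: int))" by (rule finite_subset) auto
  fix k :: int
  have "def_pred (\<lambda>e. P e \<and> k = 1 \<or> \<not> P e \<and> k = 0)" using P by (intro dintros)
  then show "def_pred (\<lambda>e. of_bool (P e) = k)" by (rule back_subst[of def_pred]) auto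
qed

end

section \<open>Definable subsets of the line\<close>

lemma finite_if_all_eq: "(\<And>x y. x \<in> A \<Longrightarrow> y \<in> A \<Longrightarrow> x = y) \<Longrightarrow> finite A"
  by (metis finite.simps finite_subset insertI1 subsetI)

text \<open>A point with members of the interval on both sides is interior. So a frontier point
  bounds the interval from above or from below, and each kind occurs at most once.\<close>

lemma finite_frontier_interval:
  fixes I :: "real set"
  assumes "is_interval I"
  shows "finite (frontier I)"
proof (rule finite_subset)
  let ?U = "{x \<in> closure I. \<forall>a\<in>I. a \<le> x}" and ?L = "{x \<in> closure I. \<forall>a\<in>I. x \<le> a}"
  have "y \<le> x" if "x \<in> ?U" "y \<in> ?U" for x y
    using closure_minimal[of I "{..x}"] that by auto
  then have "finite ?U" by (intro finite_if_all_eq antisym)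
  moreover have "x \<le> y" if "x \<in> ?L" "y \<in> ?L" for x y
    using closure_minimal[of I "{x..}"] that by auto
  then have "finite ?L" by (intro finite_if_all_eq antisym)
  ultimately show "finite (?U \<union> ?L)" by blast
  show "frontier I \<subseteq> ?U \<union> ?L"
  proof
    fix x assume x: "x \<in> frontier I"
    show "x \<in> ?U \<union> ?L"
    proof (rule ccontr)
      assume "x \<notin> ?U \<union> ?L"
      then obtain a b where ab: "a \<in> I" "b \<in> I" "a < x" "x < b"
        using x by (auto simp: frontier_def not_le)
      then have "{a<..<b} \<subseteq> I"
        using assms unfolding is_interval_1 by (meson greaterThanLessThan_iff less_imp_le subsetI)
      then have "x \<in> interior I"
        using ab interior_maximal[of "{a<..<b}" I] by auto
      then show False using x by (simp add: frontier_def)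
    qed
  qed
qed

lemma finite_frontier_Union:
  assumes "finite F" "\<And>A. A \<in> F \<Longrightarrow> finite (frontier A)"
  shows "finite (frontier (\<Union>F))"
  using assms
proof (induction F rule: finite_induct)
  case (insert A F)
  have "frontier (A \<union> \<Union>F) \<subseteq> frontier A \<union> frontier (\<Union>F)"
    by (rule frontier_Un_subset)
  then show ?case using insert by (auto intro: finite_subset)
qed simp

lemma infinite_interval_contains:
  fixes I :: "real set"
  assumes "is_interval I" "infinite I"
  obtains a b where "a < b" "{a<..<b} \<subseteq> I"
proof -
  obtain x y where "x \<in> I" "y \<in> I" "x \<noteq> y" using assms(2) finite_if_all_eq by metis
  then obtain a b where ab: "a \<in> I" "b \<in> I" "a < b" by (metis linorder_neqE)
  then have "{a<..<b} \<subseteq> I"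
    using assms(1) unfolding is_interval_1 by (meson greaterThanLessThan_iff less_imp_le subsetI)
  then show thesis using that ab by blast
qed

text \<open>Equality of cardinalities from a correspondence given as a relation, the form that a
  formula can express.\<close>

lemma card_unique_rel:
  assumes "\<And>b. b \<in> A \<Longrightarrow> \<exists>!c. c \<in> B \<and> R b c" "\<And>c. c \<in> B \<Longrightarrow> \<exists>!b. b \<in> A \<and> R b c"
  shows "card A = card B"
proof -
  let ?f = "\<lambda>b. THE c. c \<in> B \<and> R b c"
  have f: "?f b \<in> B \<and> R b (?f b)" if "b \<in> A" for b
    using theI'[OF assms(1)[OF that]] .
  have "bij_betw ?f A B"
  proof (rule bij_betw_imageI)
    show "inj_on ?f A" by (rule inj_onI) (metis assms(2) f)
    show "?f ` A = B"
    proof safe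
      fix c assume "c \<in> B"
      then obtain b where "b \<in> A" "R b c" using assms(2) by blast
      then have "?f b = c" using \<open>c \<in> B\<close> assms(1) by (intro the1_equality) auto
      then show "c \<in> ?f ` A" using \<open>b \<in> A\<close> by blast
    qed (use f in blast)
  qed
  then show ?thesis by (rule bij_betw_same_card)
qed

text \<open>Counting becomes a formula by recursion on the count: the largest element below
  \<open>t\<close> serves as witness, and exactly one element fewer lies below it.\<close>

lemma card_below_ge_Suc:
  fixes D :: "real set"
  assumes "finite D"
  shows "Suc j \<le> card {s \<in> D. s < t} \<longleftrightarrow> (\<exists>s\<in>D. s < t \<and> j \<le> card {r \<in> D. r < s})"
proof
  let ?X = "{s \<in> D. s < t}"
  assume *: "Suc j \<le> card ?X"
  then have ne: "?X \<noteq> {}" by (metis card.empty not_less_eq_eq zero_le)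
  have fin: "finite ?X" using assms by simp
  define s where "s = Max ?X"
  have s: "s \<in> ?X" unfolding s_def using Max_in[OF fin ne] .
  have max: "r \<le> s" if "r \<in> ?X" for r unfolding s_def using Max_ge[OF fin that] .
  have "{r \<in> D. r < s} = ?X - {s}"
  proof (rule Set.set_eqI)
    fix r
    show "r \<in> {r \<in> D. r < s} \<longleftrightarrow> r \<in> ?X - {s}"
      using s max[of r] by (cases "r = s") auto
  qed
  then have "card {r \<in> D. r < s} = card ?X - 1"
    using card_Diff_singleton[OF s] by simp
  then show "\<exists>s\<in>D. s < t \<and> j \<le> card {r \<in> D. r < s}" using * s by (intro bexI[of _ s]) auto
next
  assume "\<exists>s\<in>D. s < t \<and> j \<le> card {r \<in> D. r < s}"
  then obtain s where s: "s \<in> D" "s < t" "j \<le> card {r \<in> D. r < s}" by blast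
  have "card (insert s {r \<in> D. r < s}) \<le> card {s \<in> D. s < t}"
    by (rule card_mono) (use assms s in auto)
  then show "Suc j \<le> card {s \<in> D. s < t}" using s assms by simp
qed

context o_minimal_field_expansion
begin

text \<open>The formula may be witnessed in many variables although it reads only the first.
  Identifying all variables brings it down to the one-dimensional axiom.\<close>

lemma def_pred_real_intervals:
  assumes "def_pred (\<lambda>e. R (e 0))"
  obtains F where "finite F" "\<And>I. I \<in> F \<Longrightarrow> is_interval I" "{t. R t} = \<Union>F"
proof -
  obtain n where "def_pred_at n (\<lambda>e. R (e 0))" using assms def_pred_def by blast
  from def_pred_at_subst[OF this, of "\<lambda>i. 0" 1] obtain A
    where A: "A \<in> S 1" "\<forall>e. R (e 0) \<longleftrightarrow> map e [0..<1] \<in> A"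
    unfolding def_pred_at_def by (meson zero_less_one)
  have "R t \<longleftrightarrow> [t] \<in> A" for t using A(2)[rule_format, of "\<lambda>i. t"] by simp
  moreover have "\<exists>t. x = [t]" if "x \<in> A" for x
    using subset_space[OF A(1)] that by (cases x) auto
  ultimately have "A = (\<lambda>x. [x]) ` {t. R t}" by blast
  moreover obtain F where F: "finite F" "\<forall>I\<in>F. is_interval I" "A = (\<lambda>x. [x]) ` \<Union>F"
    using A(1) o_minimal by auto
  ultimately have "(\<lambda>x. [x]) ` {t. R t} = (\<lambda>x. [x]) ` \<Union>F" by simp
  then have "{t. R t} = \<Union>F" by (subst (asm) inj_image_eq_iff) (auto intro: injI)
  then show thesis using that F by blast
qed

lemma finite_frontier_def:
  assumes "def_pred (\<lambda>e. R (e 0))" shows "finite (frontier {t. R t})"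
proof -
  obtain F where F: "finite F" "\<And>I. I \<in> F \<Longrightarrow> is_interval I" "{t. R t} = \<Union>F"
    using def_pred_real_intervals[OF assms] by blast
  show ?thesis
    unfolding F(3) by (intro finite_frontier_Union F(1) finite_frontier_interval F(2))
qed

lemma infinite_def_contains_interval:
  assumes "def_pred (\<lambda>e. R (e 0))" "infinite {t. R t}"
  obtains a b where "a < b" "\<And>t. a < t \<Longrightarrow> t < b \<Longrightarrow> R t"
proof -
  obtain F where F: "finite F" "\<And>I. I \<in> F \<Longrightarrow> is_interval I" "{t. R t} = \<Union>F"
    using def_pred_real_intervals[OF assms(1)] by blast
  then obtain I where I: "I \<in> F" "infinite I" using assms(2) by (metis finite_Union)
  obtain a b where ab: "a < b" "{a<..<b} \<subseteq> I"
    using infinite_interval_contains[OF F(2)[OF I(1)] I(2)] .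
  have "{a<..<b} \<subseteq> {t. R t}" using ab(2) I(1) F(3) by blast
  then show thesis by (intro that[OF ab(1)]) auto
qed

text \<open>The environment is frozen: its entries become real constants, which are admissible
  parameters.\<close>

lemma def_pred_fiber:
  assumes "def_pred (\<lambda>e. P (\<lambda>i. e (Suc i)) (e 0))"
  shows "def_pred (\<lambda>e'. P e (e' 0))"
proof -
  have "def_fun (case i of 0 \<Rightarrow> (\<lambda>e'. e' 0) | Suc j \<Rightarrow> (\<lambda>e'. e j))" for i
    by (cases i) (auto intro: dintros)
  from def_pred_comp[where T = "\<lambda>i. case i of 0 \<Rightarrow> (\<lambda>e'. e' 0) | Suc j \<Rightarrow> (\<lambda>e'. e j)", OF assms this]
  show ?thesis by simp
qed

lemma def_pred_fiber_subst:
  assumes "def_pred (\<lambda>e. P (\<lambda>i. e (Suc i)) (e 0))"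
  shows "def_pred (\<lambda>e. P (\<lambda>i. e (\<sigma> i)) (e k))"
  using def_pred_subst[OF assms, of "case_nat k \<sigma>"] by simp

text \<open>Having points inside and outside at arbitrarily small distance is a first-order
  condition in the point and the parameters of the fiber.\<close>

lemma def_pred_frontier:
  assumes "def_pred (\<lambda>e. P (\<lambda>i. e (Suc i)) (e 0))"
  shows "def_pred (\<lambda>e. e 0 \<in> frontier {t. P (\<lambda>i. e (Suc i)) t})"
  unfolding frontier_straddle dist_real_def mem_Collect_eq Bex_def
  by (intro dintros def_pred_fiber_subst[of P, OF assms])

lemma def_pred_card_below_ge:
  assumes "def_pred (\<lambda>e. e 0 \<in> D (\<lambda>i. e (Suc i)))" "\<And>e. finite (D e)"
  shows "def_pred (\<lambda>e. j \<le> card {s \<in> D (\<lambda>i. e (Suc i)). s < e 0})"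
proof (induction j)
  case 0
  then show ?case by (simp add: def_pred_const)
next
  case (Suc j)
  note D = def_pred_fiber_subst[where P = "\<lambda>e t. t \<in> D e", OF assms(1)]
    and IH = def_pred_fiber_subst[where P = "\<lambda>e t. j \<le> card {s \<in> D e. s < t}", OF Suc]
  show ?case
    unfolding card_below_ge_Suc[OF assms(2)] Bex_def by (intro dintros D IH)
qed

lemma def_pred_card_below_eq:
  assumes "def_pred (\<lambda>e. e 0 \<in> D (\<lambda>i. e (Suc i)))" "\<And>e. finite (D e)"
  shows "def_pred (\<lambda>e. card {s \<in> D (\<lambda>i. e (Suc i)). s < e 0} = j)"
proof -
  have eq: "n = j \<longleftrightarrow> j \<le> n \<and> \<not> Suc j \<le> n" for n by auto
  show ?thesis
    unfolding eq[of "card _"]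
    by (intro def_pred_conj def_pred_not def_pred_card_below_ge[of D, OF assms])
qed

lemma def_int_card:
  assumes "def_pred (\<lambda>e. e 0 \<in> D (\<lambda>i. e (Suc i)))" "\<And>e. finite (D e)" "\<And>e. card (D e) \<le> N"
  shows "def_int (\<lambda>e. int (card (D e)))"
proof -
  note D = def_pred_fiber_subst[where P = "\<lambda>e t. t \<in> D e", OF assms(1)]
  have C: "def_pred (\<lambda>e. j \<le> card (D e))" for j
  proof (cases j)
    case 0
    then show ?thesis by (simp add: def_pred_const)
  next
    case (Suc k)
    note B = def_pred_fiber_subst[where P = "\<lambda>e t. k \<le> card {s \<in> D e. s < t}",
        OF def_pred_card_below_ge[of D, OF assms(1,2)]]
    have "j \<le> card (D e) \<longleftrightarrow> (\<exists>s. s \<in> D e \<and> k \<le> card {r \<in> D e. r < s})" for e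
    proof -
      \<comment> \<open>From a point above all elements the count below a point is the full count; 0
        is inserted so that \<open>Max\<close> also makes sense for an empty set.\<close>
      have "s < Max (insert 0 (D e)) + 1" if "s \<in> D e" for s
      proof -
        have "s \<le> Max (insert 0 (D e))" by (rule Max_ge) (use assms(2) that in auto)
        then show ?thesis by linarith
      qed
      then obtain t where t: "\<forall>s\<in>D e. s < t" by blast
      then have "{s \<in> D e. s < t} = D e" by auto
      then show ?thesis
        using card_below_ge_Suc[OF assms(2)[of e], of k t] t Suc by auto
    qed
    then show ?thesis by (simp only:) (intro dintros D B)
  qed
  show ?thesis
    unfolding def_int_def
  proof safe
    have "range (\<lambda>e. int (card (D e))) \<subseteq> int ` {..N}" using assms(3) by auto
    then show "finite (range (\<lambda>e. int (card (D e))))" by (rule finite_subset) auto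
    fix k :: int
    have eq: "int n = k \<longleftrightarrow> 0 \<le> k \<and> nat k \<le> n \<and> \<not> Suc (nat k) \<le> n" for n by auto
    show "def_pred (\<lambda>e. int (card (D e)) = k)"
      unfolding eq by (intro def_pred_conj def_pred_not def_pred_const C)
  qed
qed

text \<open>With a uniform bound on the number of frontier points, finitely many formulas suffice:
  each fiber is cut at its frontier points and the pieces are numbered by position.\<close>

lemma fiber_decomposition:
  assumes P: "def_pred (\<lambda>e. P (\<lambda>i. e (Suc i)) (e 0))"
    and N: "\<And>e. card (frontier {t. P e t}) \<le> N"
  obtains M :: nat and Q where
    "\<forall>j<M. def_pred (\<lambda>e. Q j (\<lambda>i. e (Suc i)) (e 0))"
    "\<forall>e t. P e t \<longleftrightarrow> (\<exists>j<M. Q j e t)"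
    "\<forall>j k e t. Q j e t \<longrightarrow> Q k e t \<longrightarrow> j = k"
    "\<forall>j<M. (\<forall>e a b. Q j e a \<longrightarrow> Q j e b \<longrightarrow> a = b) \<or>
        (\<forall>e. open {t. Q j e t} \<and> is_interval {t. Q j e t})"
proof -
  define D where "D e = frontier {t. P e t}" for e
  have finD: "finite (D e)" for e
    unfolding D_def by (intro finite_frontier_def def_pred_fiber P)
  have D: "def_pred (\<lambda>e. e 0 \<in> D (\<lambda>i. e (Suc i)))"
    unfolding D_def by (intro def_pred_frontier P)
  define c where "c e t = card {s \<in> D e. s < t}" for e t
  have c_le: "c e t \<le> N" for e t
  proof -
    have "c e t \<le> card (D e)" unfolding c_def by (intro card_mono finD) auto
    then show ?thesis using N[of e] by (simp add: D_def)
  qed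
  \<comment> \<open>Even \<open>j\<close> selects the frontier point with \<open>j div 2\<close>
    frontier points below it, odd \<open>j\<close> the gap with that many below. The count is at
    most \<open>N\<close>, so the indices stay below \<open>2 * N + 2\<close>.\<close>
  define Q where "Q j e t \<longleftrightarrow> P e t \<and> c e t = j div 2 \<and> (t \<in> D e \<longleftrightarrow> even j)" for j e t
  have c_const: "s \<notin> D e" if "c e a = c e b" "a \<le> s" "s < b" for e a b s
  proof
    assume s: "s \<in> D e"
    have "{r \<in> D e. r < a} \<subseteq> {r \<in> D e. r < b}" "s \<in> {r \<in> D e. r < b}" "s \<notin> {r \<in> D e. r < a}"
      using s that(2,3) by auto
    then have "{r \<in> D e. r < a} \<subset> {r \<in> D e. r < b}" by blast
    then have "c e a < c e b"
      unfolding c_def by (rule psubset_card_mono[rotated]) (simp add: finD)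
    then show False using that by simp
  qed
  show thesis
  proof (rule that[of "2 * N + 2" Q]; intro allI impI)
    fix j
    note [dintros] = P D def_pred_card_below_eq[of D, OF D finD]
    show "def_pred (\<lambda>e. Q j (\<lambda>i. e (Suc i)) (e 0))"
      unfolding Q_def c_def by (intro dintros)
    show "(\<forall>e a b. Q j e a \<longrightarrow> Q j e b \<longrightarrow> a = b) \<or>
        (\<forall>e. open {t. Q j e t} \<and> is_interval {t. Q j e t})"
    proof (cases "even j")
      case True
      have "a = b" if "Q j e a" "Q j e b" for e a b
      proof -
        have "c e a = c e b" "a \<in> D e" "b \<in> D e" using that True by (auto simp: Q_def)
        then show ?thesis
          using c_const[of e a b a] c_const[of e b a b] by (cases a b rule: linorder_cases) auto
      qed
      then show ?thesis by blast
    next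
      case False
      have *: "Q j e s" if "Q j e a" "Q j e b" "a \<le> s" "s \<le> b" for e a b s
      proof (cases "s = b")
        case neq: False
        have ab: "P e a" "c e a = j div 2" "c e b = j div 2" "b \<notin> D e"
          using that False by (auto simp: Q_def)
        have nD: "r \<notin> D e" if "r \<in> {a..b}" for r
          using c_const[of e a b r] ab that by (cases "r = b") auto
        then have "{a..b} \<inter> frontier {t. P e t} = {}" by (auto simp: D_def)
        moreover have "a \<in> {a..b} \<inter> {t. P e t}" using ab that(3,4) by simp
        \<comment> \<open>A connected set that meets the fiber but not its frontier lies inside the
          fiber.\<close>
        ultimately have "{a..b} - {t. P e t} = {}"
          using connected_Int_frontier[OF connected_Icc, of a b "{t. P e t}"] by blast
        then have Ps: "P e s" using that by auto
        have "c e s = j div 2"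
        proof -
          have "c e a \<le> c e s" "c e s \<le> c e b"
            unfolding c_def using that(3,4) by (intro card_mono; force simp: finD)+
          then show ?thesis using ab by simp
        qed
        then show ?thesis using Ps nD[of s] that False by (auto simp: Q_def)
      qed (use that in simp)
      have "is_interval {t. Q j e t}" for e
        unfolding is_interval_1 using * by blast
      moreover have "open {t. Q j e t}" for e
        unfolding open_contains_ball
      proof safe
        fix t assume t: "Q j e t"
        then have "t \<notin> D e" "P e t" using False by (auto simp: Q_def)
        then have "t \<in> interior {t. P e t} - D e"
          using closure_subset[of "{t. P e t}"] by (auto simp: D_def frontier_def)
        moreover have "open (interior {t. P e t} - D e)"
          by (intro open_Diff open_interior finite_imp_closed finD)
        ultimately obtain r where r: "r > 0" "ball t r \<subseteq> interior {t. P e t} - D e"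
          by (meson open_contains_ball)
        have "ball t r \<subseteq> {t. Q j e t}"
        proof safe
          fix s assume s: "s \<in> ball t r"
          then have sP: "P e s" "s \<notin> D e" using r interior_subset by blast+
          have "{r \<in> D e. r < s} = {r \<in> D e. r < t}"
          proof (rule ccontr)
            assume "\<not> ?thesis"
            then obtain q where q: "q \<in> D e" "q < s \<longleftrightarrow> \<not> q < t" by blast
            then have "q \<in> ball t r" using s by (auto simp: dist_real_def split: if_splits)
            then show False using r q by blast
          qed
          then have "c e s = c e t" by (simp add: c_def)
          then show "Q j e s" using sP t False by (simp add: Q_def)
        qed
        then show "\<exists>r>0. ball t r \<subseteq> {t. Q j e t}" using r by blast
      qed
      ultimately show ?thesis by blast
    qed
  next
    fix e t
    show "P e t \<longleftrightarrow> (\<exists>j<2 * N + 2. Q j e t)"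
    proof
      assume "P e t"
      then have "Q (if t \<in> D e then 2 * c e t else 2 * c e t + 1) e t" by (auto simp: Q_def)
      moreover have "(if t \<in> D e then 2 * c e t else 2 * c e t + 1) < 2 * N + 2" using c_le[of e t] by auto
      ultimately show "\<exists>j<2 * N + 2. Q j e t" by blast
    qed (auto simp: Q_def)
  next
    fix j k e t assume "Q j e t" "Q k e t"
    then have "j div 2 = k div 2" "even j = even k" by (auto simp: Q_def)
    then show "j = k" by presburger
  qed
qed

end

section \<open>Cells and the Baire category theorem\<close>

lemma Euclidean_space_eq: "Euclidean_space m = top_of_set (eucl m)"
  by (simp add: Euclidean_space_def eucl_def euclidean_product_topology)

text \<open>Boxes in the first \<open>m\<close> coordinates can be written as formulas, and on
  \<open>eucl m\<close> they form neighborhood bases. The remaining coordinates agree by membership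
  in \<open>eucl m\<close>.\<close>

definition near :: "nat \<Rightarrow> real \<Rightarrow> (nat \<Rightarrow> real) \<Rightarrow> (nat \<Rightarrow> real) \<Rightarrow> bool" where
  "near m \<delta> a x \<longleftrightarrow> (\<forall>i<m. \<bar>x i - a i\<bar> < \<delta>)"

lemma open_near: "open {x. near m \<delta> a x}"
proof -
  have "{x. near m \<delta> a x} = (\<Inter>i\<in>{..<m}. {x. \<bar>x i - a i\<bar> < \<delta>})"
    by (auto simp: near_def)
  moreover have "open {x::nat \<Rightarrow> real. \<bar>x i - a i\<bar> < \<delta>}" for i
    by (intro open_Collect_less continuous_intros) auto
  ultimately show ?thesis by auto
qed

text \<open>At indices from \<open>m\<close> on both points vanish, so a minimum over the first
  \<open>m\<close> radii is enough; the 1 in it covers \<open>m = 0\<close>.\<close>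

lemma open_contains_near:
  assumes "open V" "a \<in> V" "a \<in> eucl m"
  obtains \<delta> where "\<delta> > 0" "\<And>x. x \<in> eucl m \<Longrightarrow> near m \<delta> a x \<Longrightarrow> x \<in> V"
proof -
  have "openin (product_topology (\<lambda>i. euclidean) UNIV) V"
    using assms(1) by (simp add: euclidean_product_topology)
  from product_topology_open_contains_basis[OF this assms(2)] obtain X
    where X: "a \<in> Pi\<^sub>E UNIV X" "\<And>i. openin euclidean (X i)" "Pi\<^sub>E UNIV X \<subseteq> V"
    by blast
  then have X_open: "\<And>i. open (X i)" by simp
  have "\<forall>i. \<exists>r>0. ball (a i) r \<subseteq> X i"
    using X(1) X_open by (meson PiE_E UNIV_I open_contains_ball)
  then obtain r where r: "\<And>i. r i > 0" "\<And>i. ball (a i) (r i) \<subseteq> X i" by metis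
  define \<delta> where "\<delta> = Min (insert 1 (r ` {..<m}))"
  have "\<delta> > 0" using r(1) by (auto simp: \<delta>_def)
  moreover have "x \<in> V" if x: "x \<in> eucl m" "near m \<delta> a x" for x
  proof -
    have "x i \<in> X i" for i
    proof (cases "i < m")
      case True
      then have "\<delta> \<le> r i" by (auto simp: \<delta>_def)
      moreover have "\<bar>x i - a i\<bar> < \<delta>" using x(2) True by (simp add: near_def)
      ultimately have "x i \<in> ball (a i) (r i)" by (simp add: dist_real_def abs_minus_commute)
      then show ?thesis using r(2) by blast
    next
      case False
      then have "x i = a i" using x(1) assms(3) by (simp add: eucl_def)
      then show ?thesis using X(1) by auto
    qed
    then show ?thesis using X(3) by auto
  qed
  ultimately show thesis by (rule that)
qed

lemma openin_eucl_iff: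
  "openin (top_of_set (eucl m)) U \<longleftrightarrow>
    U \<subseteq> eucl m \<and> (\<forall>a\<in>U. \<exists>\<delta>>0. \<forall>x\<in>eucl m. near m \<delta> a x \<longrightarrow> x \<in> U)"
proof safe
  assume U: "openin (top_of_set (eucl m)) U"
  then show sub: "x \<in> U \<Longrightarrow> x \<in> eucl m" for x using openin_imp_subset by blast
  obtain V where V: "open V" "U = eucl m \<inter> V" using U by (auto simp: openin_open)
  fix a assume "a \<in> U"
  then obtain \<delta> where "\<delta> > 0" "\<And>x. x \<in> eucl m \<Longrightarrow> near m \<delta> a x \<Longrightarrow> x \<in> V"
    using V open_contains_near[of V a m] by blast
  then show "\<exists>\<delta>>0. \<forall>x\<in>eucl m. near m \<delta> a x \<longrightarrow> x \<in> U" using V by auto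
next
  assume U: "U \<subseteq> eucl m" "\<forall>a\<in>U. \<exists>\<delta>>0. \<forall>x\<in>eucl m. near m \<delta> a x \<longrightarrow> x \<in> U"
  show "openin (top_of_set (eucl m)) U"
  proof (subst openin_subopen, safe)
    fix a assume a: "a \<in> U"
    then obtain \<delta> where \<delta>: "\<delta> > 0" "\<forall>x\<in>eucl m. near m \<delta> a x \<longrightarrow> x \<in> U" using U by blast
    have "openin (top_of_set (eucl m)) (eucl m \<inter> {x. near m \<delta> a x})"
      using open_near by (auto simp: openin_open)
    moreover have "a \<in> eucl m \<inter> {x. near m \<delta> a x}" using a U \<delta> by (auto simp: near_def)
    ultimately show "\<exists>T. openin (top_of_set (eucl m)) T \<and> a \<in> T \<and> T \<subseteq> U" using \<delta>(2) by blast
  qed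
qed

lemma near_imp_continuous_on:
  fixes f :: "(nat \<Rightarrow> real) \<Rightarrow> real"
  assumes "\<And>a \<epsilon>. a \<in> Q \<Longrightarrow> \<epsilon> > 0 \<Longrightarrow> \<exists>\<delta>>0. \<forall>x\<in>Q. near m \<delta> a x \<longrightarrow> \<bar>f x - f a\<bar> < \<epsilon>"
  shows "continuous_on Q f"
  unfolding continuous_on_topological
proof (intro ballI allI impI)
  fix a B assume a: "a \<in> Q" "open B" "f a \<in> B"
  then obtain \<epsilon> where \<epsilon>: "\<epsilon> > 0" "ball (f a) \<epsilon> \<subseteq> B" by (meson open_contains_ball)
  obtain \<delta> where \<delta>: "\<delta> > 0" "\<forall>x\<in>Q. near m \<delta> a x \<longrightarrow> \<bar>f x - f a\<bar> < \<epsilon>"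
    using assms[OF a(1) \<epsilon>(1)] by blast
  show "\<exists>A. open A \<and> a \<in> A \<and> (\<forall>y\<in>Q. y \<in> A \<longrightarrow> f y \<in> B)"
  proof (intro exI conjI ballI impI)
    show "open {x. near m \<delta> a x}" by (rule open_near)
    show "a \<in> {x. near m \<delta> a x}" using \<delta> by (simp add: near_def)
    fix y assume "y \<in> Q" "y \<in> {x. near m \<delta> a x}"
    then have "\<bar>f y - f a\<bar> < \<epsilon>" using \<delta>(2) by simp
    then have "f y \<in> ball (f a) \<epsilon>" by (simp add: dist_real_def abs_minus_commute)
    then show "f y \<in> B" using \<epsilon>(2) by blast
  qed
qed

lemma continuous_on_vcons [continuous_intros]:
  fixes f :: "'a::topological_space \<Rightarrow> real"
  assumes "continuous_on A f" "continuous_on A g"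
  shows "continuous_on A (\<lambda>x. f x ## g x)"
proof (rule continuous_on_coordinatewise_then_product)
  fix i
  show "continuous_on A (\<lambda>x. (f x ## g x) i)"
    using assms continuous_on_product_then_coordinatewise[OF assms(2)] by (cases i) auto
qed

lemma continuous_on_tail [continuous_intros]:
  fixes f :: "'a::topological_space \<Rightarrow> nat \<Rightarrow> real"
  assumes "continuous_on A f"
  shows "continuous_on A (\<lambda>x i. f x (Suc i))"
  by (rule continuous_on_coordinatewise_then_product)
    (rule continuous_on_product_then_coordinatewise[OF assms])

text \<open>Open simplices serve as model cells because they are the building blocks of the Euler
  characteristic. One vertex is the origin, so the coordinates are barycentric with one weight left
  out.\<close>

definition std_simplex :: "nat \<Rightarrow> (nat \<Rightarrow> real) set" where
  "std_simplex d = {x \<in> eucl d. (\<forall>i<d. 0 < x i) \<and> (\<Sum>i<d. x i) < 1}"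

lemma std_simplex_subset: "std_simplex d \<subseteq> eucl d"
  by (auto simp: std_simplex_def)

text \<open>Over a point \<open>u\<close> the new coordinate fills an open interval of length
  \<open>1 - (\<Sum>i<d. u i)\<close>. This lets a band over a cell be parametrized by a simplex of
  one dimension more.\<close>

lemma vcons_in_std_simplex:
  "a ## u \<in> std_simplex (Suc d) \<longleftrightarrow> u \<in> std_simplex d \<and> 0 < a \<and> a < 1 - (\<Sum>i<d. u i)"
proof -
  have "(\<forall>i<Suc d. 0 < (a ## u) i) \<longleftrightarrow> 0 < a \<and> (\<forall>i<d. 0 < u i)"
    by (auto simp: All_less_Suc2)
  then show ?thesis
    by (auto simp: std_simplex_def sum.lessThan_Suc_shift simp del: sum.lessThan_Suc)
qed

lemma std_simplex_sum_less: "u \<in> std_simplex d \<Longrightarrow> (\<Sum>i<d. u i) < 1"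
  by (simp add: std_simplex_def)

lemma std_simplex_nonempty: "std_simplex d \<noteq> {}"
proof -
  let ?x = "\<lambda>i. if i < d then 1 / (d + 1) else 0 :: real"
  have "(\<Sum>i<d. ?x i) = d * (1 / (d + 1))" by simp
  also have "\<dots> < 1" by (simp add: field_simps)
  finally have "?x \<in> std_simplex d" by (simp add: std_simplex_def eucl_def)
  then show ?thesis by blast
qed

lemma openin_std_simplex: "openin (top_of_set (eucl d)) (std_simplex d)"
proof -
  let ?V = "(\<Inter>i\<in>{..<d}. {x::nat \<Rightarrow> real. 0 < x i}) \<inter> {x. (\<Sum>i<d. x i) < 1}"
  have "open {x::nat \<Rightarrow> real. 0 < x i}" "open {x::nat \<Rightarrow> real. (\<Sum>i<d. x i) < 1}" for i
    by (intro open_Collect_less continuous_intros; simp)+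
  then have "open ?V" by auto
  moreover have "std_simplex d = eucl d \<inter> ?V" by (auto simp: std_simplex_def)
  ultimately show ?thesis by (auto simp: openin_open)
qed

lemma connected_std_simplex: "connected (std_simplex d)"
  unfolding connected_iff_connected_component
proof (intro ballI)
  fix x y assume xy: "x \<in> std_simplex d" "y \<in> std_simplex d"
  let ?g = "\<lambda>t::real. \<lambda>i::nat. (1 - t) * x i + t * y i"
  have "?g ` {0..1} \<subseteq> std_simplex d"
  proof safe
    fix t :: real assume t: "t \<in> {0..1}"
    have pos: "0 < ?g t i" if "i < d" for i
    proof -
      have "0 < x i" "0 < y i" using xy that by (auto simp: std_simplex_def)
      then show ?thesis
        using t by (cases "t = 0") (auto intro!: add_nonneg_pos mult_nonneg_nonneg mult_pos_pos)
    qed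
    have "(\<Sum>i<d. ?g t i) = (1 - t) * (\<Sum>i<d. x i) + t * (\<Sum>i<d. y i)"
      by (simp add: sum.distrib sum_distrib_left)
    also have "\<dots> < 1"
      by (rule convex_bound_lt) (use xy t in \<open>auto simp: std_simplex_def\<close>)
    finally show "?g t \<in> std_simplex d"
      using xy pos by (auto simp: std_simplex_def eucl_def)
  qed
  moreover have "connected (?g ` {0..1})"
    by (intro connected_continuous_image continuous_on_coordinatewise_then_product continuous_intros)
      simp
  moreover have "x \<in> ?g ` {0..1}" "y \<in> ?g ` {0..1}"
    by (rule image_eqI[of _ _ 0], simp, simp) (rule image_eqI[of _ _ 1], simp, simp)
  ultimately show "connected_component (std_simplex d) x y"
    unfolding connected_component_def by (intro exI[of _ "?g ` {0..1}"]) auto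
qed

lemma closed_eucl: "closed (eucl m)"
proof -
  have "eucl m = (\<Inter>i\<in>{m..}. {x. x i = 0})" by (auto simp: eucl_def)
  moreover have "closed {x::nat \<Rightarrow> real. x i = 0}" for i
    by (intro closed_Collect_eq continuous_intros) auto
  ultimately show ?thesis by auto
qed

text \<open>The category argument needs cells to be countable unions of closed sets. Points with a
  margin of \<open>1 / Suc k\<close> from all faces form compact sets, and compactness survives the
  parametrization.\<close>

lemma std_simplex_sigma_compact:
  "\<exists>K :: nat \<Rightarrow> (nat \<Rightarrow> real) set. (\<forall>k. compact (K k)) \<and> std_simplex d = (\<Union>k. K k)"
proof -
  define K :: "nat \<Rightarrow> (nat \<Rightarrow> real) set" where
    "K k = {x \<in> eucl d. (\<forall>i<d. 1 / Suc k \<le> x i) \<and> (\<Sum>i<d. x i) \<le> 1 - 1 / Suc k}" for k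
  have "compact (K k)" for k
  proof -
    let ?B = "Pi\<^sub>E UNIV (\<lambda>i. {0..1}) :: (nat \<Rightarrow> real) set"
    let ?V = "(\<Inter>i\<in>{..<d}. {x::nat \<Rightarrow> real. 1 / Suc k \<le> x i}) \<inter> {x. (\<Sum>i<d. x i) \<le> 1 - 1 / Suc k}"
    have "compactin (product_topology (\<lambda>i. euclidean) UNIV) ?B"
      by (simp add: compactin_PiE)
    then have "compact ?B" by (simp add: euclidean_product_topology)
    moreover have "closed {x::nat \<Rightarrow> real. 1 / Suc k \<le> x i}"
      "closed {x::nat \<Rightarrow> real. (\<Sum>i<d. x i) \<le> 1 - 1 / Suc k}" for i
      by (intro closed_Collect_le continuous_intros; simp)+
    then have "closed (eucl d \<inter> ?V)" using closed_eucl by auto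
    moreover have "K k = ?B \<inter> (eucl d \<inter> ?V)"
    proof -
      have "x i \<in> {0..1}" if "x \<in> K k" for x i
      proof (cases "i < d")
        case True
        have nn: "0 \<le> x j" if "j < d" for j
        proof -
          have "0 \<le> 1 / real (Suc k)" by simp
          also have "\<dots> \<le> x j" using \<open>x \<in> K k\<close> that by (simp add: K_def)
          finally show ?thesis .
        qed
        have "x i \<le> (\<Sum>i<d. x i)" using True nn by (intro member_le_sum) auto
        also have "\<dots> \<le> 1 - 1 / Suc k" using that by (simp add: K_def)
        also have "\<dots> \<le> 1" by simp
        finally show ?thesis using nn[OF True] by simp
      next
        case False
        then show ?thesis using that by (simp add: K_def eucl_def)
      qed
      then show ?thesis by (auto simp: K_def)
    qed
    ultimately show ?thesis by (metis compact_Int_closed)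
  qed
  moreover have "std_simplex d = (\<Union>k. K k)"
  proof safe
    fix x assume x: "x \<in> std_simplex d"
    define \<epsilon> where "\<epsilon> = Min (insert (1 - (\<Sum>i<d. x i)) (x ` {..<d}))"
    have "\<epsilon> > 0" using x by (auto simp: \<epsilon>_def std_simplex_def)
    then obtain k where k: "1 / real (Suc k) < \<epsilon>" using nat_approx_posE by blast
    have "\<epsilon> \<le> 1 - (\<Sum>i<d. x i)" "\<epsilon> \<le> x i" if "i < d" for i using that by (auto simp: \<epsilon>_def)
    moreover have "\<epsilon> \<le> 1 - (\<Sum>i<d. x i)" by (auto simp: \<epsilon>_def)
    ultimately have "x \<in> K k" using k x by (force simp: K_def std_simplex_def)
    then show "x \<in> (\<Union>k. K k)" by blast
  next
    fix x k assume x: "x \<in> K k"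
    have k: "0 < 1 / real (Suc k)" by simp
    have "0 < x i" if "i < d" for i
      using x that k by (auto simp: K_def simp del: zero_less_divide_1_iff intro: less_le_trans[OF k])
    moreover have "(\<Sum>i<d. x i) < 1"
    proof -
      have "(\<Sum>i<d. x i) \<le> 1 - 1 / real (Suc k)" using x by (simp add: K_def)
      then show ?thesis using k by linarith
    qed
    ultimately show "x \<in> std_simplex d" using x by (simp add: K_def std_simplex_def)
  qed
  ultimately show ?thesis by blast
qed

section \<open>Invariance of domain\<close>

lemma invariance_of_domain_eucl:
  assumes "openin (top_of_set (eucl m)) U" "continuous_on U f" "f ` U \<subseteq> eucl m" "inj_on f U"
  shows "openin (top_of_set (eucl m)) (f ` U)"
proof -
  have "U \<subseteq> eucl m" using assms(1) openin_imp_subset by blast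
  then have "subtopology (top_of_set (eucl m)) U = top_of_set U"
    by (simp add: subtopology_subtopology inf.absorb2)
  then have "continuous_map (subtopology (Euclidean_space m) U) (Euclidean_space m) f"
    using assms(2,3) by (auto simp: Euclidean_space_eq)
  then show ?thesis
    using invariance_of_domain_Euclidean_space[of m U f] assms(1,4) by (simp add: Euclidean_space_eq)
qed

text \<open>Points of all dimensions share one type, so \<open>eucl d\<close> is a subset of
  \<open>eucl m\<close> and invariance of domain makes the image open in \<open>eucl m\<close>. But
  no nonempty subset of \<open>eucl d\<close> is.\<close>

lemma lower_dim_no_interior:
  assumes "openin (top_of_set (eucl m)) W" "continuous_on W f" "f ` W \<subseteq> eucl d" "inj_on f W" "d < m"
  shows "W = {}"
proof (rule ccontr)
  assume "W \<noteq> {}"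
  then obtain w where w: "w \<in> W" by blast
  have "eucl d \<subseteq> eucl m" using assms(5) by (auto simp: eucl_def)
  then have "openin (top_of_set (eucl m)) (f ` W)"
    using assms by (intro invariance_of_domain_eucl) auto
  then obtain \<delta> where \<delta>: "\<delta> > 0" "\<forall>x\<in>eucl m. near m \<delta> (f w) x \<longrightarrow> x \<in> f ` W"
    using w unfolding openin_eucl_iff by blast
  have fw: "f w \<in> eucl d" using assms(3) w by blast
  \<comment> \<open>A move by \<open>\<delta> / 2\<close> in direction \<open>d\<close> stays in the
    box and in \<open>eucl m\<close>, but leaves \<open>eucl d\<close>, where index \<open>d\<close>
    is 0.\<close>
  let ?x = "(f w)(d := \<delta> / 2)"
  have "?x \<in> eucl m" "near m \<delta> (f w) ?x"
    using fw assms(5) \<delta>(1) by (auto simp: eucl_def near_def)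
  then have "?x \<in> eucl d" using \<delta>(2) assms(3) by blast
  then show False using \<delta>(1) by (auto simp: eucl_def dest!: spec[of _ d])
qed

context o_minimal_field_expansion
begin

section \<open>Closure properties of definable sets, and cells\<close>

lemma def_pred_near:
  "(\<And>i. i < m \<Longrightarrow> def_fun (\<lambda>e. V e i)) \<Longrightarrow> (\<And>i. i < m \<Longrightarrow> def_fun (\<lambda>e. W e i)) \<Longrightarrow> def_fun u \<Longrightarrow>
    def_pred (\<lambda>e. near m (u e) (V e) (W e))"
  unfolding near_def by (intro dintros) auto

lemma def_set_std_simplex: "def_set d (std_simplex d)"
  unfolding std_simplex_def by (rule def_setI) (intro dintros)

lemma def_pred_trunc_mem:
  "def_set m A \<Longrightarrow> def_pred (\<lambda>e. trunc m (\<lambda>i. e (\<sigma> i)) \<in> A)"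
  by (erule def_pred_mem) (auto intro: dintros)

lemma def_set_Un: "def_set m A \<Longrightarrow> def_set m B \<Longrightarrow> def_set m (A \<union> B)"
  unfolding def_set_def by (auto intro: dintros)

lemma def_set_Diff: "def_set m A \<Longrightarrow> def_set m B \<Longrightarrow> def_set m (A - B)"
  unfolding def_set_def by (auto intro: dintros)

lemma def_set_empty: "def_set m {}"
  unfolding def_set_def by (auto intro: dintros)

lemma def_set_eucl: "def_set m (eucl m)"
  unfolding def_set_def by (auto intro: dintros)

lemma def_set_Union: "finite F \<Longrightarrow> (\<And>A. A \<in> F \<Longrightarrow> def_set m A) \<Longrightarrow> def_set m (\<Union>F)"
  by (induction F rule: finite_induct) (auto intro: def_set_Un def_set_empty)

lemma def_set_image:
  assumes "def_set d Q" "\<And>i. def_fun (\<lambda>e. \<phi> (trunc d e) i)" "\<phi> ` Q \<subseteq> eucl m"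
  shows "def_set m (\<phi> ` Q)"
proof -
  have \<phi>: "def_fun (\<lambda>e. \<phi> (trunc d (\<lambda>i. e (\<sigma> i))) j)" for \<sigma> j
    using def_fun_subst[OF assms(2)] .
  have "def_set m {x \<in> eucl m. \<exists>u\<in>eucl d. u \<in> Q \<and> (\<forall>i<m. x i = \<phi> u i)}"
    by (rule def_setI) (intro dintros def_pred_trunc_mem[OF assms(1)] \<phi>)
  moreover have "\<phi> ` Q = {x \<in> eucl m. \<exists>u\<in>eucl d. u \<in> Q \<and> (\<forall>i<m. x i = \<phi> u i)}"
  proof safe
    fix u assume "u \<in> Q"
    then show "\<exists>v\<in>eucl d. v \<in> Q \<and> (\<forall>i<m. \<phi> u i = \<phi> v i)"
      using def_set_subset[OF assms(1)] by (intro bexI[of _ u]) auto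
  next
    fix x u assume "x \<in> eucl m" "u \<in> Q" "\<forall>i<m. x i = \<phi> u i"
    then have "x = \<phi> u" using assms(3) by (intro eucl_eqI[of x m]) auto
    then show "x \<in> \<phi> ` Q" using \<open>u \<in> Q\<close> by blast
  qed (use assms(3) in blast)
  ultimately show ?thesis by simp
qed

text \<open>Classical cells are built from graphs and bands; here only a definable parametrization
  by an open simplex is recorded. The condition \<open>d \<le> m\<close> leaves two cases: a cell is
  open or of smaller dimension. \<open>trunc d\<close> turns the parametrization into a function of
  environments.\<close>

definition cell :: "nat \<Rightarrow> nat \<Rightarrow> (nat \<Rightarrow> real) set \<Rightarrow> bool" where
  "cell m d C \<longleftrightarrow> d \<le> m \<and> C \<subseteq> eucl m \<and> (\<exists>\<phi> \<psi>. homeomorphism (std_simplex d) C \<phi> \<psi> \<and>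
     (\<forall>i. def_fun (\<lambda>e. \<phi> (trunc d e) i)))"

lemma cellE:
  assumes "cell m d C"
  obtains \<phi> \<psi> where "d \<le> m" "C \<subseteq> eucl m" "homeomorphism (std_simplex d) C \<phi> \<psi>"
    "\<And>i. def_fun (\<lambda>e. \<phi> (trunc d e) i)"
  using assms unfolding cell_def by blast

lemma cell_subset: "cell m d C \<Longrightarrow> C \<subseteq> eucl m"
  by (simp add: cell_def)

lemma cell_nonempty: "cell m d C \<Longrightarrow> C \<noteq> {}"
  using std_simplex_nonempty by (auto simp: cell_def homeomorphism_def)

lemma cell_connected: "cell m d C \<Longrightarrow> connected C"
  by (metis cellE connected_continuous_image connected_std_simplex homeomorphism_def)

lemma cell_def_set:
  assumes "cell m d C" shows "def_set m C"
proof -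
  obtain \<phi> \<psi> where *: "C \<subseteq> eucl m" "homeomorphism (std_simplex d) C \<phi> \<psi>"
    "\<And>i. def_fun (\<lambda>e. \<phi> (trunc d e) i)" using assms unfolding cell_def by blast
  then have C: "C = \<phi> ` std_simplex d" by (simp add: homeomorphism_def)
  show ?thesis
    unfolding C by (rule def_set_image[OF def_set_std_simplex *(3)]) (use * C in simp)
qed

lemma cell_open:
  assumes "cell m m C" shows "openin (top_of_set (eucl m)) C"
proof -
  obtain \<phi> \<psi> where *: "C \<subseteq> eucl m" "homeomorphism (std_simplex m) C \<phi> \<psi>"
    using assms unfolding cell_def by blast
  have "openin (top_of_set (eucl m)) (\<phi> ` std_simplex m)"
    using * by (intro invariance_of_domain_eucl openin_std_simplex)
      (auto simp: homeomorphism_def intro: inj_on_inverseI)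
  then show ?thesis using * by (simp add: homeomorphism_def)
qed

text \<open>Images of the compact exhaustion are closed. An open subset of one of them would be
  embedded into dimension \<open>d\<close> by the inverse parametrization, so it is empty.\<close>

lemma lower_cell_meagre:
  assumes "cell m d C" "d < m"
  obtains \<K> where "countable \<K>" "\<Union>\<K> = C"
    "\<And>K. K \<in> \<K> \<Longrightarrow> closedin (top_of_set (eucl m)) K \<and> (top_of_set (eucl m)) interior_of K = {}"
proof -
  obtain \<phi> \<psi> where *: "C \<subseteq> eucl m" "homeomorphism (std_simplex d) C \<phi> \<psi>"
    using assms(1) unfolding cell_def by blast
  obtain K :: "nat \<Rightarrow> (nat \<Rightarrow> real) set" where K: "\<forall>k. compact (K k)" "std_simplex d = (\<Union>k. K k)"
    using std_simplex_sigma_compact[of d] by (elim exE conjE)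
  show thesis
  proof (rule that[of "range (\<lambda>k. \<phi> ` K k)"])
    show "countable (range (\<lambda>k. \<phi> ` K k))" by simp
    show "\<Union>(range (\<lambda>k. \<phi> ` K k)) = C" using * K(2) by (auto simp: homeomorphism_def)
    fix L assume "L \<in> range (\<lambda>k. \<phi> ` K k)"
    then obtain k where L: "L = \<phi> ` K k" by blast
    have "L \<subseteq> C" using L * K(2) by (auto simp: homeomorphism_def)
    have "continuous_on (K k) \<phi>"
      using * K(2) by (auto simp: homeomorphism_def intro: continuous_on_subset)
    then have "compact L" using K(1) L by (simp add: compact_continuous_image)
    then have "closedin (top_of_set (eucl m)) L"
      using \<open>L \<subseteq> C\<close> *(1) by (intro closed_subset compact_imp_closed) auto
    moreover have "(top_of_set (eucl m)) interior_of L = {}"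
    proof (rule lower_dim_no_interior)
      let ?W = "(top_of_set (eucl m)) interior_of L"
      have W: "?W \<subseteq> C" by (rule order_trans[OF interior_of_subset \<open>L \<subseteq> C\<close>])
      show "openin (top_of_set (eucl m)) ?W" by simp
      have h1: "continuous_on C \<psi>" "\<psi> ` C = std_simplex d" "\<forall>y\<in>C. \<phi> (\<psi> y) = y"
        using *(2) by (simp_all add: homeomorphism_def)
      have h2: "inj_on \<psi> C" by (rule inj_on_inverseI[of _ \<phi>]) (use h1(3) in simp)
      note h = h1(1) h2 h1(2)
      show "continuous_on ?W \<psi>" by (rule continuous_on_subset[OF h(1) W])
      show "inj_on \<psi> ?W" by (rule inj_on_subset[OF h(2) W])
      show "\<psi> ` ?W \<subseteq> eucl d" using image_mono[OF W, of \<psi>] h(3) std_simplex_subset[of d] by simp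
    qed (rule assms(2))
    ultimately show "closedin (top_of_set (eucl m)) L \<and> (top_of_set (eucl m)) interior_of L = {}" ..
  qed
qed

section \<open>Decompositions into cells and the category argument\<close>

definition decomposable :: "nat \<Rightarrow> (nat \<Rightarrow> real) set \<Rightarrow> bool" where
  "decomposable m A \<longleftrightarrow> (\<exists>\<C>. finite \<C> \<and> disjoint \<C> \<and> \<Union>\<C> = A \<and> (\<forall>C\<in>\<C>. \<exists>d. cell m d C))"

lemma decomposable_empty: "decomposable m {}"
  unfolding decomposable_def by (rule exI[of _ "{}"]) auto

lemma decomposable_Un:
  assumes "decomposable m A" "decomposable m B" "A \<inter> B = {}"
  shows "decomposable m (A \<union> B)"
proof -
  obtain \<C> \<D> where "finite \<C>" "disjoint \<C>" "\<Union>\<C> = A" "\<forall>C\<in>\<C>. \<exists>d. cell m d C"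
    "finite \<D>" "disjoint \<D>" "\<Union>\<D> = B" "\<forall>C\<in>\<D>. \<exists>d. cell m d C"
    using assms(1,2) unfolding decomposable_def by blast
  then show ?thesis
    unfolding decomposable_def using assms(3)
    by (intro exI[of _ "\<C> \<union> \<D>"]) (auto intro!: disjoint_union)
qed

lemma decomposable_UN:
  assumes "finite I" "\<And>i. i \<in> I \<Longrightarrow> decomposable m (B i)"
    "\<And>i j. i \<in> I \<Longrightarrow> j \<in> I \<Longrightarrow> i \<noteq> j \<Longrightarrow> B i \<inter> B j = {}"
  shows "decomposable m (\<Union>i\<in>I. B i)"
  using assms
proof (induction I rule: finite_induct)
  case (insert i I)
  then have "B i \<inter> (\<Union>i\<in>I. B i) = {}" by blast
  then show ?case using insert by (auto intro!: decomposable_Un)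
qed (simp add: decomposable_empty)

text \<open>A form of the Baire theorem for definable sets that may fail to be closed. If a cell of
  full dimension meets \<open>U\<close>, it is open and yields \<open>W\<close>; otherwise all cells
  that meet \<open>U\<close> are countable unions of closed sets without interior and cannot cover
  \<open>U\<close>.\<close>

lemma definable_Baire:
  assumes CD: "\<And>A. def_set m A \<Longrightarrow> decomposable m A"
    and U: "openin (top_of_set (eucl m)) U" "U \<noteq> {}"
    and A: "countable \<A>" "\<And>A. A \<in> \<A> \<Longrightarrow> def_set m A" "U \<subseteq> \<Union>\<A>"
  obtains A W where "A \<in> \<A>" "openin (top_of_set (eucl m)) W" "W \<noteq> {}" "W \<subseteq> A \<inter> U"
proof (rule ccontr)
  note found = that
  assume "\<not> thesis"
  then have no: "False" if "A \<in> \<A>" "openin (top_of_set (eucl m)) W" "W \<noteq> {}" "W \<subseteq> A \<inter> U" for A W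
    using found[OF that] by blast
  obtain \<C> where \<C>: "\<And>A. A \<in> \<A> \<Longrightarrow> finite (\<C> A)" "\<And>A. A \<in> \<A> \<Longrightarrow> \<Union>(\<C> A) = A"
    "\<And>A C. A \<in> \<A> \<Longrightarrow> C \<in> \<C> A \<Longrightarrow> \<exists>d. cell m d C"
    using CD[OF A(2)] unfolding decomposable_def by metis
  define \<E> where "\<E> = {C. \<exists>A\<in>\<A>. C \<in> \<C> A \<and> C \<inter> U \<noteq> {}}"
  have "\<exists>\<K>. countable \<K> \<and> \<Union>\<K> = C \<and>
    (\<forall>K\<in>\<K>. closedin (top_of_set (eucl m)) K \<and> (top_of_set (eucl m)) interior_of K = {})"
    if CE: "C \<in> \<E>" for C
  proof -
    obtain A where A': "A \<in> \<A>" "C \<in> \<C> A" "C \<inter> U \<noteq> {}" using CE unfolding \<E>_def by blast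
    then obtain d where d: "cell m d C" using \<C>(3) by blast
    have "d \<noteq> m"
    proof
      assume "d = m"
      then have "openin (top_of_set (eucl m)) (C \<inter> U)" using d cell_open U(1) by blast
      then show False using no[OF A'(1)] A' \<C>(2)[OF A'(1)] by blast
    qed
    then have "d < m" using d by (simp add: cell_def)
    from lower_cell_meagre[OF d this] show ?thesis by metis
  qed
  then obtain \<K> where \<K>: "\<And>C. C \<in> \<E> \<Longrightarrow> countable (\<K> C)" "\<And>C. C \<in> \<E> \<Longrightarrow> \<Union>(\<K> C) = C"
    "\<And>C K. C \<in> \<E> \<Longrightarrow> K \<in> \<K> C \<Longrightarrow> closedin (top_of_set (eucl m)) K \<and> (top_of_set (eucl m)) interior_of K = {}"
    by metis
  have "\<E> \<subseteq> (\<Union>A\<in>\<A>. \<C> A)" by (auto simp: \<E>_def)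
  moreover have "countable (\<Union>A\<in>\<A>. \<C> A)" using A(1) \<C>(1) by (simp add: countable_finite)
  ultimately have "countable \<E>" by (rule countable_subset)
  then have "countable (\<Union>C\<in>\<E>. \<K> C)" using \<K>(1) by simp
  moreover have "completely_metrizable_space (top_of_set (eucl m))"
    using completely_metrizable_Euclidean_space[of m] by (simp add: Euclidean_space_eq)
  ultimately have "(top_of_set (eucl m)) interior_of \<Union>(\<Union>C\<in>\<E>. \<K> C) = {}"
    using \<K>(3) by (intro Baire_category_alt) auto
  moreover have "U \<subseteq> \<Union>(\<Union>C\<in>\<E>. \<K> C)"
  proof
    fix x assume x: "x \<in> U"
    then obtain A where "A \<in> \<A>" "x \<in> A" using A(3) by blast
    then obtain C where "C \<in> \<C> A" "x \<in> C" using \<C>(2) by blast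
    then have "C \<in> \<E>" using x \<open>A \<in> \<A>\<close> by (auto simp: \<E>_def)
    then show "x \<in> \<Union>(\<Union>C\<in>\<E>. \<K> C)" using \<K>(2) \<open>x \<in> C\<close> by blast
  qed
  ultimately show False using interior_of_maximal[OF _ U(1)] U(2) by blast
qed

end

section \<open>Uniform finiteness and piecewise continuity\<close>

context o_minimal_field_expansion
begin

definition uniformly_finite :: "nat \<Rightarrow> bool" where
  "uniformly_finite m \<longleftrightarrow> (\<forall>D. def_pred (\<lambda>e. e 0 \<in> D (trunc m (\<lambda>i. e (Suc i)))) \<longrightarrow>
     (\<forall>x\<in>eucl m. finite (D x)) \<longrightarrow> (\<exists>N. \<forall>x\<in>eucl m. card (D x) \<le> N))"

text \<open>The pieces may overlap; \<open>def_set_disjoint_refinement\<close> makes them disjoint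
  when this matters.\<close>

definition piecewise_continuous :: "nat \<Rightarrow> (nat \<Rightarrow> real) set \<Rightarrow> ((nat \<Rightarrow> real) \<Rightarrow> real) \<Rightarrow> bool" where
  "piecewise_continuous m B f \<longleftrightarrow>
     (\<exists>\<Q>. finite \<Q> \<and> \<Union>\<Q> = B \<and> (\<forall>Q\<in>\<Q>. def_set m Q \<and> continuous_on Q f))"

section \<open>Transfer from lower dimensions along cells\<close>

lemma piecewise_continuous_Union:
  assumes "finite F" "\<And>B. B \<in> F \<Longrightarrow> piecewise_continuous m B f"
  shows "piecewise_continuous m (\<Union>F) f"
proof -
  obtain \<Q> where \<Q>: "\<forall>B\<in>F. finite (\<Q> B) \<and> \<Union>(\<Q> B) = B \<and> (\<forall>Q\<in>\<Q> B. def_set m Q \<and> continuous_on Q f)"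
    using assms(2) unfolding piecewise_continuous_def by metis
  then show ?thesis
    unfolding piecewise_continuous_def using assms(1)
    by (intro exI[of _ "\<Union>B\<in>F. \<Q> B"]) fastforce
qed

text \<open>A cell of dimension \<open>d\<close> is a copy of the simplex in \<open>eucl d\<close>,
  so the family is pulled back along the parametrization and the bound from dimension
  \<open>d\<close> applies.\<close>

lemma uniform_bound_lower:
  assumes UF: "uniformly_finite d" and C: "cell m d C"
    and D: "def_pred (\<lambda>e. e 0 \<in> D (trunc m (\<lambda>i. e (Suc i))))" "\<forall>x\<in>eucl m. finite (D x)"
  shows "\<exists>N. \<forall>x\<in>C. card (D x) \<le> N"
proof -
  obtain \<phi> \<psi> where *: "C \<subseteq> eucl m" "homeomorphism (std_simplex d) C \<phi> \<psi>"
    "\<And>i. def_fun (\<lambda>e. \<phi> (trunc d e) i)" using C unfolding cell_def by blast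
  then have C_eq: "C = \<phi> ` std_simplex d" by (simp add: homeomorphism_def)
  have \<phi>: "def_fun (\<lambda>e. \<phi> (trunc d (\<lambda>i. e (\<sigma> i))) j)" for \<sigma> j
    using def_fun_subst[OF *(3)] .
  have Dm: "def_pred (\<lambda>e. e k \<in> D (trunc m (\<lambda>i. e (\<sigma> i))))" for k \<sigma>
    using def_pred_subst[OF D(1), of "case_nat k \<sigma>"] by simp
  \<comment> \<open>\<open>uniformly_finite\<close> asks for finite fibers on all of
    \<open>eucl d\<close>, so the family is made empty off the simplex. The point
    \<open>\<phi> u\<close> is named by a quantifier because definability of \<open>D\<close> is
    given for truncated variables.\<close>
  define D' where "D' u = {t. u \<in> std_simplex d \<and> (\<exists>x\<in>eucl m. (\<forall>i<m. x i = \<phi> u i) \<and> t \<in> D x)}" for u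
  have eq: "D' u = D (\<phi> u)" if "u \<in> std_simplex d" for u
  proof -
    have "\<phi> u \<in> eucl m" using that *(1) C_eq by blast
    then show ?thesis using that by (auto simp: D'_def dest: eucl_eqI[of _ m "\<phi> u"])
  qed
  have "def_pred (\<lambda>e. e 0 \<in> D' (trunc d (\<lambda>i. e (Suc i))))"
    unfolding D'_def mem_Collect_eq
    by (intro dintros def_pred_trunc_mem[OF def_set_std_simplex] \<phi> Dm)
  moreover have "\<forall>u\<in>eucl d. finite (D' u)"
  proof
    fix u show "finite (D' u)"
    proof (cases "u \<in> std_simplex d")
      case True
      then show ?thesis using eq D(2) *(1) C_eq by auto
    qed (simp add: D'_def)
  qed
  ultimately obtain N where N: "\<forall>u\<in>eucl d. card (D' u) \<le> N" using UF unfolding uniformly_finite_def by blast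
  then have "card (D (\<phi> u)) \<le> N" if "u \<in> std_simplex d" for u
  proof -
    have "card (D' u) \<le> N" using N that std_simplex_subset[of d] by blast
    then show ?thesis using eq[OF that] by simp
  qed
  then have "\<forall>x\<in>C. card (D x) \<le> N" using C_eq by blast
  then show ?thesis ..
qed

text \<open>Pieces for the pulled-back function are pushed forward; continuity returns because the
  inverse parametrization is continuous on the cell.\<close>

lemma piecewise_continuous_lower:
  assumes PC: "\<And>B f. def_set d B \<Longrightarrow> def_fun (\<lambda>e. f (trunc d e)) \<Longrightarrow> piecewise_continuous d B f"
    and C: "cell m d C" and f: "def_fun (\<lambda>e. f (trunc m e))"
  shows "piecewise_continuous m C f"
proof -
  obtain \<phi> \<psi> where *: "C \<subseteq> eucl m" "homeomorphism (std_simplex d) C \<phi> \<psi>"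
    "\<And>i. def_fun (\<lambda>e. \<phi> (trunc d e) i)" using C unfolding cell_def by blast
  then have C_eq: "C = \<phi> ` std_simplex d" by (simp add: homeomorphism_def)
  have "def_fun (\<lambda>e. f (trunc m (\<phi> (trunc d e))))"
    using def_fun_comp[OF f, of "\<lambda>i e. \<phi> (trunc d e) i"] *(3) by simp
  from PC[OF def_set_std_simplex this] obtain \<Q> where
    \<Q>: "finite \<Q>" "\<Union>\<Q> = std_simplex d" "\<forall>Q\<in>\<Q>. def_set d Q \<and> continuous_on Q (\<lambda>u. f (trunc m (\<phi> u)))"
    unfolding piecewise_continuous_def by blast
  show ?thesis
    unfolding piecewise_continuous_def
  proof (intro exI conjI ballI)
    show "finite ((`) \<phi> ` \<Q>)" using \<Q>(1) by simp
    show "\<Union>((`) \<phi> ` \<Q>) = C" using C_eq \<Q>(2) by blast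
    fix R assume "R \<in> (`) \<phi> ` \<Q>"
    then obtain Q where Q: "Q \<in> \<Q>" "R = \<phi> ` Q" by blast
    have QS: "Q \<subseteq> std_simplex d" using Q(1) \<Q>(2) by blast
    then have RC: "R \<subseteq> C" using Q(2) C_eq by blast
    show "def_set m R"
      unfolding Q(2) by (rule def_set_image[OF _ *(3)]) (use Q \<Q>(3) RC *(1) in auto)
    have inv: "\<forall>u\<in>std_simplex d. \<psi> (\<phi> u) = u" "\<forall>x\<in>C. \<phi> (\<psi> x) = x" "continuous_on C \<psi>"
      using *(2) by (simp_all add: homeomorphism_def)
    have "continuous_on R (\<lambda>x. f (trunc m (\<phi> (\<psi> x))))"
    proof (rule continuous_on_compose2[of Q "\<lambda>u. f (trunc m (\<phi> u))" R \<psi>])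
      show "continuous_on Q (\<lambda>u. f (trunc m (\<phi> u)))" using Q(1) \<Q>(3) by blast
      show "continuous_on R \<psi>" using inv(3) RC continuous_on_subset by blast
      show "\<psi> ` R \<subseteq> Q" using Q(2) QS inv(1) by auto
    qed
    moreover have "f (trunc m (\<phi> (\<psi> x))) = f x" if "x \<in> R" for x
    proof -
      have "x \<in> C" using that RC by blast
      then have "\<phi> (\<psi> x) = x" "x \<in> eucl m" using inv(2) *(1) by blast+
      then show ?thesis by simp
    qed
    ultimately show "continuous_on R f" by (rule continuous_on_eq)
  qed
qed

text \<open>Cells of full dimension are open and nonempty, so a set without interior consists of
  cells of smaller dimension.\<close>

lemma piecewise_continuous_no_interior:
  assumes PC: "\<And>d B f. d < m \<Longrightarrow> def_set d B \<Longrightarrow> def_fun (\<lambda>e. f (trunc d e)) \<Longrightarrow> piecewise_continuous d B f"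
    and A: "decomposable m A" "\<And>W. openin (top_of_set (eucl m)) W \<Longrightarrow> W \<subseteq> A \<Longrightarrow> W = {}"
    and f: "def_fun (\<lambda>e. f (trunc m e))"
  shows "piecewise_continuous m A f"
proof -
  obtain \<C> where \<C>: "finite \<C>" "\<Union>\<C> = A" "\<forall>C\<in>\<C>. \<exists>d. cell m d C"
    using A(1) unfolding decomposable_def by blast
  have "piecewise_continuous m C f" if C: "C \<in> \<C>" for C
  proof -
    obtain d where d: "cell m d C" using \<C>(3) C by blast
    have "d \<noteq> m"
    proof
      assume "d = m"
      then have "C = {}" using A(2)[OF cell_open] d C \<C>(2) by blast
      then show False using cell_nonempty[OF d] by blast
    qed
    then have "d < m" using d by (simp add: cell_def)
    from piecewise_continuous_lower[OF PC[OF this] d f] show ?thesis by blast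
  qed
  then show ?thesis using piecewise_continuous_Union[OF \<C>(1)] \<C>(2) by blast
qed

text \<open>The discontinuities have no interior. At each of them the function jumps across a
  rational, so countably many definable sets \<open>lo q\<close> and \<open>hi q\<close> cover them.
  Such a set contains no nonempty open set: with a point it would contain nearby points whose values
  lie on the wrong side of \<open>q\<close>.\<close>

lemma piecewise_continuous_open:
  assumes CD: "\<And>A. def_set m A \<Longrightarrow> decomposable m A"
    and PC: "\<And>d B f. d < m \<Longrightarrow> def_set d B \<Longrightarrow> def_fun (\<lambda>e. f (trunc d e)) \<Longrightarrow> piecewise_continuous d B f"
    and U: "def_set m U" "openin (top_of_set (eucl m)) U" and f: "def_fun (\<lambda>e. f (trunc m e))"
  shows "piecewise_continuous m U f"
proof -
  have fm: "def_fun (\<lambda>e. f (trunc m (\<lambda>i. e (\<sigma> i))))" for \<sigma>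
    using def_fun_subst[OF f] .
  note mem = def_pred_trunc_mem[OF U(1)]
  define disc where "disc = {x \<in> eucl m. x \<in> U \<and> (\<exists>\<epsilon>. 0 < \<epsilon> \<and> (\<forall>\<delta>. 0 < \<delta> \<longrightarrow>
      (\<exists>y\<in>eucl m. y \<in> U \<and> near m \<delta> x y \<and> \<epsilon> \<le> \<bar>f y - f x\<bar>)))}"
  have disc: "def_set m disc"
    unfolding disc_def by (rule def_setI) (intro dintros def_pred_near mem fm)
  have UE: "U \<subseteq> eucl m" using U(1) by (rule def_set_subset)
  have "continuous_on (U - disc) f"
  proof (rule near_imp_continuous_on)
    fix a and \<epsilon> :: real assume "a \<in> U - disc" "\<epsilon> > 0"
    then obtain \<delta> where "\<delta> > 0" "\<not> (\<exists>y\<in>eucl m. y \<in> U \<and> near m \<delta> a y \<and> \<epsilon> \<le> \<bar>f y - f a\<bar>)"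
      using UE unfolding disc_def by blast
    then show "\<exists>\<delta>>0. \<forall>x\<in>U - disc. near m \<delta> a x \<longrightarrow> \<bar>f x - f a\<bar> < \<epsilon>"
      using UE by (intro exI[of _ \<delta>]) (auto simp: not_le)
  qed
  then have 1: "piecewise_continuous m (U - disc) f"
    unfolding piecewise_continuous_def
    by (intro exI[of _ "{U - disc}"]) (auto intro: def_set_Diff U disc)
  have "W = {}" if W: "openin (top_of_set (eucl m)) W" "W \<subseteq> disc" for W
  proof (rule ccontr)
    assume "W \<noteq> {}"
    define lo where "lo q = {x \<in> eucl m. x \<in> disc \<and> f x < q \<and>
      (\<forall>\<delta>. 0 < \<delta> \<longrightarrow> (\<exists>y\<in>eucl m. y \<in> U \<and> near m \<delta> x y \<and> q < f y))}" for q
    define hi where "hi q = {x \<in> eucl m. x \<in> disc \<and> q < f x \<and>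
      (\<forall>\<delta>. 0 < \<delta> \<longrightarrow> (\<exists>y\<in>eucl m. y \<in> U \<and> near m \<delta> x y \<and> f y < q))}" for q
    have def_lo: "def_set m (lo q)" for q
      unfolding lo_def
      by (rule def_setI) (intro dintros def_pred_near mem def_pred_trunc_mem[OF disc] fm)
    have def_hi: "def_set m (hi q)" for q
      unfolding hi_def
      by (rule def_setI) (intro dintros def_pred_near mem def_pred_trunc_mem[OF disc] fm)
    have cover: "W \<subseteq> \<Union>(lo ` \<rat> \<union> hi ` \<rat>)"
    proof
      fix x assume x: "x \<in> W"
      then have xd: "x \<in> disc" "x \<in> eucl m" using W(2) by (auto simp: disc_def)
      then obtain \<epsilon> where \<epsilon>: "0 < \<epsilon>"
        "\<And>\<delta>. 0 < \<delta> \<Longrightarrow> \<exists>y\<in>eucl m. y \<in> U \<and> near m \<delta> x y \<and> \<epsilon> \<le> \<bar>f y - f x\<bar>"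
        unfolding disc_def by blast
      obtain q where q: "q \<in> \<rat>" "f x < q" "q < f x + \<epsilon>"
        using Rats_dense_in_real[of "f x" "f x + \<epsilon>"] \<epsilon>(1) by auto
      obtain r where r: "r \<in> \<rat>" "f x - \<epsilon> < r" "r < f x"
        using Rats_dense_in_real[of "f x - \<epsilon>" "f x"] \<epsilon>(1) by auto
      show "x \<in> \<Union>(lo ` \<rat> \<union> hi ` \<rat>)"
      proof (cases "\<forall>\<delta>>0. \<exists>y\<in>eucl m. y \<in> U \<and> near m \<delta> x y \<and> q < f y")
        case True
        then have "x \<in> lo q" using xd q by (simp add: lo_def)
        then show ?thesis using q by blast
      next
        \<comment> \<open>Near \<open>x\<close> all values are at most \<open>q\<close>, which is
          below \<open>f x + \<epsilon>\<close>. So the points where \<open>f\<close> deviates by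
          \<open>\<epsilon>\<close> deviate downwards, past \<open>r\<close>.\<close>
        case False
        then obtain \<delta>0 where \<delta>0: "\<delta>0 > 0" "\<forall>y\<in>eucl m. y \<in> U \<longrightarrow> near m \<delta>0 x y \<longrightarrow> f y \<le> q"
          by (auto simp: not_less)
        have "\<exists>y\<in>eucl m. y \<in> U \<and> near m \<delta> x y \<and> f y < r" if "\<delta> > 0" for \<delta>
        proof -
          have "min \<delta> \<delta>0 > 0" using that \<delta>0 by simp
          from \<epsilon>(2)[OF this] obtain y where y: "y \<in> eucl m" "y \<in> U" "near m (min \<delta> \<delta>0) x y" "\<epsilon> \<le> \<bar>f y - f x\<bar>"
            by blast
          then have "near m \<delta> x y" "near m \<delta>0 x y" by (auto simp: near_def)
          then have "f y \<le> q" using \<delta>0 y by blast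
          then have "f y < r" using y(4) q r by linarith
          then show ?thesis using y \<open>near m \<delta> x y\<close> by blast
        qed
        then have "x \<in> hi r" using xd r by (simp add: hi_def)
        then show ?thesis using r by blast
      qed
    qed
    obtain A V where AV: "A \<in> lo ` \<rat> \<union> hi ` \<rat>" "openin (top_of_set (eucl m)) V" "V \<noteq> {}" "V \<subseteq> A \<inter> W"
    proof (rule definable_Baire[OF CD W(1) \<open>W \<noteq> {}\<close> _ _ cover])
      show "countable (lo ` \<rat> \<union> hi ` \<rat>)" by (simp add: countable_rat)
    qed (use def_lo def_hi in auto)
    then obtain x where x: "x \<in> V" by blast
    then obtain \<delta> where \<delta>: "\<delta> > 0" "\<forall>y\<in>eucl m. near m \<delta> x y \<longrightarrow> y \<in> V"
      using AV(2) unfolding openin_eucl_iff by blast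
    from AV(1) consider q where "A = lo q" | q where "A = hi q" by blast
    then show False
    proof cases
      case 1
      then have "x \<in> lo q" using x AV(4) by blast
      then obtain y where "y \<in> eucl m" "near m \<delta> x y" "q < f y" using \<delta>(1) unfolding lo_def by blast
      moreover from this have "y \<in> lo q" using \<delta>(2) AV(4) 1 by blast
      ultimately show False by (simp add: lo_def)
    next
      case 2
      then have "x \<in> hi q" using x AV(4) by blast
      then obtain y where "y \<in> eucl m" "near m \<delta> x y" "f y < q" using \<delta>(1) unfolding hi_def by blast
      moreover from this have "y \<in> hi q" using \<delta>(2) AV(4) 2 by blast
      ultimately show False by (simp add: hi_def)
    qed
  qed
  note no_int = this
  have 2: "piecewise_continuous m disc f"
    by (rule piecewise_continuous_no_interior[OF PC CD[OF disc] no_int f])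
  have "disc \<subseteq> U" by (auto simp: disc_def)
  then have "\<Union>{U - disc, disc} = U" by blast
  then show ?thesis using piecewise_continuous_Union[of "{U - disc, disc}" m f] 1 2 by auto
qed

lemma piecewise_continuous_step:
  assumes CD: "\<And>A. def_set m A \<Longrightarrow> decomposable m A"
    and PC: "\<And>d B f. d < m \<Longrightarrow> def_set d B \<Longrightarrow> def_fun (\<lambda>e. f (trunc d e)) \<Longrightarrow> piecewise_continuous d B f"
    and B: "def_set m B" and f: "def_fun (\<lambda>e. f (trunc m e))"
  shows "piecewise_continuous m B f"
proof -
  obtain \<C> where \<C>: "finite \<C>" "\<Union>\<C> = B" "\<forall>C\<in>\<C>. \<exists>d. cell m d C"
    using CD[OF B] unfolding decomposable_def by blast
  have "piecewise_continuous m C f" if C: "C \<in> \<C>" for C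
  proof -
    obtain d where d: "cell m d C" using \<C>(3) C by blast
    show ?thesis
    proof (cases "d = m")
      case True
      then show ?thesis
        using piecewise_continuous_open[OF CD PC cell_def_set[OF d] _ f] cell_open d by blast
    next
      case False
      then have "d < m" using d by (simp add: cell_def)
      from piecewise_continuous_lower[OF PC[OF this] d f] show ?thesis by blast
    qed
  qed
  then show ?thesis using piecewise_continuous_Union[OF \<C>(1)] \<C>(2) by blast
qed

text \<open>Each finite set of reals gets a code \<open>(F, h)\<close> from a countable supply:
  rational approximations and a rational radius that is small against all distances in the
  set.\<close>

lemma finite_real_rational_approximation:
  assumes "finite (D :: real set)"
  obtains F h where "finite F" "F \<subseteq> \<rat>" "h \<in> \<rat>" "0 < h"
    "\<forall>p\<in>F. \<forall>q\<in>F. p \<noteq> q \<longrightarrow> 6 * h \<le> \<bar>p - q\<bar>"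
    "\<forall>b\<in>D. \<exists>p\<in>F. \<bar>b - p\<bar> < h"
    "\<forall>p\<in>F. \<exists>!b. b \<in> D \<and> \<bar>b - p\<bar> < h"
proof -
  define G where "G = insert 1 ((\<lambda>(b, c). \<bar>b - c\<bar>) ` {(b, c) \<in> D \<times> D. b \<noteq> c})"
  have "finite {(b, c) \<in> D \<times> D. b \<noteq> c}"
    by (rule finite_subset[of _ "D \<times> D"]) (use assms in auto)
  then have fin: "finite G" by (simp add: G_def)
  have "\<forall>g\<in>G. g > 0" by (auto simp: G_def)
  then have "Min G > 0" using fin Min_in[of G] by (auto simp: G_def)
  \<comment> \<open>With all distances above \<open>8 * h\<close>, approximations to within
    \<open>h\<close> are still at least \<open>6 * h\<close> apart. The 1 in \<open>G\<close> covers
    sets with at most one element.\<close>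
  then obtain h where h: "h \<in> \<rat>" "0 < h" "h < Min G / 8"
    using Rats_dense_in_real[of 0 "Min G / 8"] by auto
  have sep: "8 * h < \<bar>b - c\<bar>" if "b \<in> D" "c \<in> D" "b \<noteq> c" for b c
  proof -
    have "\<bar>b - c\<bar> \<in> G" using that by (force simp: G_def)
    then have "Min G \<le> \<bar>b - c\<bar>" using fin by simp
    then show ?thesis using h by linarith
  qed
  have "\<exists>p\<in>\<rat>. \<bar>b - p\<bar> < h" for b
  proof -
    obtain p where "p \<in> \<rat>" "b < p" "p < b + h" using Rats_dense_in_real[of b "b + h"] h by auto
    then show ?thesis by (intro bexI[of _ p]) auto
  qed
  then obtain p where p: "\<And>b. p b \<in> \<rat>" "\<And>b. \<bar>b - p b\<bar> < h" by metis
  show thesis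
  proof (rule that[of "p ` D" h])
    show "finite (p ` D)" "p ` D \<subseteq> \<rat>" using assms p by auto
    show "h \<in> \<rat>" "0 < h" using h by auto
    show "\<forall>r\<in>p ` D. \<forall>q\<in>p ` D. r \<noteq> q \<longrightarrow> 6 * h \<le> \<bar>r - q\<bar>"
    proof (intro ballI impI)
      fix r q assume "r \<in> p ` D" "q \<in> p ` D" "r \<noteq> q"
      then obtain b c where bc: "b \<in> D" "c \<in> D" "b \<noteq> c" "r = p b" "q = p c" by blast
      show "6 * h \<le> \<bar>r - q\<bar>"
        using sep[OF bc(1-3)] p(2)[of b] p(2)[of c] bc(4,5) by linarith
    qed
    show "\<forall>b\<in>D. \<exists>q\<in>p ` D. \<bar>b - q\<bar> < h" using p(2) by blast
    show "\<forall>q\<in>p ` D. \<exists>!b. b \<in> D \<and> \<bar>b - q\<bar> < h"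
    proof
      fix q assume "q \<in> p ` D"
      then obtain b where b: "b \<in> D" "q = p b" by blast
      have "c = b" if "c \<in> D" "\<bar>c - q\<bar> < h" for c
      proof (rule ccontr)
        assume "c \<noteq> b"
        then have "8 * h < \<bar>c - b\<bar>" using sep that b by blast
        then show False using that(2) p(2)[of b] b(2) h by linarith
      qed
      then show "\<exists>!b. b \<in> D \<and> \<bar>b - q\<bar> < h" using b p(2)[of b] by blast
    qed
  qed
qed

text \<open>Where nearby fibers correspond point by point, the cardinality is locally constant,
  hence constant on each of finitely many connected cells. The other points form cells of smaller
  dimension: in an open cell, the fibers over some open subset share a code, and a common code makes
  fibers correspond.\<close>

lemma uniformly_finite_step:
  assumes CD: "\<And>A. def_set m A \<Longrightarrow> decomposable m A"
    and UF: "\<And>d. d < m \<Longrightarrow> uniformly_finite d"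
  shows "uniformly_finite m"
  unfolding uniformly_finite_def
proof (intro allI impI)
  fix D :: "(nat \<Rightarrow> real) \<Rightarrow> real set"
  assume D: "def_pred (\<lambda>e. e 0 \<in> D (trunc m (\<lambda>i. e (Suc i))))" and fin: "\<forall>x\<in>eucl m. finite (D x)"
  have Dm: "def_pred (\<lambda>e. e k \<in> D (trunc m (\<lambda>i. e (\<sigma> i))))" for k \<sigma>
    using def_pred_subst[OF D(1), of "case_nat k \<sigma>"] by simp
  \<comment> \<open>near the points of \<open>G\<close> the fibers are in bijection, which a single formula can express for all cardinalities\<close>
  define G where "G = {a \<in> eucl m. \<exists>\<epsilon>. \<exists>\<delta>. 0 < \<delta> \<and> (\<forall>x\<in>eucl m. near m \<delta> a x \<longrightarrow>
      (\<forall>b. b \<in> D a \<longrightarrow> (\<exists>!c. c \<in> D x \<and> \<bar>b - c\<bar> < \<epsilon>)) \<and>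
      (\<forall>c. c \<in> D x \<longrightarrow> (\<exists>!b. b \<in> D a \<and> \<bar>b - c\<bar> < \<epsilon>)))}"
  have G: "def_set m G"
    unfolding G_def by (rule def_setI) (intro dintros def_pred_near Dm)
  have local_const: "\<exists>\<delta>>0. \<forall>x\<in>eucl m. near m \<delta> a x \<longrightarrow> card (D x) = card (D a)" if "a \<in> G" for a
  proof -
    obtain \<epsilon> \<delta> where "0 < \<delta>" and *: "\<forall>x\<in>eucl m. near m \<delta> a x \<longrightarrow>
      (\<forall>b. b \<in> D a \<longrightarrow> (\<exists>!c. c \<in> D x \<and> \<bar>b - c\<bar> < \<epsilon>)) \<and>
      (\<forall>c. c \<in> D x \<longrightarrow> (\<exists>!b. b \<in> D a \<and> \<bar>b - c\<bar> < \<epsilon>))"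
      using \<open>a \<in> G\<close> unfolding G_def by blast
    have "card (D a) = card (D x)" if "x \<in> eucl m" "near m \<delta> a x" for x
      by (rule card_unique_rel[where R = "\<lambda>b c. \<bar>b - c\<bar> < \<epsilon>"]) (use * that in blast)+
    then show ?thesis using \<open>0 < \<delta>\<close> by metis
  qed
  have bound_G: "\<exists>N. \<forall>x\<in>C. card (D x) \<le> N" if C: "cell m d C" "C \<subseteq> G" for d C
  proof -
    have "(\<lambda>x. card (D x)) constant_on C"
    proof (rule locally_constant_imp_constant)
      show "connected C" using C(1) by (rule cell_connected)
      fix a assume a: "a \<in> C"
      then obtain \<delta> where \<delta>: "\<delta> > 0" "\<forall>x\<in>eucl m. near m \<delta> a x \<longrightarrow> card (D x) = card (D a)"
        using local_const C(2) by blast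
      show "\<exists>T. openin (top_of_set C) T \<and> a \<in> T \<and> (\<forall>x\<in>T. card (D x) = card (D a))"
      proof (intro exI conjI ballI)
        show "openin (top_of_set C) (C \<inter> {x. near m \<delta> a x})" using open_near by (auto simp: openin_open)
        show "a \<in> C \<inter> {x. near m \<delta> a x}" using a \<delta> by (simp add: near_def)
        fix x assume "x \<in> C \<inter> {x. near m \<delta> a x}"
        then show "card (D x) = card (D a)" using \<delta>(2) cell_subset[OF C(1)] by blast
      qed
    qed
    then show ?thesis unfolding constant_on_def by (metis order_refl)
  qed
  have bound_compl: "\<exists>N. \<forall>x\<in>C. card (D x) \<le> N" if C: "cell m d C" "C \<subseteq> eucl m - G" for d C
  proof (cases "d = m")
    case False
    then have "d < m" using C by (simp add: cell_def)
    from uniform_bound_lower[OF UF[OF this] C(1) D fin] show ?thesis .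
  next
    case True
    then have "openin (top_of_set (eucl m)) C" using C cell_open by blast
    define I where "I = {(F, h). finite F \<and> F \<subseteq> \<rat> \<and> h \<in> \<rat> \<and> 0 < (h::real) \<and>
        (\<forall>p\<in>F. \<forall>q\<in>F. p \<noteq> q \<longrightarrow> 6 * h \<le> \<bar>p - q\<bar>)}"
    define A where "A = (\<lambda>(F, h). {x \<in> eucl m. (\<forall>b. b \<in> D x \<longrightarrow> (\<exists>p\<in>F. \<bar>b - p\<bar> < h)) \<and>
        (\<forall>p\<in>F. \<exists>!b. b \<in> D x \<and> \<bar>b - p\<bar> < h)})"
    obtain B W where BW: "B \<in> A ` I" "openin (top_of_set (eucl m)) W" "W \<noteq> {}" "W \<subseteq> B \<inter> C"
    proof (rule definable_Baire[OF CD \<open>openin _ C\<close> cell_nonempty[OF C(1)]])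
      have "I \<subseteq> {F. finite F \<and> F \<subseteq> \<rat>} \<times> \<rat>" by (auto simp: I_def)
      moreover have "countable ({F. finite F \<and> F \<subseteq> \<rat>} \<times> (\<rat>::real set))"
        by (intro countable_SIGMA countable_Collect_finite_subset countable_rat)
      ultimately show "countable (A ` I)" using countable_subset by blast
      show "def_set m B" if B: "B \<in> A ` I" for B
      proof -
        obtain F h where "finite F" "B = A (F, h)" using B by (auto simp: I_def)
        then show ?thesis
          unfolding A_def by simp (rule def_setI, intro dintros Dm)
      qed
      show "C \<subseteq> \<Union>(A ` I)"
      proof
        fix x assume "x \<in> C"
        then have x: "x \<in> eucl m" using C(2) by blast
        then have "finite (D x)" using fin by blast
        then obtain F h where Fh: "finite F" "F \<subseteq> \<rat>" "h \<in> \<rat>" "0 < h"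
          "\<forall>p\<in>F. \<forall>q\<in>F. p \<noteq> q \<longrightarrow> 6 * h \<le> \<bar>p - q\<bar>"
          "\<forall>b\<in>D x. \<exists>p\<in>F. \<bar>b - p\<bar> < h"
          "\<forall>p\<in>F. \<exists>!b. b \<in> D x \<and> \<bar>b - p\<bar> < h"
          by (rule finite_real_rational_approximation)
        then have "(F, h) \<in> I" "x \<in> A (F, h)" using x by (simp_all add: I_def A_def)
        then show "x \<in> \<Union>(A ` I)" by blast
      qed
    qed
    obtain F h where Fh: "B = A (F, h)" "(F, h) \<in> I" using BW(1) by auto
    have sep: "6 * h \<le> \<bar>p - q\<bar>" if "p \<in> F" "q \<in> F" "p \<noteq> q" for p q using Fh(2) that by (simp add: I_def)
    have W_sub: "W \<subseteq> A (F, h)" using BW(4) Fh(1) by blast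
    obtain a where a: "a \<in> W" using BW(3) by blast
    then obtain \<delta> where \<delta>: "\<delta> > 0" "\<forall>y\<in>eucl m. near m \<delta> a y \<longrightarrow> y \<in> W"
      using BW(2) unfolding openin_eucl_iff by blast
    \<comment> \<open>Both fibers have exactly one point within \<open>h\<close> of each code point,
      and matching through a code point costs less than \<open>2 * h\<close>. A competitor within
      \<open>2 * h\<close> of \<open>b\<close> has a code point closer than \<open>4 * h\<close> to
      \<open>p\<close>; as code points are \<open>6 * h\<close> apart, it is \<open>p\<close>
      itself.\<close>
    have match: "\<exists>!c. c \<in> D y \<and> \<bar>b - c\<bar> < 2 * h" if xyb: "x \<in> W" "y \<in> W" "b \<in> D x" for x y b
    proof -
      have x: "x \<in> A (F, h)" and y: "y \<in> A (F, h)" using xyb W_sub by blast+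
      obtain p where p: "p \<in> F" "\<bar>b - p\<bar> < h" using x xyb(3) by (auto simp: A_def)
      have "\<exists>!c. c \<in> D y \<and> \<bar>c - p\<bar> < h" using y p(1) by (simp add: A_def)
      then obtain c where c: "c \<in> D y" "\<bar>c - p\<bar> < h" "\<And>c'. c' \<in> D y \<Longrightarrow> \<bar>c' - p\<bar> < h \<Longrightarrow> c' = c"
        by blast
      have "c' = c" if c': "c' \<in> D y" "\<bar>b - c'\<bar> < 2 * h" for c'
      proof -
        obtain q where q: "q \<in> F" "\<bar>c' - q\<bar> < h" using y c'(1) by (auto simp: A_def)
        have "q = p"
        proof (rule ccontr)
          assume "q \<noteq> p"
          then have "6 * h \<le> \<bar>q - p\<bar>" using sep q p by blast
          then show False using q(2) p(2) c'(2) by linarith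
        qed
        then show ?thesis using c(3) q c' by blast
      qed
      moreover have "\<bar>b - c\<bar> < 2 * h" using p c by linarith
      ultimately show ?thesis using c(1) by blast
    qed
    have "a \<in> G"
      unfolding G_def
    proof (intro CollectI conjI exI ballI impI allI)
      show "a \<in> eucl m" using a BW(2) openin_imp_subset by blast
      show "0 < \<delta>" by (rule \<delta>)
      fix x assume "x \<in> eucl m" "near m \<delta> a x"
      then have xW: "x \<in> W" using \<delta> by blast
      show "\<exists>!c. c \<in> D x \<and> \<bar>b - c\<bar> < 2 * h" if "b \<in> D a" for b using match[OF a xW that] .
      show "\<exists>!b. b \<in> D a \<and> \<bar>b - c\<bar> < 2 * h" if "c \<in> D x" for c
        using match[OF xW a that] by (simp add: abs_minus_commute)
    qed
    \<comment> \<open>An open cell disjoint from \<open>G\<close> would thus contain a point of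
      \<open>G\<close>, so this case does not occur.\<close>
    then show ?thesis using a BW(4) C(2) by blast
  qed
  obtain \<C>1 where \<C>1: "finite \<C>1" "\<Union>\<C>1 = G" "\<forall>C\<in>\<C>1. \<exists>d. cell m d C"
    using CD[OF G] unfolding decomposable_def by blast
  define H where "H = eucl m - G"
  have "def_set m H" unfolding H_def by (intro def_set_Diff def_set_eucl G)
  from CD[OF this] obtain \<C>2 where \<C>2: "finite \<C>2" "\<Union>\<C>2 = H" "\<forall>C\<in>\<C>2. \<exists>d. cell m d C"
    unfolding decomposable_def by blast
  note \<C> = \<C>1 \<C>2
  have "\<exists>N. \<forall>x\<in>C. card (D x) \<le> N" if C: "C \<in> \<C>1 \<union> \<C>2" for C
  proof -
    obtain d where d: "cell m d C" using \<C>(3,6) C by blast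
    have "C \<subseteq> G \<or> C \<subseteq> H" using \<C>(2,5) C by blast
    then have "C \<subseteq> G \<or> C \<subseteq> eucl m - G" unfolding H_def .
    then show ?thesis using bound_G[OF d] bound_compl[OF d] by blast
  qed
  then have "\<forall>C\<in>\<C>1 \<union> \<C>2. \<exists>N. \<forall>x\<in>C. card (D x) \<le> N" by blast
  then obtain N where N: "\<forall>C\<in>\<C>1 \<union> \<C>2. \<forall>x\<in>C. card (D x) \<le> N C" by metis
  have "card (D x) \<le> Max (N ` (\<C>1 \<union> \<C>2))" if "x \<in> eucl m" for x
  proof -
    have "x \<in> \<Union>(\<C>1 \<union> \<C>2)" using that \<C>(2,5) unfolding H_def by blast
    then obtain C where C: "C \<in> \<C>1 \<union> \<C>2" "x \<in> C" by blast
    then have "card (D x) \<le> N C" using N by blast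
    also have "\<dots> \<le> Max (N ` (\<C>1 \<union> \<C>2))" using C \<C>(1,4) by simp
    finally show ?thesis .
  qed
  then show "\<exists>N. \<forall>x\<in>eucl m. card (D x) \<le> N" by blast
qed

end

section \<open>Cell decomposition\<close>

text \<open>A semialgebraic homeomorphism of the line onto (-1, 1), with inverse
  \<open>unsquash\<close>. Endpoints of intervals, the infinite ones included, become numbers in
  [-1, 1], so every band is bounded by two real-valued functions.\<close>

definition squash :: "real \<Rightarrow> real" where "squash t = t / (1 + \<bar>t\<bar>)"
definition unsquash :: "real \<Rightarrow> real" where "unsquash y = y / (1 - \<bar>y\<bar>)"

lemma abs_squash_less_1: "\<bar>squash t\<bar> < 1"
  by (simp add: squash_def)

lemma unsquash_squash [simp]: "unsquash (squash t) = t"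
proof -
  have "\<bar>squash t\<bar> = \<bar>t\<bar> / (1 + \<bar>t\<bar>)" by (simp add: squash_def)
  moreover have "1 - \<bar>t\<bar> / (1 + \<bar>t\<bar>) = 1 / (1 + \<bar>t\<bar>)" by (simp add: field_simps)
  ultimately show ?thesis by (simp add: unsquash_def squash_def)
qed

lemma squash_unsquash [simp]: "\<bar>y\<bar> < 1 \<Longrightarrow> squash (unsquash y) = y"
proof -
  assume y: "\<bar>y\<bar> < 1"
  have "\<bar>unsquash y\<bar> = \<bar>y\<bar> / (1 - \<bar>y\<bar>)" using y by (simp add: unsquash_def)
  moreover have "1 + \<bar>y\<bar> / (1 - \<bar>y\<bar>) = 1 / (1 - \<bar>y\<bar>)" using y by (simp add: field_simps)
  ultimately show ?thesis using y by (simp add: unsquash_def squash_def)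
qed

lemma squash_less_iff [simp]: "squash s < squash t \<longleftrightarrow> s < t"
proof -
  have *: "squash s < squash t" if "s < t" for s t
  proof -
    have "s * \<bar>t\<bar> \<le> t * \<bar>s\<bar>"
      using that by (cases "0 \<le> s"; cases "0 \<le> t")
        (auto simp: abs_if mult_le_0_iff mult_nonneg_nonpos intro: order_trans[of _ 0] split: if_splits)
    then have "s * (1 + \<bar>t\<bar>) < t * (1 + \<bar>s\<bar>)" using that by (simp add: algebra_simps)
    then show ?thesis by (simp add: squash_def divide_less_eq less_divide_eq pos_divide_less_eq pos_less_divide_eq add_pos_nonneg mult.commute)
  qed
  show ?thesis using *[of s t] *[of t s] by (cases s t rule: linorder_cases) auto
qed

lemma continuous_on_squash: "continuous_on A squash"
  unfolding squash_def[abs_def] by (intro continuous_intros) (auto simp: add_nonneg_eq_0_iff)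

lemma continuous_on_unsquash: "continuous_on {-1<..<1} unsquash"
  unfolding unsquash_def[abs_def] by (intro continuous_intros) auto

definition squash_bounds :: "(real \<Rightarrow> bool) \<Rightarrow> real \<Rightarrow> real \<Rightarrow> bool" where
  "squash_bounds P l r \<longleftrightarrow> -1 \<le> l \<and> l < r \<and> r \<le> 1 \<and> (\<forall>t. P t \<longleftrightarrow> l < squash t \<and> squash t < r)"

text \<open>Allows the endpoints to be defined by description. Every number in (-1, 1) is a value of
  \<open>squash\<close>, and one of them tells two different endpoints apart.\<close>

lemma squash_bounds_unique:
  assumes "squash_bounds P l r" "squash_bounds P l' r'"
  shows "l = l' \<and> r = r'"
proof -
  have *: "l < y \<and> y < r \<longleftrightarrow> l' < y \<and> y < r'" if "\<bar>y\<bar> < 1" for y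
    using assms squash_unsquash[OF that] unfolding squash_bounds_def by metis
  have b: "-1 \<le> l" "l < r" "r \<le> 1" "-1 \<le> l'" "l' < r'" "r' \<le> 1"
    using assms by (auto simp: squash_bounds_def)
  have "l = l'"
  proof (rule ccontr)
    assume "l \<noteq> l'"
    then consider "l < l'" | "l' < l" by linarith
    then show False
    proof cases
      case 1
      then obtain y where "l < y" "y < min l' r" using b dense[of "l" "min l' r"] by auto
      moreover from this have "\<bar>y\<bar> < 1" using b by auto
      ultimately show False using *[of y] b by auto
    next
      case 2
      then obtain y where "l' < y" "y < min l r'" using b dense[of "l'" "min l r'"] by auto
      moreover from this have "\<bar>y\<bar> < 1" using b by auto
      ultimately show False using *[of y] b by auto
    qed
  qed
  moreover have "r = r'"
  proof (rule ccontr)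
    assume "r \<noteq> r'"
    then consider "r < r'" | "r' < r" by linarith
    then show False
    proof cases
      case 1
      then obtain y where "max l' r < y" "y < r'" using b dense[of "max l' r" "r'"] by auto
      moreover from this have "\<bar>y\<bar> < 1" using b by auto
      ultimately show False using *[of y] b by auto
    next
      case 2
      then obtain y where "max l r' < y" "y < r" using b dense[of "max l r'" "r"] by auto
      moreover from this have "\<bar>y\<bar> < 1" using b by auto
      ultimately show False using *[of y] b by auto
    qed
  qed
  ultimately show ?thesis by blast
qed

text \<open>Infimum and supremum of the compressed interval: openness keeps them from being
  attained, convexity fills the space between.\<close>

lemma squash_bounds_exist:
  assumes "open {t. P t}" "is_interval {t. P t}" "P t0"
  shows "\<exists>l r. squash_bounds P l r"
proof -
  let ?I = "squash ` {t. P t}"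
  have sq: "-1 < squash t" "squash t < 1" for t using abs_squash_less_1[of t] by auto
  have ne: "?I \<noteq> {}" using assms(3) by auto
  have bdd: "bdd_below ?I" "bdd_above ?I"
    using sq by (auto intro!: bdd_belowI[of _ "-1"] bdd_aboveI[of _ 1] simp: less_imp_le)
  have lr: "Inf ?I < squash t \<and> squash t < Sup ?I" if t: "P t" for t
  proof -
    obtain \<epsilon> where "\<epsilon> > 0" "ball t \<epsilon> \<subseteq> {t. P t}" using assms(1) t open_contains_ball[of "{t. P t}"] by auto
    then have "P (t - \<epsilon> / 2)" "P (t + \<epsilon> / 2)" by (auto simp: subset_iff dist_real_def)
    then have "Inf ?I \<le> squash (t - \<epsilon> / 2)" "squash (t + \<epsilon> / 2) \<le> Sup ?I"
      using bdd by (auto intro: cInf_lower cSup_upper)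
    moreover have "squash (t - \<epsilon> / 2) < squash t" "squash t < squash (t + \<epsilon> / 2)" using \<open>\<epsilon> > 0\<close> by simp_all
    ultimately show ?thesis by linarith
  qed
  have gap: "P t" if t: "Inf ?I < squash t" "squash t < Sup ?I" for t
  proof -
    obtain a where a: "P a" "a < t" using t(1) cInf_less_iff[OF ne bdd(1), of "squash t"] by auto
    obtain b where b: "P b" "t < b" using t(2) less_cSup_iff[OF ne bdd(2), of "squash t"] by auto
    show ?thesis
      using assms(2)[unfolded is_interval_1, rule_format, of a b t] a b by simp
  qed
  have b1: "-1 \<le> Inf ?I" by (rule cInf_greatest[OF ne]) (use sq in \<open>auto simp: less_imp_le\<close>)
  have b2: "Sup ?I \<le> 1" by (rule cSup_least[OF ne]) (use sq in \<open>auto simp: less_imp_le\<close>)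
  have b3: "Inf ?I < Sup ?I" using lr[OF assms(3)] by linarith
  have b4: "P t \<longleftrightarrow> Inf ?I < squash t \<and> squash t < Sup ?I" for t using lr gap by blast
  have "squash_bounds P (Inf ?I) (Sup ?I)"
    unfolding squash_bounds_def by (intro conjI allI b1 b2 b3 b4)
  then show ?thesis by (intro exI)
qed

lemma disjoint_Union_refine:
  assumes "disjoint \<Q>" "\<And>Q. Q \<in> \<Q> \<Longrightarrow> disjoint (\<C> Q)" "\<And>Q. Q \<in> \<Q> \<Longrightarrow> \<Union>(\<C> Q) = Q"
  shows "disjoint (\<Union>Q\<in>\<Q>. \<C> Q)"
proof (rule disjointI)
  fix C D assume "C \<in> (\<Union>Q\<in>\<Q>. \<C> Q)" "D \<in> (\<Union>Q\<in>\<Q>. \<C> Q)" "C \<noteq> D"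
  then obtain Q R where QR: "Q \<in> \<Q>" "C \<in> \<C> Q" "R \<in> \<Q>" "D \<in> \<C> R" by blast
  show "C \<inter> D = {}"
  proof (cases "Q = R")
    case True
    then show ?thesis using QR \<open>C \<noteq> D\<close> assms(2)[of Q] by (auto simp: disjoint_def)
  next
    case False
    then have "Q \<inter> R = {}" using QR assms(1) by (auto simp: disjoint_def)
    moreover have "C \<subseteq> Q" "D \<subseteq> R" using QR assms(3) by blast+
    ultimately show ?thesis by blast
  qed
qed

context o_minimal_field_expansion
begin

lemma def_fun_squash [dintros]: "def_fun u \<Longrightarrow> def_fun (\<lambda>e. squash (u e))"
  unfolding squash_def by (intro dintros)

lemma def_fun_unsquash [dintros]: "def_fun u \<Longrightarrow> def_fun (\<lambda>e. unsquash (u e))"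
  unfolding unsquash_def by (intro dintros)

section \<open>Refinement of decompositions\<close>

lemma def_set_disjoint_refinement:
  assumes "finite \<Q>" "\<And>Q. Q \<in> \<Q> \<Longrightarrow> def_set m Q"
  shows "\<exists>\<R>. finite \<R> \<and> disjoint \<R> \<and> \<Union>\<R> = \<Union>\<Q> \<and> (\<forall>R\<in>\<R>. def_set m R \<and> (\<exists>Q\<in>\<Q>. R \<subseteq> Q))"
  using assms
proof (induction \<Q> rule: finite_induct)
  case empty
  then show ?case by (intro exI[of _ "{}"]) auto
next
  case (insert A \<Q>)
  then obtain \<R> where R: "finite \<R>" "disjoint \<R>" "\<Union>\<R> = \<Union>\<Q>" "\<forall>R\<in>\<R>. def_set m R \<and> (\<exists>Q\<in>\<Q>. R \<subseteq> Q)"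
    by auto
  have "def_set m (A - \<Union>\<Q>)" by (intro def_set_Diff def_set_Union) (use insert in auto)
  moreover have "disjoint ({A - \<Union>\<Q>} \<union> \<R>)"
    using R(2,3) by (intro disjoint_union) auto
  ultimately show ?case
    using R by (intro exI[of _ "{A - \<Union>\<Q>} \<union> \<R>"]) auto
qed

text \<open>The functions are treated one after the other: pieces of continuity for the first are
  made disjoint, and each is decomposed for the rest. Continuity passes to subsets, so nothing
  gained is lost.\<close>

lemma cells_with_continuity:
  assumes CD: "\<And>A. def_set m A \<Longrightarrow> decomposable m A"
    and PC: "\<And>B f. def_set m B \<Longrightarrow> def_fun (\<lambda>e. f (trunc m e)) \<Longrightarrow> piecewise_continuous m B f"
  shows "def_set m B \<Longrightarrow> (\<And>f. f \<in> set fs \<Longrightarrow> def_fun (\<lambda>e. f (trunc m e))) \<Longrightarrow>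
    \<exists>\<C>. finite \<C> \<and> disjoint \<C> \<and> \<Union>\<C> = B \<and>
      (\<forall>C\<in>\<C>. (\<exists>d. cell m d C) \<and> (\<forall>f\<in>set fs. continuous_on C f))"
proof (induction fs arbitrary: B)
  case Nil
  then show ?case using CD[of B] by (auto simp: decomposable_def)
next
  case (Cons f fs)
  obtain \<Q> where \<Q>: "finite \<Q>" "\<Union>\<Q> = B" "\<forall>Q\<in>\<Q>. def_set m Q \<and> continuous_on Q f"
    using PC[OF Cons.prems(1), of f] Cons.prems(2) unfolding piecewise_continuous_def by auto
  obtain \<R> where \<R>: "finite \<R>" "disjoint \<R>" "\<Union>\<R> = B" "\<forall>R\<in>\<R>. def_set m R \<and> (\<exists>Q\<in>\<Q>. R \<subseteq> Q)"
    using def_set_disjoint_refinement[OF \<Q>(1)] \<Q>(2,3) by metis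
  have "\<forall>R\<in>\<R>. \<exists>\<C>. finite \<C> \<and> disjoint \<C> \<and> \<Union>\<C> = R \<and>
      (\<forall>C\<in>\<C>. (\<exists>d. cell m d C) \<and> (\<forall>f\<in>set fs. continuous_on C f))"
    using Cons.IH \<R>(4) Cons.prems(2) by auto
  then obtain \<C> where \<C>: "\<forall>R\<in>\<R>. finite (\<C> R) \<and> disjoint (\<C> R) \<and> \<Union>(\<C> R) = R \<and>
      (\<forall>C\<in>\<C> R. (\<exists>d. cell m d C) \<and> (\<forall>f\<in>set fs. continuous_on C f))"
    by metis
  show ?case
  proof (rule exI, intro conjI ballI)
    show "finite (\<Union>R\<in>\<R>. \<C> R)" using \<R>(1) \<C> by auto
    show "disjoint (\<Union>R\<in>\<R>. \<C> R)" using \<R>(2) \<C> by (intro disjoint_Union_refine) auto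
    have "\<Union>(\<Union>R\<in>\<R>. \<C> R) = (\<Union>R\<in>\<R>. \<Union>(\<C> R))" by blast
    also have "\<dots> = B" using \<C> \<R>(3) by simp
    finally show "\<Union>(\<Union>R\<in>\<R>. \<C> R) = B" .
    fix C assume "C \<in> (\<Union>R\<in>\<R>. \<C> R)"
    then obtain R where R: "R \<in> \<R>" "C \<in> \<C> R" by blast
    then show "\<exists>d. cell m d C" using \<C> by blast
    fix g assume g: "g \<in> set (f # fs)"
    show "continuous_on C g"
    proof (cases "g = f")
      case True
      obtain Q where "Q \<in> \<Q>" "R \<subseteq> Q" using \<R>(4) R by blast
      moreover have "C \<subseteq> R" using \<C> R by blast
      ultimately show ?thesis using \<Q>(3) True continuous_on_subset by blast
    next
      case False
      then show ?thesis using g \<C> R by auto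
    qed
  qed
qed

section \<open>Cells over graphs and bands\<close>

lemma trunc_tail_trunc: "trunc d (\<lambda>i. trunc (Suc d) e (Suc i)) = trunc d (\<lambda>i. e (Suc i))"
  by (auto simp: trunc_def fun_eq_iff)

text \<open>With at most one point over each base point the set is the graph of a definable
  function. Over a cell of continuity the graph is a cell of the same dimension, lifted by the
  function and returned by the projection.\<close>

lemma graph_decomposable:
  assumes CD: "\<And>A. def_set m A \<Longrightarrow> decomposable m A"
    and PC: "\<And>B f. def_set m B \<Longrightarrow> def_fun (\<lambda>e. f (trunc m e)) \<Longrightarrow> piecewise_continuous m B f"
    and A: "def_set (Suc m) A" "\<And>x a b. a ## x \<in> A \<Longrightarrow> b ## x \<in> A \<Longrightarrow> a = b"
  shows "decomposable (Suc m) A"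
proof -
  have mem: "def_pred (\<lambda>e. e k ## trunc m (\<lambda>i. e (\<sigma> i)) \<in> A)" for k \<sigma>
    by (rule def_pred_mem[OF A(1)]) (auto intro!: dintros)
  define f where "f x = (THE a. a ## x \<in> A)" for x
  have f: "def_fun (\<lambda>e. f (trunc m e))"
    unfolding f_def by (rule def_fun_The) (use mem A(2) in blast)+
  have f_eq: "f x = a" if "a ## x \<in> A" for x a
    unfolding f_def using that A(2) by blast
  define B where "B = {x \<in> eucl m. \<exists>a. a ## x \<in> A}"
  have "def_set m B" unfolding B_def by (rule def_setI) (intro dintros mem)
  then obtain \<C> where \<C>: "finite \<C>" "disjoint \<C>" "\<Union>\<C> = B"
    "\<forall>C\<in>\<C>. (\<exists>d. cell m d C) \<and> (\<forall>g\<in>set [f]. continuous_on C g)"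
    using cells_with_continuity[OF CD PC, of B "[f]"] f by auto
  let ?F = "\<lambda>x. f x ## x"
  have inj: "inj ?F" by (rule injI) simp
  have A_eq: "A = ?F ` B"
  proof safe
    fix y assume y: "y \<in> A"
    then obtain a x where ax: "y = a ## x" "x \<in> eucl m"
      using def_set_subset[OF A(1)] eucl_Suc_cases by blast
    then have "y = ?F x" "x \<in> B" using f_eq y by (auto simp: B_def)
    then show "y \<in> ?F ` B" by blast
  next
    fix x assume "x \<in> B"
    then show "?F x \<in> A" using f_eq by (auto simp: B_def)
  qed
  show ?thesis
    unfolding decomposable_def
  proof (rule exI, intro conjI ballI)
    show "finite ((`) ?F ` \<C>)" using \<C>(1) by simp
    show "disjoint ((`) ?F ` \<C>)" by (rule disjoint_image[OF inj_on_subset[OF inj] \<C>(2)]) simp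
    show "\<Union>((`) ?F ` \<C>) = A" unfolding A_eq \<C>(3)[symmetric] by blast
    fix C' assume "C' \<in> (`) ?F ` \<C>"
    then obtain C where C: "C \<in> \<C>" "C' = ?F ` C" by blast
    then obtain d where d: "cell m d C" and cont: "continuous_on C f" using \<C>(4) by auto
    then obtain \<phi> \<psi> where *: "d \<le> m" "C \<subseteq> eucl m" "homeomorphism (std_simplex d) C \<phi> \<psi>"
      "\<And>i. def_fun (\<lambda>e. \<phi> (trunc d e) i)" unfolding cell_def by blast
    have h: "continuous_on (std_simplex d) \<phi>" "continuous_on C \<psi>" "\<phi> ` std_simplex d = C"
      "\<psi> ` C = std_simplex d" "\<forall>u\<in>std_simplex d. \<psi> (\<phi> u) = u" "\<forall>x\<in>C. \<phi> (\<psi> x) = x"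
      using *(3) by (auto simp: homeomorphism_def)
    have \<phi>E: "trunc m (\<phi> u) = \<phi> u" if "u \<in> std_simplex d" for u
      using that h(3) *(2) by (intro trunc_eucl) blast
    \<comment> \<open>\<open>trunc m\<close> changes nothing on the simplex, and it makes the
      composite definable in every environment.\<close>
    let ?\<phi>' = "\<lambda>u. f (trunc m (\<phi> u)) ## \<phi> u" and ?\<psi>' = "\<lambda>y. \<psi> (\<lambda>i. y (Suc i))"
    have "cell (Suc m) d C'"
      unfolding cell_def
    proof (intro conjI exI allI)
      show "d \<le> Suc m" using * by simp
      show "C' \<subseteq> eucl (Suc m)" using C *(2) by auto
      show "homeomorphism (std_simplex d) C' ?\<phi>' ?\<psi>'"
      proof (rule homeomorphismI)
        have "continuous_on (std_simplex d) (\<lambda>u. f (\<phi> u))"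
          by (rule continuous_on_compose2[OF cont h(1)]) (simp add: h(3))
        then have "continuous_on (std_simplex d) (\<lambda>u. f (trunc m (\<phi> u)))"
          by (rule continuous_on_eq) (simp add: \<phi>E)
        then show "continuous_on (std_simplex d) ?\<phi>'" by (intro continuous_intros h(1))
        show "continuous_on C' ?\<psi>'"
          by (rule continuous_on_compose2[OF h(2)])
            (auto simp: C intro!: continuous_on_tail continuous_on_id)
        show "?\<phi>' ` std_simplex d \<subseteq> C'" using h(3) \<phi>E C by auto
        show "?\<psi>' ` C' \<subseteq> std_simplex d" using h(4) C by auto
      qed (use h \<phi>E C in auto)
      fix i
      have "def_fun (\<lambda>e. f (trunc m (\<phi> (trunc d e))))"
        using def_fun_comp[OF f, of "\<lambda>i e. \<phi> (trunc d e) i"] *(4) by simp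
      then show "def_fun (\<lambda>e. ?\<phi>' (trunc d e) i)" by (intro dintros *(4))
    qed
    then show "\<exists>d. cell (Suc m) d C'" by blast
  qed
qed

text \<open>The endpoints of the fibers are definable functions of the base point, by uniqueness of
  \<open>squash_bounds\<close>. Over a cell where both are continuous, the band is a cell of one
  dimension more.\<close>

lemma band_decomposable:
  assumes CD: "\<And>A. def_set m A \<Longrightarrow> decomposable m A"
    and PC: "\<And>B f. def_set m B \<Longrightarrow> def_fun (\<lambda>e. f (trunc m e)) \<Longrightarrow> piecewise_continuous m B f"
    and A: "def_set (Suc m) A" "\<And>x. open {t. t ## x \<in> A}" "\<And>x. is_interval {t. t ## x \<in> A}"
  shows "decomposable (Suc m) A"
proof -
  have mem: "def_pred (\<lambda>e. e k ## trunc m (\<lambda>i. e (\<sigma> i)) \<in> A)" for k \<sigma>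
    by (rule def_pred_mem[OF A(1)]) (auto intro!: dintros)
  define l where "l x = (THE l. \<exists>r. squash_bounds (\<lambda>t. t ## x \<in> A) l r)" for x
  define r where "r x = (THE r. \<exists>l. squash_bounds (\<lambda>t. t ## x \<in> A) l r)" for x
  have l: "def_fun (\<lambda>e. l (trunc m e))"
    unfolding l_def
  proof (rule def_fun_The)
    show "def_pred (\<lambda>e. \<exists>r. squash_bounds (\<lambda>t. t ## trunc m (\<lambda>i. e (Suc i)) \<in> A) (e 0) r)"
      unfolding squash_bounds_def by (intro dintros mem)
  qed (use squash_bounds_unique in blast)
  have r: "def_fun (\<lambda>e. r (trunc m e))"
    unfolding r_def
  proof (rule def_fun_The)
    show "def_pred (\<lambda>e. \<exists>l. squash_bounds (\<lambda>t. t ## trunc m (\<lambda>i. e (Suc i)) \<in> A) l (e 0))"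
      unfolding squash_bounds_def by (intro dintros mem)
  qed (use squash_bounds_unique in blast)
  define B where "B = {x \<in> eucl m. \<exists>a. a ## x \<in> A}"
  have "def_set m B" unfolding B_def by (rule def_setI) (intro dintros mem)
  then obtain \<C> where \<C>: "finite \<C>" "disjoint \<C>" "\<Union>\<C> = B"
    "\<forall>C\<in>\<C>. (\<exists>d. cell m d C) \<and> (\<forall>g\<in>set [l, r]. continuous_on C g)"
    using cells_with_continuity[OF CD PC, of B "[l, r]"] l r by auto
  have bounds: "squash_bounds (\<lambda>t. t ## x \<in> A) (l x) (r x)" if xB: "x \<in> B" for x
  proof -
    obtain a where "a ## x \<in> A" using xB by (auto simp: B_def)
    then obtain l' r' where lr: "squash_bounds (\<lambda>t. t ## x \<in> A) l' r'"
      using squash_bounds_exist[of "\<lambda>t. t ## x \<in> A"] A(2,3) by blast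
    then have "l x = l'" "r x = r'"
      unfolding l_def r_def using squash_bounds_unique by blast+
    then show ?thesis using lr by simp
  qed
  let ?F = "\<lambda>C. {y \<in> A. (\<lambda>i. y (Suc i)) \<in> C}"
  have tail_B: "(\<lambda>i. y (Suc i)) \<in> B" if yA: "y \<in> A" for y
  proof -
    obtain a x where "y = a ## x" "x \<in> eucl m"
      using yA def_set_subset[OF A(1)] eucl_Suc_cases by blast
    then show ?thesis using yA by (auto simp: B_def)
  qed
  show ?thesis
    unfolding decomposable_def
  proof (rule exI, intro conjI ballI)
    show "finite (?F ` \<C>)" using \<C>(1) by simp
    show "disjoint (?F ` \<C>)"
    proof (rule disjointI)
      fix S T assume "S \<in> ?F ` \<C>" "T \<in> ?F ` \<C>" "S \<noteq> T"
      then obtain C D where "C \<in> \<C>" "D \<in> \<C>" "S = ?F C" "T = ?F D" "C \<noteq> D" by blast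
      then show "S \<inter> T = {}" using \<C>(2) by (auto simp: disjoint_def)
    qed
    show "\<Union>(?F ` \<C>) = A" using tail_B \<C>(3) by blast
    fix C' assume "C' \<in> ?F ` \<C>"
    then obtain C where C: "C \<in> \<C>" "C' = ?F C" by blast
    have CB: "C \<subseteq> B" using C \<C>(3) by blast
    obtain d where d: "cell m d C" and cont: "continuous_on C l" "continuous_on C r" using C \<C>(4) by auto
    then obtain \<phi> \<psi> where *: "d \<le> m" "C \<subseteq> eucl m" "homeomorphism (std_simplex d) C \<phi> \<psi>"
      "\<And>i. def_fun (\<lambda>e. \<phi> (trunc d e) i)" unfolding cell_def by blast
    have h: "continuous_on (std_simplex d) \<phi>" "continuous_on C \<psi>" "\<phi> ` std_simplex d = C"
      "\<psi> ` C = std_simplex d" "\<forall>u\<in>std_simplex d. \<psi> (\<phi> u) = u" "\<forall>x\<in>C. \<phi> (\<psi> x) = x"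
      using *(3) by (auto simp: homeomorphism_def)
    \<comment> \<open>Dividing the first coordinate by its range gives a number in (0, 1), which
      interpolates between the compressed endpoints; \<open>unsquash\<close> returns to the line.
      \<open>\<psi>0\<close> undoes these steps in reverse order.\<close>
    define \<phi>0 where "\<phi>0 v = (let x = \<phi> (\<lambda>i. v (Suc i)) in
      unsquash (l x + v 0 / (1 - (\<Sum>i<d. v (Suc i))) * (r x - l x)) ## x)" for v
    define \<psi>0 where "\<psi>0 y = (let x = (\<lambda>i. y (Suc i)); u = \<psi> x in
      ((squash (y 0) - l x) / (r x - l x) * (1 - (\<Sum>i<d. u i))) ## u)" for y
    \<comment> \<open>The same map with truncations inserted, which is the form that is definable;
      both agree on the simplex.\<close>
    define \<phi>1 where "\<phi>1 v = (let x = trunc m (\<phi> (trunc d (\<lambda>i. v (Suc i)))) in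
      unsquash (l x + v 0 / (1 - (\<Sum>i<d. v (Suc i))) * (r x - l x)) ## x)" for v
    have \<phi>1_eq: "\<phi>0 v = \<phi>1 v" if v: "v \<in> std_simplex (Suc d)" for v
    proof -
      have "(\<lambda>i. v (Suc i)) \<in> std_simplex d"
        using vcons_in_std_simplex[of "v 0" "\<lambda>i. v (Suc i)" d] v by simp
      then have "trunc d (\<lambda>i. v (Suc i)) = (\<lambda>i. v (Suc i))" "\<phi> (\<lambda>i. v (Suc i)) \<in> eucl m"
        using std_simplex_subset h(3) *(2) by (auto simp: subset_iff)
      then show ?thesis by (simp add: \<phi>0_def \<phi>1_def)
    qed
    have lr: "-1 \<le> l x" "l x < r x" "r x \<le> 1" "t ## x \<in> A \<longleftrightarrow> l x < squash t \<and> squash t < r x"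
      if "x \<in> C" for x t
      using bounds[of x] CB that by (auto simp: squash_bounds_def)
    have main: "homeomorphism (std_simplex (Suc d)) C' \<phi>0 \<psi>0"
    proof (rule homeomorphismI)
      let ?S = "std_simplex (Suc d)"
      have tl: "(\<lambda>i. v (Suc i)) \<in> std_simplex d" "0 < v 0" "v 0 < 1 - (\<Sum>i<d. v (Suc i))" if "v \<in> ?S" for v
        using vcons_in_std_simplex[of "v 0" "\<lambda>i. v (Suc i)" d] that by auto
      have xC: "\<phi> (\<lambda>i. v (Suc i)) \<in> C" if "v \<in> ?S" for v using tl(1)[OF that] h(3) by blast
      have frac: "0 < v 0 / (1 - (\<Sum>i<d. v (Suc i)))" "v 0 / (1 - (\<Sum>i<d. v (Suc i))) < 1" if "v \<in> ?S" for v
        using tl[OF that] by auto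
      have between: "l x < l x + q * (r x - l x) \<and> l x + q * (r x - l x) < r x" if "x \<in> C" "0 < q" "q < 1" for x q
      proof -
        have "0 < q * (r x - l x)" "q * (r x - l x) < 1 * (r x - l x)"
          using lr(2)[OF that(1)] that by (simp, intro mult_strict_right_mono) auto
        then show ?thesis by auto
      qed
      have ball: "l x + q * (r x - l x) \<in> {-1<..<1}" if "x \<in> C" "0 < q" "q < 1" for x q
        using between[OF that] lr(1,3)[OF that(1)] by auto
      have ct: "continuous_on ?S (\<lambda>v. \<phi> (\<lambda>i. v (Suc i)))"
        by (rule continuous_on_compose2[OF h(1)])
          (auto intro!: continuous_on_tail continuous_on_id tl)
      have cl: "continuous_on ?S (\<lambda>v. l (\<phi> (\<lambda>i. v (Suc i))))" "continuous_on ?S (\<lambda>v. r (\<phi> (\<lambda>i. v (Suc i))))"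
        by (rule continuous_on_compose2[OF cont(1) ct], use xC in blast)
          (rule continuous_on_compose2[OF cont(2) ct], use xC in blast)
      have c0: "continuous_on T (\<lambda>v. v i)" for i and T :: "(nat \<Rightarrow> real) set"
        by (rule continuous_on_subset[OF continuous_on_product_coordinates]) simp
      have "continuous_on ?S (\<lambda>v. unsquash (l (\<phi> (\<lambda>i. v (Suc i))) + v 0 / (1 - (\<Sum>i<d. v (Suc i))) *
          (r (\<phi> (\<lambda>i. v (Suc i))) - l (\<phi> (\<lambda>i. v (Suc i))))))"
      proof (rule continuous_on_compose2[OF continuous_on_unsquash])
        show "continuous_on ?S (\<lambda>v. l (\<phi> (\<lambda>i. v (Suc i))) + v 0 / (1 - (\<Sum>i<d. v (Suc i))) *
          (r (\<phi> (\<lambda>i. v (Suc i))) - l (\<phi> (\<lambda>i. v (Suc i)))))"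
          by (intro continuous_intros cl c0) (use tl in force)
      qed (use ball xC frac in blast)
      then show "continuous_on ?S \<phi>0"
        unfolding \<phi>0_def Let_def by (intro continuous_intros ct)
      have tlC: "(\<lambda>i. y (Suc i)) \<in> C" if "y \<in> C'" for y using that C by simp
      have ct': "continuous_on C' (\<lambda>y. \<psi> (\<lambda>i. y (Suc i)))"
        by (rule continuous_on_compose2[OF h(2)])
          (auto intro!: continuous_on_tail continuous_on_id tlC)
      have ctl: "continuous_on C' (\<lambda>y i. y (Suc i))" by (intro continuous_on_tail continuous_on_id)
      have cl': "continuous_on C' (\<lambda>y. l (\<lambda>i. y (Suc i)))" "continuous_on C' (\<lambda>y. r (\<lambda>i. y (Suc i)))"
        by (rule continuous_on_compose2[OF cont(1) ctl], use tlC in blast)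
          (rule continuous_on_compose2[OF cont(2) ctl], use tlC in blast)
      have cs: "continuous_on C' (\<lambda>y. squash (y 0))"
        by (rule continuous_on_compose2[OF continuous_on_squash[of UNIV] c0]) simp
      have cps: "continuous_on C' (\<lambda>y. \<psi> (\<lambda>i. y (Suc i)) j)" for j
        using continuous_on_product_then_coordinatewise[OF ct'] .
      show "continuous_on C' \<psi>0"
        unfolding \<psi>0_def Let_def
        by (intro continuous_intros ct' cl' cs cps) (use tlC lr(2) in force)
      show "\<phi>0 ` ?S \<subseteq> C'"
      proof safe
        fix v assume v: "v \<in> ?S"
        let ?x = "\<phi> (\<lambda>i. v (Suc i))" and ?q = "v 0 / (1 - (\<Sum>i<d. v (Suc i)))"
        have "\<bar>l ?x + ?q * (r ?x - l ?x)\<bar> < 1" using ball[OF xC[OF v] frac[OF v]] by (simp add: abs_less_iff)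
        then have "\<phi>0 v \<in> A"
          unfolding \<phi>0_def Let_def using lr(4)[OF xC[OF v]] between[OF xC[OF v] frac[OF v]] by simp
        then show "\<phi>0 v \<in> C'" using xC[OF v] C by (simp add: \<phi>0_def Let_def)
      qed
      have \<psi>S: "\<psi> x \<in> std_simplex d" if "x \<in> C" for x using that h(4) by blast
      have pos: "0 < 1 - (\<Sum>i<d. \<psi> x i)" if "x \<in> C" for x using std_simplex_sum_less[OF \<psi>S[OF that]] by simp
      show "\<psi>0 ` C' \<subseteq> ?S"
      proof safe
        fix y assume y: "y \<in> C'"
        let ?x = "\<lambda>i. y (Suc i)"
        have x: "?x \<in> C" using tlC[OF y] .
        have "y 0 ## ?x \<in> A" using y C by simp
        then have "l ?x < squash (y 0)" "squash (y 0) < r ?x" using lr(4)[OF x] by blast+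
        then have q: "0 < (squash (y 0) - l ?x) / (r ?x - l ?x)" "(squash (y 0) - l ?x) / (r ?x - l ?x) < 1"
          by auto
        then have "(squash (y 0) - l ?x) / (r ?x - l ?x) * (1 - (\<Sum>i<d. \<psi> ?x i)) < 1 * (1 - (\<Sum>i<d. \<psi> ?x i))"
          using pos[OF x] by (intro mult_strict_right_mono)
        then show "\<psi>0 y \<in> ?S"
          unfolding \<psi>0_def Let_def vcons_in_std_simplex
          using \<psi>S[OF x] mult_pos_pos[OF q(1) pos[OF x]] by simp
      qed
      show "\<psi>0 (\<phi>0 v) = v" if v: "v \<in> ?S" for v
      proof -
        let ?x = "\<phi> (\<lambda>i. v (Suc i))" and ?s = "1 - (\<Sum>i<d. v (Suc i))"
        have "\<bar>l ?x + v 0 / ?s * (r ?x - l ?x)\<bar> < 1" using ball[OF xC[OF v] frac[OF v]] by (simp add: abs_less_iff)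
        then have "\<psi>0 (\<phi>0 v) = ((l ?x + v 0 / ?s * (r ?x - l ?x) - l ?x) / (r ?x - l ?x) * ?s) ## (\<lambda>i. v (Suc i))"
          using tl(1)[OF v] h(5) by (simp add: \<psi>0_def \<phi>0_def Let_def)
        also have "(l ?x + v 0 / ?s * (r ?x - l ?x) - l ?x) / (r ?x - l ?x) * ?s = v 0"
          using lr(2)[OF xC[OF v]] tl(2,3)[OF v] by simp
        finally show ?thesis by simp
      qed
      show "\<phi>0 (\<psi>0 y) = y" if y: "y \<in> C'" for y
      proof -
        let ?x = "\<lambda>i. y (Suc i)"
        have x: "?x \<in> C" using tlC[OF y] .
        let ?s = "1 - (\<Sum>i<d. \<psi> ?x i)" and ?q = "(squash (y 0) - l ?x) / (r ?x - l ?x)"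
        have "?q * ?s / ?s = ?q" using pos[OF x] by simp
        then have "\<phi>0 (\<psi>0 y) = unsquash (l ?x + ?q * (r ?x - l ?x)) ## ?x"
          using h(6) x by (simp add: \<phi>0_def \<psi>0_def Let_def)
        also have "unsquash (l ?x + ?q * (r ?x - l ?x)) = y 0" using lr(2)[OF x] by simp
        finally show ?thesis by simp
      qed
    qed
    have "cell (Suc m) (Suc d) C'"
      unfolding cell_def
    proof (intro conjI exI allI)
      show "Suc d \<le> Suc m" using * by simp
      show "C' \<subseteq> eucl (Suc m)" using C def_set_subset[OF A(1)] by blast
      show "homeomorphism (std_simplex (Suc d)) C' \<phi>1 \<psi>0"
        by (rule homeomorphism_cong[OF main]) (simp_all add: \<phi>1_eq)
      have \<phi>c: "def_fun (\<lambda>e. \<phi> (trunc d (\<lambda>i. e (\<sigma> i))) j)" for \<sigma> j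
        using def_fun_subst[OF *(4)] .
      have lc: "def_fun (\<lambda>e. l (trunc m (\<phi> (trunc d (\<lambda>i. e (Suc i))))))"
        using def_fun_comp[OF l, of "\<lambda>i e. \<phi> (trunc d (\<lambda>i. e (Suc i))) i"] \<phi>c by simp
      have rc: "def_fun (\<lambda>e. r (trunc m (\<phi> (trunc d (\<lambda>i. e (Suc i))))))"
        using def_fun_comp[OF r, of "\<lambda>i e. \<phi> (trunc d (\<lambda>i. e (Suc i))) i"] \<phi>c by simp
      have tc: "def_fun (\<lambda>e. trunc (Suc d) e j)" for j
        using def_fun_trunc[of "Suc d" "\<lambda>i. i" j] by simp
      have xc: "def_fun (\<lambda>e. trunc m (\<phi> (trunc d (\<lambda>i. e (Suc i)))) j)" for j
        unfolding trunc_apply[of m] by (intro dintros \<phi>c)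
      fix i
      show "def_fun (\<lambda>e. \<phi>1 (trunc (Suc d) e) i)"
        unfolding \<phi>1_def Let_def trunc_tail_trunc by (intro dintros lc rc tc xc)
    qed
    then show "\<exists>d. cell (Suc m) d C'" by blast
  qed
qed

text \<open>Uniform finiteness in dimension \<open>m\<close> bounds the frontiers of all fibers, so
  the set splits into finitely many graphs and bands over the base.\<close>

lemma decomposable_step:
  assumes CD: "\<And>A. def_set m A \<Longrightarrow> decomposable m A"
    and PC: "\<And>B f. def_set m B \<Longrightarrow> def_fun (\<lambda>e. f (trunc m e)) \<Longrightarrow> piecewise_continuous m B f"
    and UF: "uniformly_finite m" and A: "def_set (Suc m) A"
  shows "decomposable (Suc m) A"
proof -
  define P where "P e t \<longleftrightarrow> t ## trunc m e \<in> A" for e t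
  have P: "def_pred (\<lambda>e. P (\<lambda>i. e (Suc i)) (e 0))"
    unfolding P_def by (rule def_pred_mem[OF A]) (auto intro!: dintros)
  have "\<forall>x\<in>eucl m. finite (frontier {t. P x t})"
    using finite_frontier_def def_pred_fiber[OF P] by blast
  moreover have "def_pred (\<lambda>e. e 0 \<in> frontier {t. P (trunc m (\<lambda>i. e (Suc i))) t})"
  proof -
    have "P (trunc m e) = P e" for e by (simp add: P_def fun_eq_iff)
    then show ?thesis using def_pred_frontier[OF P] by simp
  qed
  ultimately obtain N where N: "\<forall>x\<in>eucl m. card (frontier {t. P x t}) \<le> N"
    using UF unfolding uniformly_finite_def by (elim allE[of _ "\<lambda>x. frontier {t. P x t}"]) blast
  have "card (frontier {t. P e t}) \<le> N" for e
  proof -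
    have "P (trunc m e) = P e" by (simp add: P_def fun_eq_iff)
    then show ?thesis using N[rule_format, OF trunc_in_eucl[of m e]] by simp
  qed
  then obtain M :: nat and Q where Q0:
    "\<forall>j<M. def_pred (\<lambda>e. Q j (\<lambda>i. e (Suc i)) (e 0))"
    "\<forall>e t. P e t \<longleftrightarrow> (\<exists>j<M. Q j e t)" "\<forall>j k e t. Q j e t \<longrightarrow> Q k e t \<longrightarrow> j = k"
    "\<forall>j<M. (\<forall>e a b. Q j e a \<longrightarrow> Q j e b \<longrightarrow> a = b) \<or>
        (\<forall>e. open {t. Q j e t} \<and> is_interval {t. Q j e t})"
    by (rule fiber_decomposition[OF P])
  note Q = Q0(1)[rule_format] Q0(2)[rule_format] Q0(3)[rule_format]
  define B where "B j = {y \<in> eucl (Suc m). Q j (\<lambda>i. y (Suc i)) (y 0)}" for j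
  have mem_B: "t ## x \<in> B j \<longleftrightarrow> x \<in> eucl m \<and> Q j x t" for t x j
    by (auto simp: B_def)
  have "A = (\<Union>j\<in>{..<M}. B j)"
  proof (rule Set.set_eqI)
    fix y
    show "y \<in> A \<longleftrightarrow> y \<in> (\<Union>j\<in>{..<M}. B j)"
    proof (cases "y \<in> eucl (Suc m)")
      case True
      then obtain t x where y: "y = t ## x" "x \<in> eucl m" by (rule eucl_Suc_cases)
      then show ?thesis using Q(2)[of x t] by (auto simp: P_def mem_B)
    next
      case False
      then show ?thesis using def_set_subset[OF A] by (auto simp: B_def)
    qed
  qed
  moreover have "decomposable (Suc m) (\<Union>j\<in>{..<M}. B j)"
  proof (rule decomposable_UN)
    fix j assume "j \<in> {..<M}"
    then have j: "j < M" by simp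
    have "def_pred (\<lambda>e. Q j (\<lambda>i. trunc (Suc m) e (Suc i)) (trunc (Suc m) e 0))"
      using def_pred_comp[OF Q(1)[OF j], of "\<lambda>i e. trunc (Suc m) e i"] def_fun_trunc[of "Suc m" "\<lambda>i. i"] by simp
    then have B: "def_set (Suc m) (B j)" unfolding B_def by (intro def_setI)
    from Q0(4)[THEN spec, THEN mp, OF j] show "decomposable (Suc m) (B j)"
    proof
      assume *: "\<forall>e a b. Q j e a \<longrightarrow> Q j e b \<longrightarrow> a = b"
      show ?thesis by (rule graph_decomposable[OF CD PC B]) (use * mem_B in blast)+
    next
      assume *: "\<forall>e. open {t. Q j e t} \<and> is_interval {t. Q j e t}"
      have "{t. t ## x \<in> B j} = (if x \<in> eucl m then {t. Q j x t} else {})" for x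
        by (auto simp: mem_B)
      then show ?thesis
        using * by (intro band_decomposable[OF CD PC B]) auto
    qed
  next
    fix j k assume "j \<in> {..<M}" "k \<in> {..<M}" "j \<noteq> k"
    then show "B j \<inter> B k = {}" using Q(3) by (auto simp: B_def)
  qed simp
  ultimately show ?thesis by simp
qed

text \<open>Decomposition in dimension \<open>m\<close> uses all three statements in dimension
  \<open>m - 1\<close>. It then feeds the category argument for the other two statements in
  dimension \<open>m\<close>, which refer to themselves only in smaller dimensions.\<close>

theorem cell_decomposition: "def_set m A \<Longrightarrow> decomposable m A"
  and uniform_finiteness: "uniformly_finite m"
  and piecewise_continuity: "def_set m B \<Longrightarrow> def_fun (\<lambda>e. f (trunc m e)) \<Longrightarrow> piecewise_continuous m B f"
proof -
  have "(\<forall>A. def_set m A \<longrightarrow> decomposable m A) \<and> uniformly_finite m \<and>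
    (\<forall>B f. def_set m B \<longrightarrow> def_fun (\<lambda>e. f (trunc m e)) \<longrightarrow> piecewise_continuous m B f)"
  proof (induction m rule: less_induct)
    case (less m)
    have CD: "decomposable m A" if A: "def_set m A" for A
    proof (cases m)
      case 0
      then have "A = {} \<or> A = eucl 0" using def_set_subset[OF A] by (auto simp: eucl_0)
      moreover have "std_simplex 0 = eucl 0" by (auto simp: std_simplex_def)
      then have "cell 0 0 (eucl 0)"
        unfolding cell_def
        by (intro conjI exI[of _ "\<lambda>x. x"] allI) (auto simp: homeomorphism_def trunc_def intro: dintros)
      ultimately show ?thesis
        unfolding decomposable_def 0 by (elim disjE) (rule exI[of _ "{}"], simp, rule exI[of _ "{eucl 0}"], auto)
    next
      case (Suc k)
      have k: "k < m" using Suc by simp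
      have IH: "\<And>A. def_set k A \<Longrightarrow> decomposable k A" "uniformly_finite k"
        "\<And>B f. def_set k B \<Longrightarrow> def_fun (\<lambda>e. f (trunc k e)) \<Longrightarrow> piecewise_continuous k B f"
        using less[OF k] by simp_all
      show ?thesis using decomposable_step[OF IH(1,3,2)] A Suc by simp
    qed
    have "uniformly_finite m" by (rule uniformly_finite_step[OF CD]) (use less in simp_all)
    moreover have "piecewise_continuous m B f" if "def_set m B" "def_fun (\<lambda>e. f (trunc m e))" for B f
      by (rule piecewise_continuous_step[OF CD _ that]) (use less in simp_all)
    ultimately show ?case using CD by blast
  qed
  then show "def_set m A \<Longrightarrow> decomposable m A" "uniformly_finite m"
    "def_set m B \<Longrightarrow> def_fun (\<lambda>e. f (trunc m e)) \<Longrightarrow> piecewise_continuous m B f"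
    by blast+
qed

end

section \<open>Iterated Euler integrals\<close>

text \<open>Step functions with finitely many breakpoints, described by the frontiers of their
  levels because this is what \<open>finite_frontier_def\<close> provides.\<close>

definition tame :: "(real \<Rightarrow> int) \<Rightarrow> bool" where
  "tame h \<longleftrightarrow> finite (range h) \<and> (\<forall>k. finite (frontier {t. h t = k}))"

definition right_val :: "(real \<Rightarrow> int) \<Rightarrow> real \<Rightarrow> int" where
  "right_val h a = (THE k. \<forall>\<^sub>F s in at_right a. h s = k)"

definition bot_val :: "(real \<Rightarrow> int) \<Rightarrow> int" where
  "bot_val h = (THE k. \<forall>\<^sub>F s in at_bot. h s = k)"

text \<open>
  On tame functions this is the Euler integral over the line: an open interval contributes its value
  at its left end with sign \<open>-1\<close> (at \<open>-\<infinity>\<close> if it is unbounded below). In this form linearity is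
  immediate, no partition into intervals being involved.
\<close>

definition line_integral :: "(real \<Rightarrow> int) \<Rightarrow> int" where
  "line_integral h = (\<Sum>a\<in>{a. h a \<noteq> right_val h a}. h a - right_val h a) - bot_val h"

section \<open>One-sided limits and linearity on the line\<close>

lemma eventually_eq_unique:
  assumes "F \<noteq> bot" "\<forall>\<^sub>F s in F. h s = k" "\<forall>\<^sub>F s in F. h s = l"
  shows "k = l"
proof -
  have "\<exists>s. h s = k \<and> h s = l"
    using eventually_happens'[OF assms(1) eventually_conj[OF assms(2,3)]] .
  then show ?thesis by blast
qed

lemma right_val_eq: "\<forall>\<^sub>F s in at_right a. h s = k \<Longrightarrow> right_val h a = k"
  unfolding right_val_def
  by (rule the_equality, assumption) (rule eventually_eq_unique[OF trivial_limit_at_right_real])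

lemma bot_val_eq: "\<forall>\<^sub>F s in at_bot. h s = k \<Longrightarrow> bot_val h = k"
  unfolding bot_val_def
  by (rule the_equality, assumption) (rule eventually_eq_unique[OF trivial_limit_at_bot_linorder])

lemma tame_const_on:
  assumes "tame h" "connected S" "\<And>k. S \<inter> frontier {t. h t = k} = {}" "s \<in> S" "t \<in> S"
  shows "h s = h t"
proof -
  have "S \<inter> {r. h r = h s} \<noteq> {}" using assms(4) by blast
  then have "S - {r. h r = h s} = {}"
    using connected_Int_frontier[OF assms(2), of "{r. h r = h s}"] assms(3)[of "h s"] by blast
  then show ?thesis using assms(5) by auto
qed

lemma tame_finite_frontiers:
  assumes "tame h" shows "finite (\<Union>k. frontier {t. h t = k})"
proof -
  have "(\<Union>k. frontier {t. h t = k}) = (\<Union>k\<in>range h. frontier {t. h t = k})"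
  proof -
    have "frontier {t. h t = k} = {}" if "k \<notin> range h" for k
    proof -
      have "{t. h t = k} = {}" using that by auto
      then show ?thesis by simp
    qed
    then show ?thesis by blast
  qed
  moreover have "finite (\<Union>k\<in>range h. frontier {t. h t = k})"
    using assms unfolding tame_def by blast
  ultimately show ?thesis by metis
qed

lemma tame_right_val:
  assumes "tame h" shows "\<forall>\<^sub>F s in at_right a. h s = right_val h a"
proof -
  let ?D = "\<Union>k. frontier {t. h t = k}"
  obtain b where b: "a < b" "{a<..<b} \<inter> ?D = {}"
  proof (cases "{d \<in> ?D. a < d} = {}")
    case True
    then show thesis by (intro that[of "a + 1"]) auto
  next
    case False
    have fin: "finite {d \<in> ?D. a < d}"
      by (rule finite_subset[OF _ tame_finite_frontiers[OF assms]]) blast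
    then have "Min {d \<in> ?D. a < d} \<in> {d \<in> ?D. a < d}" using False by (rule Min_in)
    moreover have "Min {d \<in> ?D. a < d} \<le> d" if "d \<in> ?D" "a < d" for d
      using fin that by (intro Min_le) auto
    ultimately show thesis by (intro that[of "Min {d \<in> ?D. a < d}"]) fastforce+
  qed
  have mid: "(a + b) / 2 \<in> {a<..<b}" using b(1) by auto
  have const: "h s = h ((a + b) / 2)" if "s \<in> {a<..<b}" for s
    by (rule tame_const_on[OF assms connected_Ioo _ that mid]) (use b(2) in blast)
  have ev: "\<forall>\<^sub>F s in at_right a. h s = h ((a + b) / 2)"
    unfolding eventually_at_right[OF b(1)]
    by (rule exI[of _ b], intro conjI b(1) allI impI const) simp
  show ?thesis unfolding right_val_eq[OF ev] by (rule ev)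
qed

lemma tame_bot_val:
  assumes "tame h" shows "\<forall>\<^sub>F s in at_bot. h s = bot_val h"
proof -
  let ?D = "\<Union>k. frontier {t. h t = k}"
  obtain b where b: "\<And>d. d \<in> ?D \<Longrightarrow> b < d"
  proof
    fix d assume "d \<in> ?D"
    then have "Min (insert 0 ?D) \<le> d" by (intro Min_le) (use tame_finite_frontiers[OF assms] in auto)
    then show "Min (insert 0 ?D) - 1 < d" by linarith
  qed
  have const: "h s = h b" if "s \<le> b" for s
    by (rule tame_const_on[OF assms connected_Iic[of b]]) (use b that in fastforce)+
  have ev: "\<forall>\<^sub>F s in at_bot. h s = h b"
    unfolding eventually_at_bot_linorder by (rule exI[of _ b]) (intro allI impI const)
  show ?thesis unfolding bot_val_eq[OF ev] by (rule ev)
qed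

lemma tame_jumps_subset:
  assumes "tame h" shows "{a. h a \<noteq> right_val h a} \<subseteq> (\<Union>k. frontier {t. h t = k})"
proof
  fix a assume "a \<in> {a. h a \<noteq> right_val h a}"
  then have ne: "h a \<noteq> right_val h a" by simp
  have "a \<in> frontier {t. h t = h a}"
    unfolding frontier_straddle
  proof (intro allI impI conjI)
    fix e :: real assume e: "e > 0"
    show "\<exists>x\<in>{t. h t = h a}. dist a x < e" by (intro bexI[of _ a]) (use e in auto)
    have "\<forall>\<^sub>F s in at_right a. s \<in> {a<..<a + e}"
      unfolding eventually_at_right_field using e by (intro exI[of _ "a + e"]) auto
    then have "\<forall>\<^sub>F s in at_right a. s \<in> {a<..<a + e} \<and> h s = right_val h a"
      using tame_right_val[OF assms] by (rule eventually_conj)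
    then obtain s where "s \<in> {a<..<a + e}" "h s = right_val h a"
      using eventually_happens'[OF trivial_limit_at_right_real] by blast
    then show "\<exists>x. x \<notin> {t. h t = h a} \<and> dist a x < e"
      using ne by (intro exI[of _ s]) (auto simp: dist_real_def)
  qed
  then show "a \<in> (\<Union>k. frontier {t. h t = k})" by blast
qed

lemma tame_finite_jumps: "tame h \<Longrightarrow> finite {a. h a \<noteq> right_val h a}"
  using tame_jumps_subset tame_finite_frontiers finite_subset by metis

text \<open>Two functions have different jump sets; for linearity both sums are taken over the
  union.\<close>

lemma line_integral_superset:
  assumes "finite A" "{a. h a \<noteq> right_val h a} \<subseteq> A"
  shows "line_integral h = (\<Sum>a\<in>A. h a - right_val h a) - bot_val h"
proof -
  have "(\<Sum>a\<in>{a. h a \<noteq> right_val h a}. h a - right_val h a) = (\<Sum>a\<in>A. h a - right_val h a)"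
    by (rule sum.mono_neutral_left) (use assms in auto)
  then show ?thesis by (simp add: line_integral_def)
qed

lemma line_integral_add:
  assumes "tame g" "tame h"
  shows "line_integral (\<lambda>t. g t + h t) = line_integral g + line_integral h"
proof -
  have r: "right_val (\<lambda>t. g t + h t) a = right_val g a + right_val h a" for a
    by (rule right_val_eq, use tame_right_val[OF assms(1), of a] tame_right_val[OF assms(2), of a] in eventually_elim)
      simp
  have b: "bot_val (\<lambda>t. g t + h t) = bot_val g + bot_val h"
    by (rule bot_val_eq, use tame_bot_val[OF assms(1)] tame_bot_val[OF assms(2)] in eventually_elim) simp
  let ?A = "{a. g a \<noteq> right_val g a} \<union> {a. h a \<noteq> right_val h a}"
  have fin: "finite ?A" using assms tame_finite_jumps by simp
  have "line_integral (\<lambda>t. g t + h t) = (\<Sum>a\<in>?A. g a + h a - (right_val g a + right_val h a)) - (bot_val g + bot_val h)"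
  proof -
    have "{a. g a + h a \<noteq> right_val (\<lambda>t. g t + h t) a} \<subseteq> ?A" unfolding r by auto
    from line_integral_superset[OF fin this] show ?thesis unfolding r b .
  qed
  also have "\<dots> = (\<Sum>a\<in>?A. g a - right_val g a) + (\<Sum>a\<in>?A. h a - right_val h a) - (bot_val g + bot_val h)"
    by (simp add: sum.distrib[symmetric] algebra_simps)
  also have "\<dots> = line_integral g + line_integral h"
    using line_integral_superset[OF fin, of g] line_integral_superset[OF fin, of h] by auto
  finally show ?thesis .
qed

lemma line_integral_cmult:
  assumes "tame h" shows "line_integral (\<lambda>t. c * h t) = c * line_integral h"
proof -
  have r: "right_val (\<lambda>t. c * h t) a = c * right_val h a" for a
    by (rule right_val_eq, use tame_right_val[OF assms, of a] in eventually_elim) simp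
  have b: "bot_val (\<lambda>t. c * h t) = c * bot_val h"
    by (rule bot_val_eq, use tame_bot_val[OF assms] in eventually_elim) simp
  have "line_integral (\<lambda>t. c * h t) = (\<Sum>a\<in>{a. h a \<noteq> right_val h a}. c * h a - c * right_val h a) - c * bot_val h"
    using line_integral_superset[of "{a. h a \<noteq> right_val h a}" "\<lambda>t. c * h t"] tame_finite_jumps[OF assms] r b
    by auto
  also have "\<dots> = c * line_integral h"
    by (simp add: line_integral_def right_diff_distrib sum_distrib_left)
  finally show ?thesis .
qed

lemma line_integral_const: "line_integral (\<lambda>t. c) = - c"
proof -
  have "right_val (\<lambda>t. c) a = c" "bot_val (\<lambda>t. c) = c" for a
    by (auto intro: right_val_eq bot_val_eq)
  then show ?thesis by (simp add: line_integral_def)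
qed

lemma line_integral_point: "line_integral (\<lambda>t. of_bool (t = p)) = 1"
proof -
  have r: "right_val (\<lambda>t. of_bool (t = p)) a = 0" for a
  proof (rule right_val_eq)
    show "\<forall>\<^sub>F s in at_right a. (of_bool (s = p) :: int) = 0"
    proof (cases "p \<le> a")
      case True
      then show ?thesis unfolding eventually_at_right_field by (intro exI[of _ "a + 1"]) auto
    next
      case False
      then show ?thesis unfolding eventually_at_right_field by (intro exI[of _ p]) auto
    qed
  qed
  have b: "bot_val (\<lambda>t. of_bool (t = p)) = 0"
    by (rule bot_val_eq) (auto simp: eventually_at_bot_dense intro!: exI[of _ p])
  have jumps: "{a. (of_bool (a = p) :: int) \<noteq> right_val (\<lambda>t. of_bool (t = p)) a} = {p}"
    unfolding r by auto
  show ?thesis unfolding line_integral_def jumps r b by simp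
qed

text \<open>If the interval is bounded below, its infimum is the only jump, from 0 to 1, and
  contributes -1. Otherwise the value 1 at minus infinity is subtracted. The right end never counts:
  it lies outside the interval and is followed by zeros.\<close>

lemma line_integral_open_interval:
  assumes "open I" "is_interval I" "I \<noteq> {}"
  shows "line_integral (\<lambda>t. of_bool (t \<in> I)) = - 1"
proof -
  let ?h = "\<lambda>t. of_bool (t \<in> I) :: int"
  obtain p where p: "p \<in> I" using assms(3) by blast
  have between: "t \<in> I" if "a \<in> I" "b \<in> I" "a \<le> t" "t \<le> b" for a b t
    using assms(2) that unfolding is_interval_1 by blast
  have r1: "right_val ?h a = 1" if a: "a \<in> I" for a
  proof (rule right_val_eq)
    obtain e where e: "e > 0" "ball a e \<subseteq> I" using assms(1) a open_contains_ball by blast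
    show "\<forall>\<^sub>F s in at_right a. ?h s = 1"
      unfolding eventually_at_right_field
      by (rule exI[of _ "a + e"]) (use e in \<open>auto simp: subset_iff dist_real_def\<close>)
  qed
  have r0: "right_val ?h a = 0" if a: "a \<notin> I" "p < a" for a
  proof (rule right_val_eq)
    have "s \<notin> I" if "a < s" for s using between[OF p, of s a] a that by auto
    then show "\<forall>\<^sub>F s in at_right a. ?h s = 0"
      unfolding eventually_at_right_field by (intro exI[of _ "a + 1"]) auto
  qed
  show ?thesis
  proof (cases "bdd_below I")
    case False
    have all: "t \<in> I" if "t \<le> p" for t
    proof -
      obtain a where "a \<in> I" "a < t" using False unfolding bdd_below_def by (meson not_le)
      then show ?thesis using between p that by (meson less_imp_le)
    qed
    have b: "bot_val ?h = 1"
      by (rule bot_val_eq) (use all in \<open>auto simp: eventually_at_bot_linorder\<close>)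
    have "?h a = right_val ?h a" for a
      using r1[of a] r0[of a] all[of a] by (cases "a \<in> I"; cases "a \<le> p") auto
    then have jumps: "{a. ?h a \<noteq> right_val ?h a} = {}" by blast
    show ?thesis unfolding line_integral_def jumps b by simp
  next
    case True
    define c where "c = Inf I"
    have c_le: "c \<le> t" if "t \<in> I" for t unfolding c_def using cInf_lower[OF that True] .
    have cI: "c \<notin> I"
    proof
      assume "c \<in> I"
      then obtain e where e: "e > 0" "ball c e \<subseteq> I" using assms(1) open_contains_ball by blast
      then have "c - e / 2 \<in> I" by (auto simp: subset_iff dist_real_def)
      then show False using c_le e(1) by fastforce
    qed
    have cp: "c < p" using c_le[OF p] cI p by (cases "c = p") auto
    have inI: "t \<in> I" if t: "c < t" "t \<le> p" for t
    proof -
      obtain a where "a \<in> I" "a < t" using t(1) unfolding c_def using cInf_less_iff[OF assms(3) True] by blast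
      then show ?thesis using between p t(2) by (meson less_imp_le)
    qed
    have rc: "right_val ?h c = 1"
      by (rule right_val_eq) (use inI cp in \<open>auto simp: eventually_at_right_field intro!: exI[of _ p]\<close>)
    have rlow: "right_val ?h a = 0" if a: "a < c" for a
      by (rule right_val_eq)
        (use c_le a in \<open>force simp: eventually_at_right_field intro!: exI[of _ c]\<close>)
    have b: "bot_val ?h = 0"
      by (rule bot_val_eq) (use c_le in \<open>force simp: eventually_at_bot_dense intro!: exI[of _ c]\<close>)
    have "?h a = right_val ?h a" if "a \<noteq> c" for a
    proof (cases "a \<in> I")
      case True
      then show ?thesis using r1 by simp
    next
      case aI: False
      then consider "a < c" | "p < a" using \<open>a \<noteq> c\<close> inI[of a] by linarith
      then show ?thesis using aI r0 rlow by cases auto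
    qed
    moreover have "?h c \<noteq> right_val ?h c" using rc cI by simp
    ultimately have jumps: "{a. ?h a \<noteq> right_val ?h a} = {c}" by blast
    show ?thesis unfolding line_integral_def jumps b using rc cI by simp
  qed
qed

text \<open>The head coordinate is integrated outermost, to fit prepending by
  \<open>##\<close>.\<close>

primrec eucl_integral :: "nat \<Rightarrow> ((nat \<Rightarrow> real) \<Rightarrow> int) \<Rightarrow> int" where
  "eucl_integral 0 g = g (\<lambda>i. 0)"
| "eucl_integral (Suc m) g = line_integral (\<lambda>a. eucl_integral m (\<lambda>x. g (a ## x)))"

lemma eucl_integral_cong: "(\<And>x. x \<in> eucl m \<Longrightarrow> g x = h x) \<Longrightarrow> eucl_integral m g = eucl_integral m h"
proof (induction m arbitrary: g h)
  case (Suc m)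
  have "eucl_integral m (\<lambda>x. g (a ## x)) = eucl_integral m (\<lambda>x. h (a ## x))" for a
    by (rule Suc.IH) (rule Suc.prems, simp)
  then show ?case by simp
qed (simp add: eucl_0)

context o_minimal_field_expansion
begin

section \<open>Integrals depending on parameters\<close>

lemma def_fun_real_comp:
  assumes "def_fun (\<lambda>e. g (e 0))" "def_fun u" shows "def_fun (\<lambda>e. g (u e))"
  using def_fun_comp[OF assms(1), of "\<lambda>i. u"] assms(2) by simp

text \<open>A formula reads finitely many entries, so environments may be truncated to points of
  some \<open>eucl n\<close>.\<close>

lemma uniform_finiteness_env:
  assumes D: "def_pred (\<lambda>e. e 0 \<in> D (\<lambda>i. e (Suc i)))" and fin: "\<And>e. finite (D e)"
  shows "\<exists>N. \<forall>e. card (D e) \<le> N"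
proof -
  obtain n where "def_pred_at n (\<lambda>e. e 0 \<in> D (\<lambda>i. e (Suc i)))" using D def_pred_def by blast
  then have n: "def_pred_at (Suc n) (\<lambda>e. e 0 \<in> D (\<lambda>i. e (Suc i)))" by (rule def_pred_at_mono) simp
  have eq: "D (trunc n e) = D e" for e
  proof (rule Set.set_eqI)
    fix t
    have "(t ## trunc n e) 0 \<in> D (\<lambda>i. (t ## trunc n e) (Suc i)) \<longleftrightarrow> (t ## e) 0 \<in> D (\<lambda>i. (t ## e) (Suc i))"
      by (rule def_pred_at_cong[OF n]) (auto simp: trunc_def split: nat.split)
    then show "t \<in> D (trunc n e) \<longleftrightarrow> t \<in> D e" by simp
  qed
  then have "def_pred (\<lambda>e. e 0 \<in> D (trunc n (\<lambda>i. e (Suc i))))" using D by simp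
  then obtain N where "\<forall>x\<in>eucl n. card (D x) \<le> N"
    using uniform_finiteness[of n] fin unfolding uniformly_finite_def by blast
  then have "card (D e) \<le> N" for e using eq[of e] trunc_in_eucl[of n e] by metis
  then show ?thesis by blast
qed

lemma def_int_fiber:
  assumes "def_int (\<lambda>e. G (\<lambda>i. e (Suc i)) (e 0))"
  shows "def_int (\<lambda>e'. G e (e' 0))"
proof -
  have "def_fun (case i of 0 \<Rightarrow> (\<lambda>e'. e' 0) | Suc j \<Rightarrow> (\<lambda>e'. e j))" for i
    by (cases i) (auto intro: dintros)
  from def_int_comp[where T = "\<lambda>i. case i of 0 \<Rightarrow> (\<lambda>e'. e' 0) | Suc j \<Rightarrow> (\<lambda>e'. e j)", OF assms this]
  show ?thesis by simp
qed

lemma def_int_tame: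
  assumes "def_int (\<lambda>e. h (e 0))" shows "tame h"
  unfolding tame_def
proof (intro conjI allI)
  have "range h = range (\<lambda>e::nat \<Rightarrow> real. h (e 0))" by (auto intro: image_eqI[of _ _ "\<lambda>i. _"])
  then show "finite (range h)" using assms by (simp add: def_int_def)
  show "finite (frontier {t. h t = k})" for k
    using assms by (intro finite_frontier_def) (simp add: def_int_def)
qed

text \<open>Integration has to preserve definability in the parameters, or the outer integrals would
  not be over tame functions. The number of jumps from a value \<open>v\<close> to a value
  \<open>w\<close> is bounded uniformly in the parameters, so it has finitely many definable levels;
  the integral is a fixed finite combination of these numbers, minus the value at minus
  infinity.\<close>

lemma def_int_line_integral [dintros]:
  assumes G: "def_int (\<lambda>e. G (\<lambda>i. e (Suc i)) (e 0))"
  shows "def_int (\<lambda>e. line_integral (\<lambda>a. G e a))"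
proof -
  define V where "V = range (\<lambda>e::nat \<Rightarrow> real. G (\<lambda>i. e (Suc i)) (e 0))"
  have finV: "finite V" using G by (simp add: V_def def_int_def)
  have inV: "G e a \<in> V" for e a
    unfolding V_def by (rule image_eqI[of _ _ "a ## e"]) auto
  have tame: "tame (G e)" for e using def_int_tame def_int_fiber[OF G] by blast
  have Gk: "def_pred (\<lambda>e. G (\<lambda>i. e (\<sigma> i)) (e j) = k)" for k \<sigma> j
    using def_pred_subst[of "\<lambda>e. G (\<lambda>i. e (Suc i)) (e 0) = k" "case_nat j \<sigma>"] G
    by (simp add: def_int_def)
  \<comment> \<open>One-sided limits of step functions are formulas: the value is constant on some
    interval to the right.\<close>
  have rv: "right_val (G e) a = k \<longleftrightarrow> (\<exists>b. a < b \<and> (\<forall>s. a < s \<and> s < b \<longrightarrow> G e s = k))" for e a k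
    using tame_right_val[OF tame, of e a] right_val_eq[of "G e" k a]
    unfolding eventually_at_right_field by (metis (mono_tags, lifting))
  have bv: "bot_val (G e) = k \<longleftrightarrow> (\<exists>b. \<forall>s. s \<le> b \<longrightarrow> G e s = k)" for e k
    using tame_bot_val[OF tame, of e] bot_val_eq[of "G e" k]
    unfolding eventually_at_bot_linorder by metis
  have rV: "right_val (G e) a \<in> V" for e a
    using rv[of e a "right_val (G e) a"] inV dense by metis
  have bV: "bot_val (G e) \<in> V" for e
    using bv[of e "bot_val (G e)"] inV by (metis order_refl)
  have bot: "def_int (\<lambda>e. bot_val (G e))"
    unfolding def_int_def
  proof safe
    show "finite (range (\<lambda>e. bot_val (G e)))" using bV finV finite_subset by (metis image_subsetI)
    show "def_pred (\<lambda>e. bot_val (G e) = k)" for k unfolding bv by (intro dintros Gk)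
  qed
  define D where "D v w e = {a. G e a = v \<and> right_val (G e) a = w}" for v w e
  have D: "def_int (\<lambda>e. int (card (D v w e)))" if vw: "v \<noteq> w" for v w
  proof -
    have fin: "finite (D v w e)" for e
      using tame_finite_jumps[OF tame, of e] vw by (auto simp: D_def elim: finite_subset[rotated])
    have def: "def_pred (\<lambda>e. e 0 \<in> D v w (\<lambda>i. e (Suc i)))"
      unfolding D_def mem_Collect_eq rv by (intro dintros Gk)
    obtain N where "\<forall>e. card (D v w e) \<le> N" using uniform_finiteness_env[of "D v w", OF def fin] by blast
    then show ?thesis using def_int_card[of "D v w", OF def fin] by blast
  qed
  have "line_integral (G e) = (\<Sum>(v, w)\<in>{(v, w) \<in> V \<times> V. v \<noteq> w}. (v - w) * int (card (D v w e))) - bot_val (G e)" for e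
  proof -
    let ?J = "{a. G e a \<noteq> right_val (G e) a}"
    let ?f = "\<lambda>a. (G e a, right_val (G e) a)"
    have fin: "finite {(v, w) \<in> V \<times> V. v \<noteq> w}" by (rule finite_subset[of _ "V \<times> V"]) (use finV in auto)
    have "(\<Sum>a\<in>?J. G e a - right_val (G e) a) =
        (\<Sum>y\<in>{(v, w) \<in> V \<times> V. v \<noteq> w}. \<Sum>a\<in>{a \<in> ?J. ?f a = y}. G e a - right_val (G e) a)"
      by (rule sum.group[symmetric]) (use tame_finite_jumps[OF tame] fin inV rV in auto)
    also have "\<dots> = (\<Sum>(v, w)\<in>{(v, w) \<in> V \<times> V. v \<noteq> w}. (v - w) * int (card (D v w e)))"
    proof (rule sum.cong[OF refl])
      fix y assume "y \<in> {(v, w) \<in> V \<times> V. v \<noteq> w}"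
      then obtain v w where y: "y = (v, w)" "v \<noteq> w" by auto
      have "{a \<in> ?J. ?f a = y} = D v w e" using y by (auto simp: D_def)
      moreover have "(\<Sum>a\<in>D v w e. G e a - right_val (G e) a) = (\<Sum>a\<in>D v w e. v - w)"
        by (rule sum.cong) (auto simp: D_def)
      ultimately show "(\<Sum>a\<in>{a \<in> ?J. ?f a = y}. G e a - right_val (G e) a) = (case y of (v, w) \<Rightarrow> (v - w) * int (card (D v w e)))"
        using y by simp
    qed
    finally show ?thesis by (simp add: line_integral_def)
  qed
  then show ?thesis
    by (simp only: case_prod_unfold) (intro def_int_diff def_int_sum def_int_mult def_int_const bot D, auto)
qed

text \<open>The head coordinate is rotated from index \<open>m\<close> to the front, as for vector
  quantifiers.\<close>

lemma def_int_eucl_integral [dintros]: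
  "def_int (\<lambda>e. G (\<lambda>i. e (i + m)) (trunc m e)) \<Longrightarrow> def_int (\<lambda>e. eucl_integral m (\<lambda>x. G e x))"
proof (induction m arbitrary: G)
  case 0
  then show ?case by (simp add: trunc_def)
next
  case (Suc m)
  let ?\<sigma> = "\<lambda>i. if i = 0 then m else if i \<le> m then i - 1 else i"
  have eq: "(\<lambda>i. e (Suc (i + m))) = (\<lambda>i. e (?\<sigma> (i + Suc m)))"
    "e m ## trunc m e = trunc (Suc m) (\<lambda>i. e (?\<sigma> i))" for e
    by (auto simp: fun_eq_iff trunc_def split: nat.split)
  have "def_int (\<lambda>e. G (\<lambda>i. e (Suc (i + m))) (e m ## trunc m e))"
    unfolding eq using def_int_subst[OF Suc.prems, of ?\<sigma>] .
  then have "def_int (\<lambda>e. eucl_integral m (\<lambda>x. G (\<lambda>i. e (Suc i)) (e 0 ## x)))"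
    using Suc.IH[of "\<lambda>e x. G (\<lambda>i. e (Suc i)) (e 0 ## x)"] by simp
  then show ?case
    using def_int_line_integral[of "\<lambda>e a. eucl_integral m (\<lambda>x. G e (a ## x))"] by simp
qed

lemma def_int_slice:
  assumes "def_int (\<lambda>e. g (trunc (Suc m) e))"
  shows "def_int (\<lambda>e. g (u ## trunc m e))" "def_int (\<lambda>e. g (e k ## trunc m (\<lambda>i. e (\<sigma> i))))"
proof -
  have 1: "trunc (Suc m) (a ## e) = a ## trunc m e" for a e
    by (auto simp: trunc_def fun_eq_iff split: nat.split)
  have "def_int (\<lambda>e. g (trunc (Suc m) (\<lambda>i. (u ## e) i)))"
    by (rule def_int_comp[OF assms, of "\<lambda>i e. (u ## e) i"]) (intro dintros)
  then show "def_int (\<lambda>e. g (u ## trunc m e))" by (simp add: 1)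
  have "def_int (\<lambda>e. g (trunc (Suc m) (\<lambda>i. (e k ## (\<lambda>i. e (\<sigma> i))) i)))"
    by (rule def_int_comp[OF assms, of "\<lambda>i e. (e k ## (\<lambda>i. e (\<sigma> i))) i"]) (intro dintros)
  then show "def_int (\<lambda>e. g (e k ## trunc m (\<lambda>i. e (\<sigma> i))))" by (simp add: 1)
qed

lemma tame_eucl_integral_slice:
  assumes "def_int (\<lambda>e. g (trunc (Suc m) e))"
  shows "tame (\<lambda>a. eucl_integral m (\<lambda>x. g (a ## x)))"
proof (rule def_int_tame)
  have "def_int (\<lambda>e. g (e m ## trunc m (\<lambda>i. e i)))" by (rule def_int_slice(2)[OF assms])
  then show "def_int (\<lambda>e. eucl_integral m (\<lambda>x. g (e 0 ## x)))"
    using def_int_eucl_integral[of "\<lambda>e x. g (e 0 ## x)" m] by simp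
qed

lemma eucl_integral_add:
  "def_int (\<lambda>e. g (trunc m e)) \<Longrightarrow> def_int (\<lambda>e. h (trunc m e)) \<Longrightarrow>
    eucl_integral m (\<lambda>x. g x + h x) = eucl_integral m g + eucl_integral m h"
proof (induction m arbitrary: g h)
  case (Suc m)
  have "eucl_integral m (\<lambda>x. g (a ## x) + h (a ## x)) =
      eucl_integral m (\<lambda>x. g (a ## x)) + eucl_integral m (\<lambda>x. h (a ## x))" for a
    by (rule Suc.IH) (rule def_int_slice(1)[OF Suc.prems(1)] def_int_slice(1)[OF Suc.prems(2)])+
  then show ?case
    using line_integral_add[OF tame_eucl_integral_slice[OF Suc.prems(1)] tame_eucl_integral_slice[OF Suc.prems(2)]]
    by simp
qed simp

lemma eucl_integral_cmult:
  "def_int (\<lambda>e. g (trunc m e)) \<Longrightarrow> eucl_integral m (\<lambda>x. c * g x) = c * eucl_integral m g"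
proof (induction m arbitrary: g)
  case (Suc m)
  have "eucl_integral m (\<lambda>x. c * g (a ## x)) = c * eucl_integral m (\<lambda>x. g (a ## x))" for a
    by (rule Suc.IH) (rule def_int_slice(1)[OF Suc.prems])
  then show ?case
    using line_integral_cmult[OF tame_eucl_integral_slice[OF Suc.prems]] by simp
qed simp

lemma eucl_integral_zero: "eucl_integral m (\<lambda>x. 0) = 0"
  by (induction m) (auto simp: line_integral_const)

lemma eucl_integral_sum:
  assumes "\<And>i. i \<in> I \<Longrightarrow> def_int (\<lambda>e. g i (trunc m e))"
  shows "eucl_integral m (\<lambda>x. \<Sum>i\<in>I. g i x) = (\<Sum>i\<in>I. eucl_integral m (g i))"
  using assms
proof (induction I rule: infinite_finite_induct)
  case (insert i I)
  have "eucl_integral m (\<lambda>x. g i x + (\<Sum>i\<in>I. g i x)) = eucl_integral m (g i) + eucl_integral m (\<lambda>x. \<Sum>i\<in>I. g i x)"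
    by (rule eucl_integral_add) (use insert in \<open>auto intro!: dintros\<close>)
  then show ?case using insert by simp
qed (simp_all add: eucl_integral_zero)

end

section \<open>Monotonicity and the Fubini theorem\<close>

definition loc_const :: "(real \<Rightarrow> real) \<Rightarrow> real \<Rightarrow> bool" where
  "loc_const g a \<longleftrightarrow> (\<exists>\<delta>. 0 < \<delta> \<and> (\<forall>s. \<bar>s - a\<bar> < \<delta> \<longrightarrow> g s = g a))"

definition loc_max :: "(real \<Rightarrow> real) \<Rightarrow> real \<Rightarrow> bool" where
  "loc_max g a \<longleftrightarrow> (\<exists>\<delta>. 0 < \<delta> \<and> (\<forall>s. \<bar>s - a\<bar> < \<delta> \<longrightarrow> g s \<le> g a))"

lemma loc_const_imp_loc_max: "loc_const g a \<Longrightarrow> loc_max g a"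
  unfolding loc_const_def loc_max_def by (blast intro: eq_refl)

text \<open>A point where the minimum over a compact subinterval is attained is a local maximum as
  well, so the function is constant next to it.\<close>

lemma loc_max_everywhere_imp_loc_const:
  assumes "p < q" "continuous_on {p<..<q} g" "\<And>a. p < a \<Longrightarrow> a < q \<Longrightarrow> loc_max g a"
  obtains a where "p < a" "a < q" "loc_const g a"
proof -
  define x where "x = p + (q - p) / 3"
  define y where "y = p + 2 * (q - p) / 3"
  have xy: "p < x" "x < y" "y < q" using assms(1) by (auto simp: x_def y_def field_simps)
  have "continuous_on {x..y} g" by (rule continuous_on_subset[OF assms(2)]) (use xy in auto)
  then obtain z where z: "z \<in> {x..y}" "\<forall>s\<in>{x..y}. g z \<le> g s"
    using continuous_attains_inf[of "{x..y}" g] xy by auto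
  obtain \<delta> where \<delta>: "0 < \<delta>" "\<forall>s. \<bar>s - z\<bar> < \<delta> \<longrightarrow> g s \<le> g z"
    using assms(3)[of z] z(1) xy unfolding loc_max_def by auto
  have eq: "g s = g z" if "x < s" "s < y" "\<bar>s - z\<bar> < \<delta>" for s
    by (rule antisym) (use \<delta>(2) z(2) that in auto)
  \<comment> \<open>\<open>z\<close> may be an endpoint of \<open>{x..y}\<close>; the point of local
    constancy is therefore taken in the middle of the part of (x, y) within \<open>\<delta>\<close>
    of \<open>z\<close>.\<close>
  define l where "l = max x (z - \<delta>)"
  define r where "r = min y (z + \<delta>)"
  have lr: "l < r" using z(1) xy \<delta>(1) by (auto simp: l_def r_def)
  define a where "a = (l + r) / 2"
  have a: "l < a" "a < r" using lr by (auto simp: a_def)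
  have mem: "x < s \<and> s < y \<and> \<bar>s - z\<bar> < \<delta>" if "l < s" "s < r" for s
    using that by (auto simp: l_def r_def)
  have "loc_const g a"
    unfolding loc_const_def
  proof (intro exI conjI allI impI)
    show "0 < min (a - l) (r - a)" using a by simp
    fix s assume "\<bar>s - a\<bar> < min (a - l) (r - a)"
    then have "l < s" "s < r" by auto
    then show "g s = g a" using eq[of s] eq[of a] mem[of s] mem[of a] a by simp
  qed
  moreover have "p < a" "a < q" using mem[OF a] xy by auto
  ultimately show thesis using that by blast
qed

text \<open>Maximum and minimum over \<open>{a..b}\<close> can only sit at the ends. Equal values
  there would make the function constant in between, and constancy produces local maxima.\<close>

lemma no_loc_max_imp_inj_on:
  assumes I: "is_interval I" "continuous_on I g"
    and no: "\<And>a. a \<in> I \<Longrightarrow> \<not> loc_max g a" "\<And>a. a \<in> I \<Longrightarrow> \<not> loc_max (\<lambda>s. - g s) a"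
  shows "inj_on g I"
proof (rule linorder_inj_onI')
  fix a b assume ab: "a \<in> I" "b \<in> I" "a < b"
  have sub: "{a..b} \<subseteq> I"
    using I(1)[unfolded is_interval_1, rule_format, of a b] ab(1,2) by auto
  have cont: "continuous_on {a..b} g" by (rule continuous_on_subset[OF I(2) sub])
  obtain M where M: "M \<in> {a..b}" "\<forall>s\<in>{a..b}. g s \<le> g M"
    using continuous_attains_sup[OF compact_Icc _ cont] ab by auto
  obtain m where m: "m \<in> {a..b}" "\<forall>s\<in>{a..b}. g m \<le> g s"
    using continuous_attains_inf[OF compact_Icc _ cont] ab by auto
  have interior: "\<exists>\<delta>>0. \<forall>s. \<bar>s - c\<bar> < \<delta> \<longrightarrow> s \<in> {a..b}" if "a < c" "c < b" for c
    by (rule exI[of _ "min (c - a) (b - c)"]) (use that in auto)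
  have M_end: "M = a \<or> M = b"
  proof (rule ccontr)
    assume "\<not> ?thesis"
    then have "a < M" "M < b" using M(1) by auto
    then have "loc_max g M" using interior[of M] M(2) unfolding loc_max_def by blast
    then show False using no(1) sub M(1) by blast
  qed
  have m_end: "m = a \<or> m = b"
  proof (rule ccontr)
    assume "\<not> ?thesis"
    then have "a < m" "m < b" using m(1) by auto
    then have "loc_max (\<lambda>s. - g s) m" using interior[of m] m(2) unfolding loc_max_def by (metis neg_le_iff_le)
    then show False using no(2) sub m(1) by blast
  qed
  show "g a \<noteq> g b"
  proof
    assume eq: "g a = g b"
    then have "g M = g a" "g m = g a" using M_end m_end by auto
    then have const: "g s = g a" if "s \<in> {a..b}" for s using M(2) m(2) that by (metis antisym)
    define c where "c = (a + b) / 2"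
    have c: "a < c" "c < b" using ab by (auto simp: c_def)
    obtain \<delta> where \<delta>: "\<delta> > 0" "\<forall>s. \<bar>s - c\<bar> < \<delta> \<longrightarrow> s \<in> {a..b}" using interior[OF c] by blast
    have "g s \<le> g c" if "\<bar>s - c\<bar> < \<delta>" for s
    proof -
      have "g s = g a" "g c = g a" using const[of s] const[of c] \<delta>(2) that c by auto
      then show ?thesis by simp
    qed
    then have "loc_max g c" using \<delta>(1) unfolding loc_max_def by blast
    moreover have "c \<in> I" using sub c by (simp add: subset_iff)
    ultimately show False using no(1) by blast
  qed
qed

lemma of_bool_Union:
  assumes "finite \<I>" "disjoint \<I>"
  shows "(of_bool (a \<in> \<Union>\<I> \<and> R) :: int) = (\<Sum>I\<in>\<I>. of_bool (a \<in> I \<and> R))"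
proof (cases "a \<in> \<Union>\<I> \<and> R")
  case True
  then obtain I where I: "I \<in> \<I>" "a \<in> I" by blast
  have "(of_bool (a \<in> J \<and> R) :: int) = 0" if "J \<in> \<I> - {I}" for J
  proof -
    have "J \<inter> I = {}" using that I(1) assms(2) by (auto simp: disjoint_def)
    then show ?thesis using I(2) by auto
  qed
  then have "(\<Sum>J\<in>\<I> - {I}. of_bool (a \<in> J \<and> R) :: int) = 0" by (intro sum.neutral) blast
  then show ?thesis using True I sum.remove[OF assms(1) I(1), of "\<lambda>J. of_bool (a \<in> J \<and> R) :: int"] by simp
next
  case False
  then have "(\<Sum>I\<in>\<I>. of_bool (a \<in> I \<and> R) :: int) = 0" by (intro sum.neutral) auto
  moreover have "(of_bool (a \<in> \<Union>\<I> \<and> R) :: int) = 0" using False by simp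
  ultimately show ?thesis by (simp only:)
qed

text \<open>Fubini for a single function on the plane, isolated as a property because it is linear
  and can be checked on generators.\<close>

definition swappable :: "(real \<Rightarrow> real \<Rightarrow> int) \<Rightarrow> bool" where
  "swappable G \<longleftrightarrow> line_integral (\<lambda>a. line_integral (\<lambda>b. G a b)) = line_integral (\<lambda>b. line_integral (\<lambda>a. G a b))"

lemma tame_indicator_interval:
  assumes "is_interval I" shows "tame (\<lambda>a. of_bool (a \<in> I))"
  unfolding tame_def
proof (intro conjI allI)
  have "range (\<lambda>a. of_bool (a \<in> I)) \<subseteq> {0, 1 :: int}" by auto
  then show "finite (range (\<lambda>a. of_bool (a \<in> I) :: int))" by (rule finite_subset) simp
  fix k :: int
  consider "k = 0" | "k = 1" | "k \<noteq> 0" "k \<noteq> 1" by blast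
  then show "finite (frontier {t. of_bool (t \<in> I) = k})"
  proof cases
    case 1
    then have "{t. of_bool (t \<in> I) = k} = - I" by auto
    then show ?thesis using finite_frontier_interval[OF assms] by (simp only: frontier_complement)
  next
    case 2
    then have "{t. of_bool (t \<in> I) = k} = I" by auto
    then show ?thesis using finite_frontier_interval[OF assms] by (simp only:)
  next
    case 3
    then have "{t. of_bool (t \<in> I) = k} = {}" by auto
    then show ?thesis by (simp only: frontier_empty finite.emptyI)
  qed
qed

text \<open>Both iterated integrals are \<open>(- 1) * (- 1)\<close>: open rays over the open
  interval \<open>I\<close>, and open sublevel sets over the open interval \<open>T\<close> of
  levels. Sublevel sets are intervals because a continuous injective function is monotone.\<close>

lemma swappable_upper_inj:
  assumes I: "open I" "is_interval I" "I \<noteq> {}" and g: "continuous_on I g" "inj_on g I"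
  shows "swappable (\<lambda>a b. of_bool (a \<in> I \<and> g a < b))"
proof -
  have "line_integral (\<lambda>b. of_bool (a \<in> I \<and> g a < b)) = (- 1) * of_bool (a \<in> I)" for a
  proof (cases "a \<in> I")
    case True
    have "line_integral (\<lambda>b. of_bool (b \<in> {g a<..})) = - 1"
      by (rule line_integral_open_interval) (auto simp: is_interval_1 intro: gt_ex)
    then show ?thesis using True by simp
  qed (use line_integral_const[of 0] in simp)
  moreover have "line_integral (\<lambda>a. (- 1) * of_bool (a \<in> I)) = 1"
  proof -
    have "tame (\<lambda>a. of_bool (a \<in> I))" by (rule tame_indicator_interval[OF I(2)])
    from line_integral_cmult[OF this, of "- 1"] show ?thesis
      using line_integral_open_interval[OF I] by simp
  qed
  ultimately have lhs: "line_integral (\<lambda>a. line_integral (\<lambda>b. of_bool (a \<in> I \<and> g a < b))) = 1"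
    by simp
  define T where "T = {t. \<exists>a\<in>I. g a < t}"
  have T: "T = (\<Union>a\<in>I. {g a<..})" by (auto simp: T_def)
  have T_open: "open T" unfolding T by auto
  have T_int: "is_interval T" unfolding is_interval_1 T_def using order_less_le_trans by blast
  have T_ne: "T \<noteq> {}" 
  proof -
    obtain a where "a \<in> I" using I(3) by blast
    then have "g a + 1 \<in> T" unfolding T_def by force
    then show ?thesis by blast
  qed
  have tame_T: "tame (\<lambda>a. of_bool (a \<in> T))" by (rule tame_indicator_interval[OF T_int])
  have "line_integral (\<lambda>a. of_bool (a \<in> I \<and> g a < t)) = (- 1) * of_bool (t \<in> T)" for t
  proof (cases "t \<in> T")
    case True
    let ?S = "{a \<in> I. g a < t}"
    have "open ?S"
      using continuous_open_preimage[OF g(1) I(1), of "{..<t}"] by (auto simp: vimage_def Int_def)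
    moreover have "is_interval ?S"
      unfolding is_interval_1
    proof (intro ballI allI impI)
      fix a b x assume ab: "a \<in> ?S" "b \<in> ?S" and x: "a \<le> x \<and> x \<le> b"
      have sub: "{a..b} \<subseteq> I"
        using I(2)[unfolded is_interval_1, rule_format, of a b] ab by auto
      have "g x < t"
      proof (cases "x = a \<or> x = b")
        case False
        then have "a < x" "x < b" using x by auto
        from continuous_inj_imp_mono[OF this continuous_on_subset[OF g(1) sub] inj_on_subset[OF g(2) sub]]
        show ?thesis using ab by auto
      qed (use ab in auto)
      then show "x \<in> ?S" using sub x by auto
    qed
    moreover have "?S \<noteq> {}" using True by (auto simp: T_def)
    ultimately have "line_integral (\<lambda>a. of_bool (a \<in> ?S)) = - 1" by (rule line_integral_open_interval)
    then show ?thesis using True by simp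
  next
    case False
    then have "(\<lambda>a. of_bool (a \<in> I \<and> g a < t) :: int) = (\<lambda>a. 0)"
      by (auto simp: T_def fun_eq_iff)
    then show ?thesis using False line_integral_const[of 0] by simp
  qed
  then have "line_integral (\<lambda>t. line_integral (\<lambda>a. of_bool (a \<in> I \<and> g a < t))) = 1"
    using line_integral_cmult[OF tame_T, of "- 1"] line_integral_open_interval[OF T_open T_int T_ne] by simp
  then show ?thesis using lhs by (simp add: swappable_def)
qed

text \<open>Both iterated integrals are -1: one point over each element of \<open>I\<close>, and one
  point over each element of the image, which is again an open interval.\<close>

lemma swappable_graph_inj:
  assumes I: "open I" "is_interval I" "I \<noteq> {}" and g: "continuous_on I g" "inj_on g I"
  shows "swappable (\<lambda>a b. of_bool (a \<in> I \<and> b = g a))"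
proof -
  have "line_integral (\<lambda>b. of_bool (a \<in> I \<and> b = g a)) = of_bool (a \<in> I)" for a
    using line_integral_point[of "g a"] line_integral_const[of 0] by (cases "a \<in> I") auto
  then have lhs: "line_integral (\<lambda>a. line_integral (\<lambda>b. of_bool (a \<in> I \<and> b = g a))) = - 1"
    using line_integral_open_interval[OF I] by simp
  have "line_integral (\<lambda>a. of_bool (a \<in> I \<and> b = g a)) = of_bool (b \<in> g ` I)" for b
  proof (cases "b \<in> g ` I")
    case True
    then obtain c where c: "c \<in> I" "b = g c" by blast
    then have "a \<in> I \<and> b = g a \<longleftrightarrow> a = c" for a using inj_onD[OF g(2)] by blast
    then show ?thesis using True line_integral_point[of c] by simp
  next
    case False
    then have "(\<lambda>a. of_bool (a \<in> I \<and> b = g a) :: int) = (\<lambda>a. 0)" by (auto simp: fun_eq_iff)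
    then show ?thesis using False line_integral_const[of 0] by simp
  qed
  moreover have "line_integral (\<lambda>b. of_bool (b \<in> g ` I)) = - 1"
  proof (rule line_integral_open_interval)
    show "open (g ` I)" by (rule invariance_of_domain[OF g(1) I(1) g(2)])
    show "is_interval (g ` I)"
      using connected_continuous_image[OF g(1)] I(2) by (simp add: is_interval_connected_1)
  qed (use I(3) in simp)
  ultimately show ?thesis using lhs by (simp add: swappable_def)
qed

context o_minimal_field_expansion
begin

text \<open>The case of \<open>fiber_decomposition\<close> without parameters: the environment is
  fixed at 0 and empty pieces are dropped.\<close>

lemma real_decomposition:
  assumes "def_pred (\<lambda>e. R (e 0))"
  shows "\<exists>\<I>. finite \<I> \<and> disjoint \<I> \<and> \<Union>\<I> = {t. R t} \<and>
    (\<forall>I\<in>\<I>. def_pred (\<lambda>e. e 0 \<in> I) \<and> ((\<exists>p. I = {p}) \<or> open I \<and> is_interval I \<and> I \<noteq> {}))"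
proof -
  obtain M :: nat and Q where Q:
    "\<forall>j<M. def_pred (\<lambda>e. Q j (\<lambda>i. e (Suc i)) (e 0))"
    "\<forall>e t. R t \<longleftrightarrow> (\<exists>j<M. Q j e t)" "\<forall>j k e t. Q j e t \<longrightarrow> Q k e t \<longrightarrow> j = k"
    "\<forall>j<M. (\<forall>e a b. Q j e a \<longrightarrow> Q j e b \<longrightarrow> a = b) \<or>
        (\<forall>e. open {t. Q j e t} \<and> is_interval {t. Q j e t})"
    by (rule fiber_decomposition[where P = "\<lambda>e. R", OF assms order_refl])
  define I where "I j = {t. Q j (\<lambda>i. 0) t}" for j
  show ?thesis
  proof (rule exI, intro conjI ballI)
    show "finite (I ` {..<M} - {{}})" by simp
    show "disjoint (I ` {..<M} - {{}})"
    proof (rule disjointI)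
      fix A B assume "A \<in> I ` {..<M} - {{}}" "B \<in> I ` {..<M} - {{}}" "A \<noteq> B"
      then obtain j k where jk: "A = I j" "B = I k" "j \<noteq> k" by auto
      show "A \<inter> B = {}" using Q(3) jk unfolding I_def by blast
    qed
    show "\<Union>(I ` {..<M} - {{}}) = {t. R t}"
    proof (rule Set.set_eqI)
      fix t
      show "t \<in> \<Union>(I ` {..<M} - {{}}) \<longleftrightarrow> t \<in> {t. R t}"
        using Q(2)[rule_format, of t "\<lambda>i. 0"] unfolding I_def by auto
    qed
    fix A assume "A \<in> I ` {..<M} - {{}}"
    then obtain j where j: "j < M" "A = I j" "A \<noteq> {}" by auto
    show "def_pred (\<lambda>e. e 0 \<in> A)"
      unfolding j(2) I_def mem_Collect_eq using def_pred_fiber[of "Q j"] Q(1) j(1) by blast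
    from Q(4)[rule_format, OF j(1)]
    show "(\<exists>p. A = {p}) \<or> open A \<and> is_interval A \<and> A \<noteq> {}"
    proof
      assume *: "\<forall>e a b. Q j e a \<longrightarrow> Q j e b \<longrightarrow> a = b"
      obtain p where p: "p \<in> A" using j(3) by blast
      have "q = p" if "q \<in> A" for q using * p that j(2) unfolding I_def by blast
      then show ?thesis using p by blast
    next
      assume "\<forall>e. open {t. Q j e t} \<and> is_interval {t. Q j e t}"
      then show ?thesis using j(2,3) unfolding I_def by blast
    qed
  qed
qed

text \<open>Finitely many pieces of continuity cover the interval, so one of them is infinite along
  it and, being definable, contains an interval.\<close>

lemma continuous_subinterval:
  assumes g: "def_fun (\<lambda>e. g (e 0))" and ab: "a < b"
  obtains c d where "a \<le> c" "c < d" "d \<le> b" "continuous_on {c<..<d} g"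
proof -
  define B where "B = {x \<in> eucl 1. a < x 0 \<and> x 0 < b}"
  have "def_set 1 B"
    unfolding B_def by (rule def_setI) (auto intro!: dintros simp: trunc_def)
  moreover have "def_fun (\<lambda>e. (\<lambda>x. g (x 0)) (trunc 1 e))"
    using g by (simp add: trunc_def)
  ultimately obtain \<Q> where \<Q>: "finite \<Q>" "\<Union>\<Q> = B"
    "\<forall>Q\<in>\<Q>. def_set 1 Q \<and> continuous_on Q (\<lambda>x. g (x 0))"
    using piecewise_continuity[of 1 B "\<lambda>x. g (x 0)"] unfolding piecewise_continuous_def by blast
  let ?v = "\<lambda>t::real. t ## (\<lambda>i. 0)"
  have v: "?v t \<in> eucl 1" for t by (auto simp: eucl_def split: nat.split)
  have "{a<..<b} \<subseteq> (\<Union>Q\<in>\<Q>. {t. ?v t \<in> Q})"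
  proof
    fix t assume "t \<in> {a<..<b}"
    then have "?v t \<in> B" using v by (simp add: B_def)
    then show "t \<in> (\<Union>Q\<in>\<Q>. {t. ?v t \<in> Q})" using \<Q>(2) by blast
  qed
  moreover have "infinite {a<..<b}" using ab by (simp add: infinite_Ioo)
  ultimately have "infinite (\<Union>Q\<in>\<Q>. {t. ?v t \<in> Q})" using finite_subset by blast
  then obtain Q where Q: "Q \<in> \<Q>" "infinite {t. ?v t \<in> Q}" using \<Q>(1) by blast
  have "def_pred (\<lambda>e. ?v (e 0) \<in> Q)"
    by (rule def_pred_mem[of 1]) (use Q(1) \<Q>(3) v in \<open>auto intro!: dintros\<close>)
  then obtain c d where cd: "c < d" "\<And>t. c < t \<Longrightarrow> t < d \<Longrightarrow> ?v t \<in> Q"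
    using infinite_def_contains_interval[of "\<lambda>t. ?v t \<in> Q"] Q(2) by auto
  have in_ab: "a < t \<and> t < b" if "c < t" "t < d" for t
  proof -
    have "?v t \<in> B" using cd(2)[OF that] Q(1) \<Q>(2) by blast
    then show ?thesis by (simp add: B_def)
  qed
  have "a \<le> c"
  proof (rule ccontr)
    assume "\<not> a \<le> c"
    then obtain t where "c < t" "t < min a d" using cd(1) dense[of c "min a d"] by auto
    then show False using in_ab[of t] by auto
  qed
  moreover have "d \<le> b"
  proof (rule ccontr)
    assume "\<not> d \<le> b"
    then obtain t where "max b c < t" "t < d" using cd(1) dense[of "max b c" d] by auto
    then show False using in_ab[of t] by auto
  qed
  moreover have "continuous_on {c<..<d} (\<lambda>t. g (?v t 0))"
  proof (rule continuous_on_compose2[of Q "\<lambda>x. g (x 0)" _ ?v])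
    show "continuous_on Q (\<lambda>x. g (x 0))" using Q(1) \<Q>(3) by blast
    show "continuous_on {c<..<d} ?v" by (intro continuous_on_vcons continuous_on_id continuous_on_const)
    show "?v ` {c<..<d} \<subseteq> Q" using cd(2) by auto
  qed
  ultimately show thesis using that cd(1) by simp
qed

section \<open>Piecewise monotonicity\<close>

lemma def_pred_loc_const:
  assumes "def_fun (\<lambda>e. g (e 0))" shows "def_pred (\<lambda>e. loc_const g (e 0))"
  unfolding loc_const_def by (intro dintros def_fun_real_comp[OF assms])

lemma def_pred_loc_max:
  assumes "def_fun (\<lambda>e. g (e 0))" shows "def_pred (\<lambda>e. loc_max g (e 0))"
  unfolding loc_max_def by (intro dintros def_fun_real_comp[OF assms])

lemma def_pred_isCont:
  assumes "def_fun (\<lambda>e. g (e 0))" shows "def_pred (\<lambda>e. isCont g (e 0))"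
  unfolding continuous_at_real_range real_norm_def
  by (intro dintros def_fun_real_comp[OF assms])

text \<open>Infinitely many local maxima fill an interval, and there a continuous function is
  constant somewhere.\<close>

lemma loc_max_interval_contradiction:
  assumes g: "def_fun (\<lambda>e. g (e 0))" and inf: "infinite {a. p < a \<and> a < q \<and> loc_max g a}"
    and cont: "continuous_on {p<..<q} g"
  shows "\<exists>a. p < a \<and> a < q \<and> loc_const g a"
proof -
  have "def_pred (\<lambda>e. p < e 0 \<and> e 0 < q \<and> loc_max g (e 0))"
    by (intro dintros def_pred_loc_max g)
  from infinite_def_contains_interval[OF this inf] obtain c d
    where cd: "c < d" "\<And>t. c < t \<Longrightarrow> t < d \<Longrightarrow> p < t \<and> t < q \<and> loc_max g t" by metis
  have "continuous_on {c<..<d} g" by (rule continuous_on_subset[OF cont]) (use cd(2) in auto)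
  from loc_max_everywhere_imp_loc_const[OF cd(1) this] cd(2) show ?thesis by metis
qed

text \<open>An infinite set of such points would contain an interval, and inside it one where
  \<open>g\<close> is continuous. Infinitely many local maxima of \<open>g\<close> or of its
  negative would then lie there and force local constancy, which the set excludes.\<close>

lemma finite_irregular_points:
  assumes g: "def_fun (\<lambda>e. g (e 0))"
  shows "finite {a. \<not> loc_const g a \<and> (\<not> isCont g a \<or> loc_max g a \<or> loc_max (\<lambda>s. - g s) a)}"
    (is "finite {a. ?Z a}")
proof (rule ccontr)
  assume inf: "infinite {a. ?Z a}"
  have g': "def_fun (\<lambda>e. - g (e 0))" using g by (rule def_fun_uminus)
  have "def_pred (\<lambda>e. ?Z (e 0))"
    by (intro dintros def_pred_loc_const def_pred_loc_max def_pred_isCont g g')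
  from infinite_def_contains_interval[OF this inf] obtain a b
    where ab: "a < b" "\<And>t. a < t \<Longrightarrow> t < b \<Longrightarrow> ?Z t" by blast
  obtain c d where cd: "a \<le> c" "c < d" "d \<le> b" "continuous_on {c<..<d} g"
    using continuous_subinterval[OF g ab(1)] by blast
  have Z: "?Z t" if "c < t" "t < d" for t using ab(2)[of t] cd that by linarith
  have isc: "isCont g t" if "c < t" "t < d" for t
    using cd(4) that continuous_on_eq_continuous_at[of "{c<..<d}" g] by auto
  have "{c<..<d} \<subseteq> {a. c < a \<and> a < d \<and> loc_max g a} \<union> {a. c < a \<and> a < d \<and> loc_max (\<lambda>s. - g s) a}"
  proof
    fix t assume "t \<in> {c<..<d}"
    then show "t \<in> {a. c < a \<and> a < d \<and> loc_max g a} \<union> {a. c < a \<and> a < d \<and> loc_max (\<lambda>s. - g s) a}"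
      using Z[of t] isc[of t] by simp
  qed
  moreover have "infinite {c<..<d}" using cd by (simp add: infinite_Ioo)
  ultimately have "infinite {a. c < a \<and> a < d \<and> loc_max g a} \<or> infinite {a. c < a \<and> a < d \<and> loc_max (\<lambda>s. - g s) a}"
    by (meson finite_UnI finite_subset)
  then obtain t where "c < t" "t < d" "loc_const g t \<or> loc_const (\<lambda>s. - g s) t"
    using loc_max_interval_contradiction[OF g _ cd(4)]
      loc_max_interval_contradiction[OF g' _ continuous_on_minus[OF cd(4)]] by blast
  moreover have "loc_const (\<lambda>s. - g s) t \<longleftrightarrow> loc_const g t" for t by (simp add: loc_const_def)
  ultimately show False using Z by blast
qed

text \<open>There are three classes of points: local constancy, continuity without local extrema,
  and finitely many exceptions. A nonempty open interval of the first class carries a constant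
  function, one of the second an injective function, and the third class contains none. Injectivity
  takes the place of monotonicity in what follows.\<close>

theorem monotonicity:
  assumes g: "def_fun (\<lambda>e. g (e 0))" and B: "def_pred (\<lambda>e. B (e 0))"
  shows "\<exists>\<I>. finite \<I> \<and> disjoint \<I> \<and> \<Union>\<I> = {a. B a} \<and>
    (\<forall>I\<in>\<I>. def_pred (\<lambda>e. e 0 \<in> I) \<and> ((\<exists>p. I = {p}) \<or> open I \<and> is_interval I \<and> I \<noteq> {} \<and>
      ((\<exists>c. \<forall>a\<in>I. g a = c) \<or> continuous_on I g \<and> inj_on g I)))"
proof -
  define X where "X k a \<longleftrightarrow> B a \<and> (if k = (0::nat) then loc_const g a
     else if k = 1 then isCont g a \<and> \<not> loc_max g a \<and> \<not> loc_max (\<lambda>s. - g s) a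
     else \<not> loc_const g a \<and> (\<not> isCont g a \<or> loc_max g a \<or> loc_max (\<lambda>s. - g s) a))" for k a
  have g': "def_fun (\<lambda>e. - g (e 0))" using g by (rule def_fun_uminus)
  have X: "def_pred (\<lambda>e. X k (e 0))" for k
    unfolding X_def
    by (cases "k = 0"; cases "k = 1"; simp;
        intro dintros B def_pred_loc_const[OF g] def_pred_loc_max[OF g] def_pred_loc_max[OF g']
          def_pred_isCont[OF g])
  have not_both: "\<not> (X 0 a \<and> X 1 a)" for a
    using loc_const_imp_loc_max by (auto simp: X_def)
  define D where "D k \<I> \<longleftrightarrow> finite \<I> \<and> disjoint \<I> \<and> \<Union>\<I> = {t. X k t} \<and>
    (\<forall>I\<in>\<I>. def_pred (\<lambda>e. e 0 \<in> I) \<and> ((\<exists>p. I = {p}) \<or> open I \<and> is_interval I \<and> I \<noteq> {}))" for k \<I>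
  have "\<exists>\<I>. D k \<I>" for k unfolding D_def by (rule real_decomposition[OF X])
  then obtain \<I> where D: "\<And>k. D k (\<I> k)" by metis
  note \<I>1 = D[unfolded D_def, THEN conjunct1] and \<I>2 = D[unfolded D_def, THEN conjunct2, THEN conjunct1]
    and \<I>3 = D[unfolded D_def, THEN conjunct2, THEN conjunct2, THEN conjunct1]
    and \<I>4 = D[unfolded D_def, THEN conjunct2, THEN conjunct2, THEN conjunct2, rule_format]
  note \<I> = \<I>1 \<I>2 \<I>3 \<I>4
  have disj: "{t. X k t} \<inter> {t. X l t} = {}" if "k \<in> {0, 1, 2}" "l \<in> {0, 1, 2}" "k \<noteq> l" for k l
    using that not_both by (auto simp: X_def)
  show ?thesis
  proof (rule exI, intro conjI ballI)
    show "finite (\<Union>k\<in>{0, 1, 2}. \<I> k)" using \<I>(1) by blast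
    show "disjoint (\<Union>k\<in>{0, 1, 2}. \<I> k)"
    proof (rule disjointI)
      fix A C assume "A \<in> (\<Union>k\<in>{0, 1, 2}. \<I> k)" "C \<in> (\<Union>k\<in>{0, 1, 2}. \<I> k)" "A \<noteq> C"
      then obtain k l where kl: "k \<in> {0, 1, 2}" "l \<in> {0, 1, 2}" "A \<in> \<I> k" "C \<in> \<I> l" by blast
      show "A \<inter> C = {}"
      proof (cases "k = l")
        case True
        then show ?thesis using \<I>(2)[of k] kl \<open>A \<noteq> C\<close> by (auto simp: disjoint_def)
      next
        case False
        have "A \<subseteq> {t. X k t}" "C \<subseteq> {t. X l t}" using \<I>(3) kl(3,4) by blast+
        then show ?thesis using disj[OF kl(1,2) False] by blast
      qed
    qed
    have "\<Union>(\<Union>k\<in>{0, 1, 2}. \<I> k) = {t. X 0 t} \<union> {t. X 1 t} \<union> {t. X 2 t}"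
      using \<I>(3) by (simp add: Union_Un_distrib Un_assoc)
    also have "\<dots> = {a. B a}" by (auto simp: X_def)
    finally show "\<Union>(\<Union>k\<in>{0, 1, 2}. \<I> k) = {a. B a}" .
    fix I assume "I \<in> (\<Union>k\<in>{0, 1, 2}. \<I> k)"
    then obtain k where k: "k \<in> {0, 1, 2}" "I \<in> \<I> k" by blast
    have IX: "I \<subseteq> {t. X k t}" using \<I>(3) k(2) by blast
    show "def_pred (\<lambda>e. e 0 \<in> I)" using \<I>(4)[OF k(2)] by blast
    from \<I>(4)[OF k(2)] have "(\<exists>p. I = {p}) \<or> open I \<and> is_interval I \<and> I \<noteq> {}" by blast
    then show "(\<exists>p. I = {p}) \<or> open I \<and> is_interval I \<and> I \<noteq> {} \<and>
      ((\<exists>c. \<forall>a\<in>I. g a = c) \<or> continuous_on I g \<and> inj_on g I)"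
    proof
      assume I: "open I \<and> is_interval I \<and> I \<noteq> {}"
      have "(\<exists>c. \<forall>a\<in>I. g a = c) \<or> continuous_on I g \<and> inj_on g I"
      proof -
        consider "k = 0" | "k = 1" | "k = 2" using k(1) by blast
        then show ?thesis
        proof cases
          case 1
          have "g constant_on I"
          proof (rule locally_constant_imp_constant)
            show "connected I" using I is_interval_connected_1 by blast
            fix a assume a: "a \<in> I"
            then have "X 0 a" using IX 1 by blast
            then obtain \<delta> where \<delta>: "0 < \<delta>" "\<forall>s. \<bar>s - a\<bar> < \<delta> \<longrightarrow> g s = g a"
              unfolding X_def loc_const_def by auto
            show "\<exists>T. openin (top_of_set I) T \<and> a \<in> T \<and> (\<forall>x\<in>T. g x = g a)"
            proof (intro exI conjI ballI)
              show "openin (top_of_set I) (I \<inter> ball a \<delta>)" by (rule openin_open_Int[OF open_ball])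
              show "a \<in> I \<inter> ball a \<delta>" using a \<delta>(1) by simp
              fix x assume "x \<in> I \<inter> ball a \<delta>"
              then have "\<bar>x - a\<bar> < \<delta>" by (simp add: dist_real_def abs_minus_commute)
              then show "g x = g a" using \<delta>(2) by blast
            qed
          qed
          then show ?thesis by (auto simp: constant_on_def)
        next
          case 2
          have X1: "isCont g a \<and> \<not> loc_max g a \<and> \<not> loc_max (\<lambda>s. - g s) a" if "a \<in> I" for a
            using IX 2 that by (auto simp: X_def)
          have "continuous_on I g" by (rule continuous_at_imp_continuous_on) (use X1 in blast)
          moreover from this have "inj_on g I"
            using no_loc_max_imp_inj_on[of I g] I X1 by blast
          ultimately show ?thesis by blast
        next
          case 3
          have "finite I"
            by (rule finite_subset[OF _ finite_irregular_points[OF g]]) (use IX 3 in \<open>auto simp: X_def\<close>)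
          then show ?thesis using I finite_imp_not_open by blast
        qed
      qed
      then show ?thesis using I by blast
    qed blast
  qed
qed

section \<open>Exchange of integrals in the plane\<close>

lemma def_int2_apply:
  assumes "def_int (\<lambda>e. G (e 0) (e 1))" "def_fun u" "def_fun v"
  shows "def_int (\<lambda>e. G (u e) (v e))"
  using def_int_comp[OF assms(1), of "\<lambda>i. if i = 0 then u else v"] assms(2,3) by simp

lemma tame_slices:
  assumes "def_int (\<lambda>e. G (e 0) (e 1))"
  shows "tame (\<lambda>b. G a b)" "tame (\<lambda>a. G a b)" "tame (\<lambda>a. line_integral (\<lambda>b. G a b))"
    "tame (\<lambda>b. line_integral (\<lambda>a. G a b))"
  by (rule def_int_tame; intro dintros def_int2_apply[OF assms])+

lemma swappable_add:
  assumes "def_int (\<lambda>e. G (e 0) (e 1))" "def_int (\<lambda>e. H (e 0) (e 1))" "swappable G" "swappable H"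
  shows "swappable (\<lambda>a b. G a b + H a b)"
  using assms(3,4) unfolding swappable_def
  by (simp add: line_integral_add tame_slices[OF assms(1)] tame_slices[OF assms(2)])

lemma swappable_cmult:
  assumes "def_int (\<lambda>e. G (e 0) (e 1))" "swappable G"
  shows "swappable (\<lambda>a b. c * G a b)"
  using assms(2) unfolding swappable_def
  by (simp add: line_integral_cmult tame_slices[OF assms(1)])

lemma swappable_sum:
  assumes "\<And>i. i \<in> I \<Longrightarrow> def_int (\<lambda>e. G i (e 0) (e 1))" "\<And>i. i \<in> I \<Longrightarrow> swappable (G i)"
  shows "swappable (\<lambda>a b. \<Sum>i\<in>I. G i a b)"
  using assms
proof (induction I rule: infinite_finite_induct)
  case (insert i I)
  have "def_int (\<lambda>e. \<Sum>i\<in>I. G i (e 0) (e 1))" by (intro def_int_sum) (use insert in simp)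
  then have "swappable (\<lambda>a b. G i a b + (\<Sum>i\<in>I. G i a b))"
    using insert by (intro swappable_add) auto
  then show ?case using insert by simp
qed (simp_all add: swappable_def)

lemma swappable_mult:
  assumes "def_int (\<lambda>e. u (e 0))" "def_int (\<lambda>e. v (e 0))"
  shows "swappable (\<lambda>a b. u a * v b)"
proof -
  have t: "tame u" "tame v" using assms by (auto intro: def_int_tame)
  have "line_integral (\<lambda>a. line_integral (\<lambda>b. u a * v b)) = line_integral (\<lambda>a. line_integral v * u a)"
    by (simp add: line_integral_cmult[OF t(2)] mult.commute)
  moreover have "line_integral (\<lambda>b. line_integral (\<lambda>a. u a * v b)) = line_integral (\<lambda>b. line_integral u * v b)"
    using line_integral_cmult[OF t(1), of "v _"] by (simp add: mult.commute)
  ultimately show ?thesis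
    unfolding swappable_def by (simp only: line_integral_cmult[OF t(1)] line_integral_cmult[OF t(2)] mult.commute)
qed

lemma swappable_pieces:
  assumes \<I>: "finite \<I>" "disjoint \<I>" "\<Union>\<I> = {a. B a}"
    and R: "def_pred (\<lambda>e. R (e 0) (e 1))"
    and I: "\<And>I. I \<in> \<I> \<Longrightarrow> def_pred (\<lambda>e. e 0 \<in> I)"
      "\<And>I. I \<in> \<I> \<Longrightarrow> swappable (\<lambda>a b. of_bool (a \<in> I \<and> R a b))"
  shows "swappable (\<lambda>a b. of_bool (B a \<and> R a b))"
proof -
  have "swappable (\<lambda>a b. \<Sum>I\<in>\<I>. of_bool (a \<in> I \<and> R a b))"
    by (rule swappable_sum) (intro dintros I R, assumption, rule I)
  moreover have "of_bool (B a \<and> R a b) = (\<Sum>I\<in>\<I>. of_bool (a \<in> I \<and> R a b) :: int)" for a b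
    using of_bool_Union[OF \<I>(1,2), of a "R a b"] \<I>(3) by simp
  ultimately show ?thesis by simp
qed

lemma swappable_rectangle:
  assumes "def_pred (\<lambda>e. P (e 0))" "def_pred (\<lambda>e. Q (e 0))"
  shows "swappable (\<lambda>a b. of_bool (P a \<and> Q b))"
  using swappable_mult[of "\<lambda>a. of_bool (P a)" "\<lambda>b. of_bool (Q b)"] assms
  by (simp add: of_bool_conj def_int_of_bool)

text \<open>Where \<open>g\<close> is constant, the region and the graph are rectangles, which
  includes pieces that are single points; where it is continuous and injective, both integrals have
  been computed.\<close>

lemma swappable_upper:
  assumes g: "def_fun (\<lambda>e. g (e 0))" and B: "def_pred (\<lambda>e. B (e 0))"
  shows "swappable (\<lambda>a b. of_bool (B a \<and> g a < b))" "swappable (\<lambda>a b. of_bool (B a \<and> b = g a))"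
proof -
  obtain \<I> where \<I>: "finite \<I>" "disjoint \<I>" "\<Union>\<I> = {a. B a}"
    and I0: "\<forall>I\<in>\<I>. def_pred (\<lambda>e. e 0 \<in> I) \<and> ((\<exists>p. I = {p}) \<or> open I \<and> is_interval I \<and> I \<noteq> {} \<and>
      ((\<exists>c. \<forall>a\<in>I. g a = c) \<or> continuous_on I g \<and> inj_on g I))"
    using monotonicity[OF g B] by (elim exE conjE)
  note I = I0[rule_format]
  have defs: "def_pred (\<lambda>e. g (e 0) < e 1)" "def_pred (\<lambda>e. e 1 = g (e 0))"
    by (intro dintros g)+
  have "swappable (\<lambda>a b. of_bool (a \<in> I \<and> g a < b)) \<and> swappable (\<lambda>a b. of_bool (a \<in> I \<and> b = g a))"
    if "I \<in> \<I>" for I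
  proof -
    have const: ?thesis if c: "\<And>a. a \<in> I \<Longrightarrow> g a = c" for c
    proof -
      have "(a \<in> I \<and> g a < b) = (a \<in> I \<and> c < b)" "(a \<in> I \<and> b = g a) = (a \<in> I \<and> b = c)" for a b
        using c by auto
      moreover have "swappable (\<lambda>a b. of_bool (a \<in> I \<and> c < b))" "swappable (\<lambda>a b. of_bool (a \<in> I \<and> b = c))"
        by (intro swappable_rectangle dintros; use I[OF \<open>I \<in> \<I>\<close>] in blast)+
      ultimately show ?thesis by simp
    qed
    from I[OF \<open>I \<in> \<I>\<close>] consider p where "I = {p}" | c where "\<forall>a\<in>I. g a = c"
      | "open I" "is_interval I" "I \<noteq> {}" "continuous_on I g" "inj_on g I" by blast
    then show ?thesis
    proof cases
      case 1
      then show ?thesis by (intro const[of "g p"]) simp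
    next
      case 2
      then show ?thesis by (intro const) blast
    next
      case 3
      then show ?thesis using swappable_upper_inj swappable_graph_inj by blast
    qed
  qed
  then show "swappable (\<lambda>a b. of_bool (B a \<and> g a < b))" "swappable (\<lambda>a b. of_bool (B a \<and> b = g a))"
    using swappable_pieces[OF \<I>, of "\<lambda>a b. g a < b"] swappable_pieces[OF \<I>, of "\<lambda>a b. b = g a"] defs I
    by blast+
qed

text \<open>The bounds of bands live in the compressed scale. For \<open>\<bar>f a\<bar> < 1\<close>
  the bound is a real number; for \<open>f a \<le> - 1\<close> the region above it is the whole
  line, and for \<open>1 \<le> f a\<close> it is empty.\<close>

lemma swappable_upper_squash:
  assumes f: "def_fun (\<lambda>e. f (e 0))" and B: "def_pred (\<lambda>e. B (e 0))"
  shows "swappable (\<lambda>a b. of_bool (B a \<and> f a < squash b))" "swappable (\<lambda>a b. of_bool (B a \<and> squash b = f a))"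
proof -
  define B1 where "B1 a \<longleftrightarrow> B a \<and> \<bar>f a\<bar> < 1" for a
  define B2 where "B2 a \<longleftrightarrow> B a \<and> f a \<le> - 1" for a
  have B1: "def_pred (\<lambda>e. B1 (e 0))" unfolding B1_def by (intro dintros B f)
  have B2: "def_pred (\<lambda>e. B2 (e 0))" unfolding B2_def by (intro dintros B f)
  define g where "g a = unsquash (f a)" for a
  have g: "def_fun (\<lambda>e. g (e 0))" unfolding g_def by (intro dintros f)
  have lt: "f a < squash b \<longleftrightarrow> g a < b" and eq: "squash b = f a \<longleftrightarrow> b = g a" if "\<bar>f a\<bar> < 1" for a b
  proof -
    have "f a = squash (g a)" using that by (simp add: g_def)
    then show "f a < squash b \<longleftrightarrow> g a < b" "squash b = f a \<longleftrightarrow> b = g a"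
      by (metis squash_less_iff, metis unsquash_squash)
  qed
  have sq: "-1 < squash b" "squash b < 1" for b using abs_squash_less_1[of b] by auto
  have "(of_bool (B a \<and> f a < squash b) :: int) = of_bool (B1 a \<and> g a < b) + of_bool (B2 a \<and> True)" for a b
  proof -
    consider "\<bar>f a\<bar> < 1" | "f a \<le> -1" | "1 \<le> f a" by linarith
    then show ?thesis
      using lt[of a b] sq[of b] by cases (auto simp: B1_def B2_def)
  qed
  moreover have "swappable (\<lambda>a b. of_bool (B1 a \<and> g a < b) + of_bool (B2 a \<and> True))"
    by (intro swappable_add swappable_upper swappable_rectangle[of B2 "\<lambda>b. True"] g B1 B2 dintros)
  ultimately show "swappable (\<lambda>a b. of_bool (B a \<and> f a < squash b))" by simp
  have "squash b = f a \<longleftrightarrow> \<bar>f a\<bar> < 1 \<and> b = g a" for a b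
    using eq[of a b] abs_squash_less_1[of b] by metis
  then have "(B a \<and> squash b = f a) = (B1 a \<and> b = g a)" for a b by (auto simp: B1_def)
  then show "swappable (\<lambda>a b. of_bool (B a \<and> squash b = f a))"
    using swappable_upper(2)[OF g B1] by simp
qed

text \<open>The fibers split into graphs and bands. A band is the region above its lower bound,
  minus the region above its upper bound, minus the graph of the upper bound.\<close>

lemma swappable_indicator:
  assumes P: "def_pred (\<lambda>e. P (e 0) (e 1))"
  shows "swappable (\<lambda>a b. of_bool (P a b))"
proof -
  define P' where "P' e t = P (e 0) t" for e :: "nat \<Rightarrow> real" and t
  have P': "def_pred (\<lambda>e. P' (\<lambda>i. e (Suc i)) (e 0))"
    unfolding P'_def using def_pred_subst[OF P, of "\<lambda>i. if i = 0 then 1 else 0"] by simp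
  have "finite (frontier {t. P' e t})" for e
    using finite_frontier_def def_pred_fiber[OF P'] by blast
  then obtain N where "card (frontier {t. P' e t}) \<le> N" for e
    using uniform_finiteness_env[of "\<lambda>e. frontier {t. P' e t}"] def_pred_frontier[OF P'] by blast
  from fiber_decomposition[OF P' this] obtain M :: nat and Q where Q:
    "\<forall>j<M. def_pred (\<lambda>e. Q j (\<lambda>i. e (Suc i)) (e 0))"
    "\<forall>e t. P' e t \<longleftrightarrow> (\<exists>j<M. Q j e t)" "\<forall>j k e t. Q j e t \<longrightarrow> Q k e t \<longrightarrow> j = k"
    "\<forall>j<M. (\<forall>e a b. Q j e a \<longrightarrow> Q j e b \<longrightarrow> a = b) \<or>
        (\<forall>e. open {t. Q j e t} \<and> is_interval {t. Q j e t})"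
    by blast
  define R where "R j a t \<longleftrightarrow> Q j (a ## (\<lambda>i. 0)) t" for j a t
  have R: "def_pred (\<lambda>e. R j (u e) (v e))" if j: "j < M" and uv: "def_fun u" "def_fun v" for j u v
  proof -
    have "def_pred (\<lambda>e. Q j (\<lambda>i. (v e ## u e ## (\<lambda>i. 0)) (Suc i)) ((v e ## u e ## (\<lambda>i. 0)) 0))"
      by (rule def_pred_comp[of "\<lambda>e. Q j (\<lambda>i. e (Suc i)) (e 0)" "\<lambda>i e. (v e ## u e ## (\<lambda>i. 0)) i"])
        (use Q(1) j uv in \<open>auto intro!: dintros\<close>)
    then show ?thesis by (simp add: R_def)
  qed
  have PR: "P a b \<longleftrightarrow> (\<exists>j<M. R j a b)" for a b
    using Q(2)[rule_format, of "a ## (\<lambda>i. 0)" b] by (simp add: P'_def R_def)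
  have Rj: "swappable (\<lambda>a b. of_bool (R j a b))" if j: "j < M" for j
  proof -
    from Q(4)[rule_format, OF j] show ?thesis
    proof
      assume "\<forall>e a b. Q j e a \<longrightarrow> Q j e b \<longrightarrow> a = b"
      then have uniq: "b = b'" if "R j a b" "R j a b'" for a b b' using that unfolding R_def by blast
      define B where "B a \<longleftrightarrow> (\<exists>b. R j a b)" for a
      define g where "g a = (THE b. R j a b)" for a
      have "def_pred (\<lambda>e. B (e 0))" unfolding B_def by (intro dintros R[OF j])
      moreover have "def_fun (\<lambda>e. g (e 0))"
        unfolding g_def by (rule def_fun_The) (intro R[OF j] dintros, rule uniq)
      moreover have "R j a b \<longleftrightarrow> B a \<and> b = g a" for a b
        unfolding B_def g_def using uniq by (metis theI')
      ultimately show ?thesis using swappable_upper(2)[of g B] by simp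
    next
      assume *: "\<forall>e. open {t. Q j e t} \<and> is_interval {t. Q j e t}"
      define B where "B a \<longleftrightarrow> (\<exists>b. R j a b)" for a
      define l where "l a = (THE l. \<exists>r. squash_bounds (R j a) l r)" for a
      define r where "r a = (THE r. \<exists>l. squash_bounds (R j a) l r)" for a
      have B: "def_pred (\<lambda>e. B (e 0))" unfolding B_def by (intro dintros R[OF j])
      have l: "def_fun (\<lambda>e. l (e 0))"
        unfolding l_def
      proof (rule def_fun_The)
        show "def_pred (\<lambda>e. \<exists>r. squash_bounds (R j (e (Suc 0))) (e 0) r)"
          unfolding squash_bounds_def by (intro dintros R[OF j])
      qed (use squash_bounds_unique in blast)
      have r: "def_fun (\<lambda>e. r (e 0))"
        unfolding r_def
      proof (rule def_fun_The)
        show "def_pred (\<lambda>e. \<exists>l. squash_bounds (R j (e (Suc 0))) l (e 0))"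
          unfolding squash_bounds_def by (intro dintros R[OF j])
      qed (use squash_bounds_unique in blast)
      have bounds: "squash_bounds (R j a) (l a) (r a)" if Ba: "B a" for a
      proof -
        obtain b where "R j a b" using Ba by (auto simp: B_def)
        moreover have "open {t. R j a t}" "is_interval {t. R j a t}" using * unfolding R_def by blast+
        ultimately obtain l' r' where lr: "squash_bounds (R j a) l' r'"
          using squash_bounds_exist[of "R j a"] by blast
        then have "l a = l'" "r a = r'"
          unfolding l_def r_def using squash_bounds_unique by blast+
        then show ?thesis using lr by simp
      qed
      have "(of_bool (R j a b) :: int) = of_bool (B a \<and> l a < squash b) +
          (- 1) * (of_bool (B a \<and> r a < squash b) + of_bool (B a \<and> squash b = r a))" for a b
      proof (cases "B a")
        case True
        from bounds[OF this] have "l a < r a" "R j a b \<longleftrightarrow> l a < squash b \<and> squash b < r a"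
          by (auto simp: squash_bounds_def)
        then show ?thesis using True by (cases "squash b" "r a" rule: linorder_cases) auto
      next
        case False
        then show ?thesis by (auto simp: B_def)
      qed
      moreover have "swappable (\<lambda>a b. of_bool (B a \<and> l a < squash b) +
          (- 1) * (of_bool (B a \<and> r a < squash b) + of_bool (B a \<and> squash b = r a)))"
        by (intro swappable_add swappable_cmult swappable_upper_squash l r B dintros
            def_fun_real_comp[OF l] def_fun_real_comp[OF r])
      ultimately show ?thesis by simp
    qed
  qed
  have "swappable (\<lambda>a b. \<Sum>j<M. of_bool (R j a b))"
    by (rule swappable_sum) (auto intro!: dintros R Rj)
  moreover have "(of_bool (P a b) :: int) = (\<Sum>j<M. of_bool (R j a b))" for a b
  proof (cases "P a b")
    case True
    then obtain j where j: "j < M" "R j a b" using PR by blast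
    have "(\<Sum>k<M. of_bool (R k a b) :: int) = (\<Sum>k<M. of_bool (k = j))"
      by (rule sum.cong[OF refl]) (use j Q(3) in \<open>auto simp: R_def\<close>)
    then show ?thesis using True j(1) by (simp add: of_bool_def)
  next
    case False
    then show ?thesis using PR by (simp add: of_bool_def)
  qed
  ultimately show ?thesis by simp
qed

lemma swappable_def_int:
  assumes G: "def_int (\<lambda>e. G (e 0) (e 1))" shows "swappable G"
proof -
  define V where "V = range (\<lambda>e::nat \<Rightarrow> real. G (e 0) (e 1))"
  have finV: "finite V" using G by (simp add: V_def def_int_def)
  have inV: "G a b \<in> V" for a b
    unfolding V_def by (rule image_eqI[of _ _ "\<lambda>i. if i = 0 then a else b"]) auto
  have Gk: "def_pred (\<lambda>e. G (e 0) (e 1) = k)" for k using G by (simp add: def_int_def)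
  have "swappable (\<lambda>a b. \<Sum>k\<in>V. k * of_bool (G a b = k))"
    by (intro swappable_sum swappable_cmult swappable_indicator def_int_mult def_int_const def_int_of_bool Gk)
  moreover have "(\<Sum>k\<in>V. k * of_bool (G a b = k)) = G a b" for a b
    using finV inV[of a b] by (simp add: of_bool_def if_distrib[of "\<lambda>x. _ * x"] sum.delta' cong: if_cong)
  ultimately show ?thesis by simp
qed

section \<open>Exchange of integrals in all dimensions\<close>

lemma def_int_vec2:
  assumes G: "def_int (\<lambda>e. G (trunc m e) (trunc n (\<lambda>i. e (i + m))))"
    and V: "\<And>e. V e \<in> eucl m" "\<And>i. i < m \<Longrightarrow> def_fun (\<lambda>e. V e i)"
    and W: "\<And>e. W e \<in> eucl n" "\<And>i. i < n \<Longrightarrow> def_fun (\<lambda>e. W e i)"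
  shows "def_int (\<lambda>e. G (V e) (W e))"
proof -
  let ?T = "\<lambda>i e. if i < m then V e i else if i - m < n then W e (i - m) else 0"
  have "def_fun (?T i)" for i
    using V(2)[of i] W(2)[of "i - m"] by (cases "i < m"; cases "i - m < n") (auto intro: dintros)
  from def_int_comp[OF G this]
  have "def_int (\<lambda>e. G (trunc m (\<lambda>i. ?T i e)) (trunc n (\<lambda>i. ?T (i + m) e)))" .
  moreover have "trunc m (\<lambda>i. ?T i e) = V e" "trunc n (\<lambda>i. ?T (i + m) e) = W e" for e
  proof -
    have "V e i = 0" if "m \<le> i" for i using V(1)[of e] that by (simp add: eucl_def)
    moreover have "W e i = 0" if "n \<le> i" for i using W(1)[of e] that by (simp add: eucl_def)
    ultimately show "trunc m (\<lambda>i. ?T i e) = V e" "trunc n (\<lambda>i. ?T (i + m) e) = W e"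
      by (auto simp: trunc_def fun_eq_iff)
  qed
  ultimately show ?thesis by simp
qed

text \<open>A real variable is moved past a vector coordinate by coordinate. Each move is the planar
  theorem, applied to the integral over the remaining coordinates, which has finitely many definable
  levels.\<close>

lemma line_eucl_swap:
  "def_int (\<lambda>e. G (e 0) (trunc n (\<lambda>i. e (Suc i)))) \<Longrightarrow>
    line_integral (\<lambda>a. eucl_integral n (\<lambda>y. G a y)) = eucl_integral n (\<lambda>y. line_integral (\<lambda>a. G a y))"
proof (induction n arbitrary: G)
  case (Suc n)
  have G': "def_int (\<lambda>e. G (e j) (e k ## trunc n (\<lambda>i. e (\<sigma> i))))" for j k \<sigma>
  proof -
    have "def_int (\<lambda>e. G ((e j ## e k ## (\<lambda>i. e (\<sigma> i))) 0) (trunc (Suc n) (\<lambda>i. (e j ## e k ## (\<lambda>i. e (\<sigma> i))) (Suc i))))"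
      by (rule def_int_comp[OF Suc.prems, of "\<lambda>i e. (e j ## e k ## (\<lambda>i. e (\<sigma> i))) i"]) (intro dintros)
    moreover have "trunc (Suc n) (\<lambda>i. (e k ## (\<lambda>i. e (\<sigma> i))) i) = e k ## trunc n (\<lambda>i. e (\<sigma> i))" for e
      by (auto simp: trunc_def fun_eq_iff split: nat.split)
    ultimately show ?thesis by simp
  qed
  have "def_int (\<lambda>e. eucl_integral n (\<lambda>y. G (e 0) (e 1 ## y)))"
    by (intro def_int_eucl_integral) (use G'[of n "Suc n" "\<lambda>i. i"] in simp)
  from swappable_def_int[of "\<lambda>a b. eucl_integral n (\<lambda>y. G a (b ## y))", OF this]
  have "line_integral (\<lambda>a. line_integral (\<lambda>b. eucl_integral n (\<lambda>y. G a (b ## y)))) =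
      line_integral (\<lambda>b. line_integral (\<lambda>a. eucl_integral n (\<lambda>y. G a (b ## y))))"
    by (simp add: swappable_def)
  also have "\<dots> = line_integral (\<lambda>b. eucl_integral n (\<lambda>y. line_integral (\<lambda>a. G a (b ## y))))"
  proof -
    have "def_int (\<lambda>e. G (e 0) (b ## trunc n (\<lambda>i. e (Suc i))))" for b
    proof -
      have "def_int (\<lambda>e. G ((e 0 ## b ## (\<lambda>i. e (Suc i))) 0) (trunc (Suc n) (\<lambda>i. (e 0 ## b ## (\<lambda>i. e (Suc i))) (Suc i))))"
        by (rule def_int_comp[OF Suc.prems, of "\<lambda>i e. (e 0 ## b ## (\<lambda>i. e (Suc i))) i"]) (intro dintros)
      moreover have "trunc (Suc n) (\<lambda>i. (b ## (\<lambda>i. e (Suc i))) i) = b ## trunc n (\<lambda>i. e (Suc i))" for e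
        by (auto simp: trunc_def fun_eq_iff split: nat.split)
      ultimately show ?thesis by simp
    qed
    then show ?thesis using Suc.IH[of "\<lambda>a y. G a (_ ## y)"] by simp
  qed
  finally show ?case by simp
qed simp

text \<open>The coordinates of the first vector are peeled off one at a time and moved past the
  whole second vector.\<close>

theorem eucl_integral_swap:
  "def_int (\<lambda>e. G (trunc m e) (trunc n (\<lambda>i. e (i + m)))) \<Longrightarrow>
    eucl_integral m (\<lambda>x. eucl_integral n (\<lambda>y. G x y)) = eucl_integral n (\<lambda>y. eucl_integral m (\<lambda>x. G x y))"
proof (induction m arbitrary: G)
  case (Suc m)
  have "eucl_integral m (\<lambda>x. eucl_integral n (\<lambda>y. G (a ## x) y)) =
      eucl_integral n (\<lambda>y. eucl_integral m (\<lambda>x. G (a ## x) y))" for a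
    by (rule Suc.IH, rule def_int_vec2[OF Suc.prems]) (auto intro!: dintros)
  moreover have "def_int (\<lambda>e. eucl_integral m (\<lambda>x. G (e 0 ## x) (trunc n (\<lambda>i. e (Suc i)))))"
    by (rule def_int_eucl_integral, rule def_int_vec2[OF Suc.prems])
      (auto intro!: dintros def_fun_trunc[of _ "\<lambda>i. i", simplified])
  ultimately show ?case
    using line_eucl_swap[of "\<lambda>a y. eucl_integral m (\<lambda>x. G (a ## x) y)" n] by simp
qed simp

end

section \<open>The Euler characteristic as an iterated integral\<close>

text \<open>One fixed enumeration of the basis; by \<open>definable_iff_def_pred\<close>
  definability may be tested along it, whichever enumeration witnesses it.\<close>

definition basis_list :: "'a::euclidean_space list" where
  "basis_list = (SOME bs. distinct bs \<and> set bs = Basis)"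

lemma basis_list: "distinct (basis_list :: 'a::euclidean_space list)" "set (basis_list :: 'a list) = Basis"
proof -
  have "\<exists>bs :: 'a list. distinct bs \<and> set bs = Basis"
    using finite_distinct_list[of "Basis :: 'a set"] by auto
  from someI_ex[OF this]
  show "distinct (basis_list :: 'a list)" "set (basis_list :: 'a list) = Basis"
    unfolding basis_list_def by blast+
qed

lemma length_basis_list: "length (basis_list :: 'a::euclidean_space list) = DIM('a)"
  using distinct_card[of "basis_list :: 'a list"] basis_list[where 'a = 'a] by simp

lemma nth_basis_list: "i < DIM('a) \<Longrightarrow> (basis_list :: 'a::euclidean_space list) ! i \<in> Basis"
  using basis_list(2)[where 'a = 'a] nth_mem[of i "basis_list :: 'a list"] by (simp add: length_basis_list)

lemma inner_nth_basis_list: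
  assumes "i < DIM('a)" "j < DIM('a)"
  shows "(basis_list :: 'a::euclidean_space list) ! i \<bullet> basis_list ! j = (if i = j then 1 else 0)"
  using assms by (simp add: inner_Basis nth_basis_list nth_eq_iff_index_eq basis_list length_basis_list)

text \<open>Entries beyond the dimension are ignored, so whole environments can be read as
  vectors.\<close>

definition vec_of :: "(nat \<Rightarrow> real) \<Rightarrow> 'a::euclidean_space" where
  "vec_of y = (\<Sum>i<DIM('a). y i *\<^sub>R basis_list ! i)"

definition coords :: "'a::euclidean_space \<Rightarrow> nat \<Rightarrow> real" where
  "coords x i = (if i < DIM('a) then x \<bullet> basis_list ! i else 0)"

lemma coords_in_eucl [simp]: "coords (x :: 'a::euclidean_space) \<in> eucl (DIM('a))"
  by (simp add: eucl_def coords_def)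

lemma inner_vec_of: "i < DIM('a) \<Longrightarrow> (vec_of y :: 'a::euclidean_space) \<bullet> basis_list ! i = y i"
  by (simp add: vec_of_def inner_sum_left inner_nth_basis_list if_distrib[of "\<lambda>x. _ * x"] sum.delta cong: if_cong)

lemma coords_vec_of: "coords (vec_of y :: 'a::euclidean_space) = trunc (DIM('a)) y"
  by (rule ext) (simp add: coords_def trunc_def inner_vec_of)

lemma vec_of_coords [simp]: "vec_of (coords x) = (x :: 'a::euclidean_space)"
proof (rule euclidean_eqI)
  fix b :: 'a assume "b \<in> Basis"
  then obtain i where "i < DIM('a)" "b = basis_list ! i"
    using basis_list(2)[where 'a = 'a] length_basis_list[where 'a = 'a] by (metis in_set_conv_nth)
  then show "vec_of (coords x) \<bullet> b = x \<bullet> b" by (simp add: inner_vec_of coords_def)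
qed

lemma vec_of_trunc [simp]: "(vec_of (trunc (DIM('a)) y) :: 'a::euclidean_space) = vec_of y"
  by (simp add: vec_of_def trunc_def)

lemma coords_vec_of_eucl: "y \<in> eucl (DIM('a)) \<Longrightarrow> coords (vec_of y :: 'a::euclidean_space) = y"
  by (simp add: coords_vec_of)

lemma vec_of_eq_iff:
  "y \<in> eucl (DIM('a)) \<Longrightarrow> (vec_of y :: 'a::euclidean_space) = x \<longleftrightarrow> y = coords x"
  using coords_vec_of_eucl by fastforce

lemma continuous_on_vec_of:
  fixes f :: "'b::topological_space \<Rightarrow> nat \<Rightarrow> real"
  assumes "continuous_on A f" shows "continuous_on A (\<lambda>x. vec_of (f x) :: 'a::euclidean_space)"
  unfolding vec_of_def
  by (intro continuous_intros continuous_on_product_then_coordinatewise[OF assms])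

lemma continuous_on_coords: "continuous_on A (coords :: 'a::euclidean_space \<Rightarrow> nat \<Rightarrow> real)"
proof (rule continuous_on_coordinatewise_then_product)
  fix i
  show "continuous_on A (\<lambda>x::'a. coords x i)"
    unfolding coords_def by (cases "i < DIM('a)") (auto intro!: continuous_intros)
qed

context o_minimal_field_expansion
begin

section \<open>Invariance under definable bijections\<close>

lemma eucl_integral_point:
  "c \<in> eucl n \<Longrightarrow> eucl_integral n (\<lambda>y. of_bool (y = c)) = 1"
proof (induction n arbitrary: c)
  case 0
  then show ?case by (simp add: eucl_0)
next
  case (Suc n)
  then obtain a c' where c: "c = a ## c'" "c' \<in> eucl n" using eucl_Suc_cases by blast
  have "eucl_integral n (\<lambda>y. of_bool (b ## y = c)) = of_bool (b = a)" for b
    using Suc.IH[OF c(2)] c(1) by (cases "b = a") (simp_all add: eucl_integral_zero)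
  then show ?case by (simp add: line_integral_point)
qed

text \<open>Double counting: the indicator of \<open>R\<close> is integrated in both orders, and
  every fiber is a point or empty. The two spaces may have different dimensions.\<close>

lemma eucl_integral_rel:
  assumes R: "def_pred (\<lambda>e. R (trunc m e) (trunc n (\<lambda>i. e (i + m))))"
    and P: "\<And>x. x \<in> eucl m \<Longrightarrow> P x \<Longrightarrow> \<exists>c\<in>eucl n. \<forall>y\<in>eucl n. R x y \<longleftrightarrow> y = c"
      "\<And>x y. x \<in> eucl m \<Longrightarrow> y \<in> eucl n \<Longrightarrow> R x y \<Longrightarrow> P x"
    and Q: "\<And>y. y \<in> eucl n \<Longrightarrow> Q y \<Longrightarrow> \<exists>c\<in>eucl m. \<forall>x\<in>eucl m. R x y \<longleftrightarrow> x = c"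
      "\<And>x y. x \<in> eucl m \<Longrightarrow> y \<in> eucl n \<Longrightarrow> R x y \<Longrightarrow> Q y"
  shows "eucl_integral m (\<lambda>x. of_bool (P x)) = eucl_integral n (\<lambda>y. of_bool (Q y))"
proof -
  have "eucl_integral n (\<lambda>y. of_bool (R x y)) = of_bool (P x)" if x: "x \<in> eucl m" for x
  proof (cases "P x")
    case True
    then obtain c where c: "c \<in> eucl n" "\<forall>y\<in>eucl n. R x y \<longleftrightarrow> y = c" using P(1)[OF x] by blast
    have "eucl_integral n (\<lambda>y. of_bool (R x y)) = eucl_integral n (\<lambda>y. of_bool (y = c))"
      by (rule eucl_integral_cong) (use c(2) in simp)
    then show ?thesis using eucl_integral_point[OF c(1)] True by simp
  next
    case False
    have "eucl_integral n (\<lambda>y. of_bool (R x y)) = eucl_integral n (\<lambda>y. 0)"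
      by (rule eucl_integral_cong) (use P(2)[OF x] False in auto)
    then show ?thesis using False by (simp add: eucl_integral_zero)
  qed
  then have 1: "eucl_integral m (\<lambda>x. eucl_integral n (\<lambda>y. of_bool (R x y))) = eucl_integral m (\<lambda>x. of_bool (P x))"
    by (rule eucl_integral_cong)
  have "eucl_integral m (\<lambda>x. of_bool (R x y)) = of_bool (Q y)" if y: "y \<in> eucl n" for y
  proof (cases "Q y")
    case True
    then obtain c where c: "c \<in> eucl m" "\<forall>x\<in>eucl m. R x y \<longleftrightarrow> x = c" using Q(1)[OF y] by blast
    have "eucl_integral m (\<lambda>x. of_bool (R x y)) = eucl_integral m (\<lambda>x. of_bool (x = c))"
      by (rule eucl_integral_cong) (use c(2) in simp)
    then show ?thesis using eucl_integral_point[OF c(1)] True by simp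
  next
    case False
    have "eucl_integral m (\<lambda>x. of_bool (R x y)) = eucl_integral m (\<lambda>x. 0)"
      by (rule eucl_integral_cong) (use Q(2)[OF _ y] False in auto)
    then show ?thesis using False by (simp add: eucl_integral_zero)
  qed
  then have 2: "eucl_integral n (\<lambda>y. eucl_integral m (\<lambda>x. of_bool (R x y))) = eucl_integral n (\<lambda>y. of_bool (Q y))"
    by (rule eucl_integral_cong)
  have "eucl_integral m (\<lambda>x. eucl_integral n (\<lambda>y. of_bool (R x y))) =
      eucl_integral n (\<lambda>y. eucl_integral m (\<lambda>x. of_bool (R x y)))"
    by (rule eucl_integral_swap) (intro def_int_of_bool R)
  then show ?thesis using 1 2 by simp
qed

text \<open>The size \<open>c\<close> is there for the induction: the slice at \<open>a\<close> is a
  simplex of size \<open>c - a\<close>. Each coordinate contributes one open interval and hence one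
  sign.\<close>

lemma eucl_integral_scaled_simplex:
  "0 < c \<Longrightarrow> eucl_integral d (\<lambda>x. of_bool ((\<forall>i<d. 0 < x i) \<and> (\<Sum>i<d. x i) < c)) = (- 1) ^ d"
proof (induction d arbitrary: c)
  case (Suc d)
  have "eucl_integral d (\<lambda>x. of_bool ((\<forall>i<Suc d. 0 < (a ## x) i) \<and> (\<Sum>i<Suc d. (a ## x) i) < c)) =
      (- 1) ^ d * of_bool (a \<in> {0<..<c})" for a
  proof -
    have eq: "(\<forall>i<Suc d. 0 < (a ## x) i) \<and> (\<Sum>i<Suc d. (a ## x) i) < c \<longleftrightarrow>
        0 < a \<and> (\<forall>i<d. 0 < x i) \<and> (\<Sum>i<d. x i) < c - a" for x
      by (auto simp: All_less_Suc2 sum.lessThan_Suc_shift algebra_simps simp del: sum.lessThan_Suc)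
    show ?thesis
    proof (cases "a \<in> {0<..<c}")
      case True
      then show ?thesis using Suc.IH[of "c - a"] unfolding eq by simp
    next
      case False
      have "\<not> (0 < a \<and> (\<forall>i<d. 0 < x i) \<and> (\<Sum>i<d. x i) < c - a)" for x
      proof
        assume *: "0 < a \<and> (\<forall>i<d. 0 < x i) \<and> (\<Sum>i<d. x i) < c - a"
        then have "0 \<le> (\<Sum>i<d. x i)" by (intro sum_nonneg) (auto simp: less_imp_le)
        then show False using * False by auto
      qed
      then have "(\<lambda>x. of_bool (0 < a \<and> (\<forall>i<d. 0 < x i) \<and> (\<Sum>i<d. x i) < c - a) :: int) = (\<lambda>x. 0)"
        by (simp only: of_bool_eq_0_iff fun_eq_iff) simp
      then show ?thesis using False unfolding eq by (simp only: eucl_integral_zero) simp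
    qed
  qed
  moreover have "is_interval {0<..<c}" "{0<..<c} \<noteq> {}" using Suc.prems by (auto simp: is_interval_1)
  ultimately show ?case
    using line_integral_cmult[OF tame_indicator_interval, of "{0<..<c}"]
      line_integral_open_interval[of "{0<..<c}"] by simp
qed simp

lemma eucl_integral_std_simplex: "eucl_integral d (\<lambda>x. of_bool (x \<in> std_simplex d)) = (- 1) ^ d"
proof -
  have "eucl_integral d (\<lambda>x. of_bool (x \<in> std_simplex d)) =
      eucl_integral d (\<lambda>x. of_bool ((\<forall>i<d. 0 < x i) \<and> (\<Sum>i<d. x i) < 1))"
    by (rule eucl_integral_cong) (simp add: std_simplex_def)
  then show ?thesis using eucl_integral_scaled_simplex[of 1 d] by simp
qed

text \<open>Inner products with all vectors are asked for, not only with basis vectors, which keeps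
  the notion independent of coordinates and compatible with products.\<close>

definition def_vec :: "((nat \<Rightarrow> real) \<Rightarrow> 'a::euclidean_space) \<Rightarrow> bool" where
  "def_vec V \<longleftrightarrow> (\<forall>b. def_fun (\<lambda>e. V e \<bullet> b))"

lemma def_vec_vec_of [dintros]:
  "(\<And>i. def_fun (\<lambda>e. Y e i)) \<Longrightarrow> def_vec (\<lambda>e. vec_of (Y e))"
  unfolding def_vec_def vec_of_def inner_sum_left inner_scaleR_left by (intro allI dintros)

lemma def_vec_Pair [dintros]: "def_vec V \<Longrightarrow> def_vec W \<Longrightarrow> def_vec (\<lambda>e. (V e, W e))"
  unfolding def_vec_def inner_prod_def fst_conv snd_conv by (auto intro!: dintros)

lemma def_vec_fst [dintros]:
  assumes "def_vec V" shows "def_vec (\<lambda>e. fst (V e))"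
proof -
  have "def_fun (\<lambda>e. V e \<bullet> (b, 0))" for b using assms by (simp add: def_vec_def)
  then show ?thesis by (simp add: def_vec_def inner_prod_def)
qed

lemma def_vec_snd [dintros]:
  assumes "def_vec V" shows "def_vec (\<lambda>e. snd (V e))"
proof -
  have "def_fun (\<lambda>e. V e \<bullet> (0, b))" for b using assms by (simp add: def_vec_def)
  then show ?thesis by (simp add: def_vec_def inner_prod_def)
qed

lemma def_vec_const [dintros]: "def_vec (\<lambda>e. c)"
  unfolding def_vec_def by (intro allI dintros)

lemma def_vec_real: "def_vec (\<lambda>e. u e :: real) \<longleftrightarrow> def_fun u"
proof
  assume "def_vec u"
  then have "def_fun (\<lambda>e. u e \<bullet> 1)" by (simp only: def_vec_def)
  then show "def_fun u" by simp
qed (auto simp: def_vec_def intro!: dintros)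

lemma def_vec_linear:
  assumes "linear f" "def_vec V" shows "def_vec (\<lambda>e. f (V e))"
proof -
  have "f (V e) \<bullet> c = (\<Sum>b\<in>Basis. (V e \<bullet> b) * (f b \<bullet> c))" for e c
  proof -
    have "f (V e) = f (\<Sum>b\<in>Basis. (V e \<bullet> b) *\<^sub>R b)" by (simp add: euclidean_representation)
    also have "\<dots> = (\<Sum>b\<in>Basis. (V e \<bullet> b) *\<^sub>R f b)"
      by (simp add: linear_sum[OF assms(1)] linear_cmul[OF assms(1)])
    finally show ?thesis by (simp add: inner_sum_left)
  qed
  moreover have "def_fun (\<lambda>e. \<Sum>b\<in>Basis. (V e \<bullet> b) * (f b \<bullet> c))" for c
    using assms(2) by (intro dintros) (simp add: def_vec_def)
  ultimately show ?thesis by (simp add: def_vec_def)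
qed

lemma def_fun_inner [dintros]:
  assumes "def_vec V" "def_vec W" shows "def_fun (\<lambda>e. V e \<bullet> W e)"
proof -
  have eq: "V e \<bullet> W e = (\<Sum>b\<in>Basis. (V e \<bullet> b) * (W e \<bullet> b))" for e by (rule euclidean_inner)
  have "def_fun (\<lambda>e. \<Sum>b\<in>Basis. (V e \<bullet> b) * (W e \<bullet> b))"
    using assms unfolding def_vec_def by (intro def_fun_sum def_fun_mult) blast+
  then show ?thesis by (simp only: eq)
qed

lemma def_pred_vec_eq [dintros]:
  fixes V W :: "(nat \<Rightarrow> real) \<Rightarrow> 'a::euclidean_space"
  assumes "def_vec V" "def_vec W" shows "def_pred (\<lambda>e. V e = W e)"
  unfolding euclidean_eq_iff[where 'a = 'a]
  using assms unfolding def_vec_def by (intro def_pred_ball def_pred_eq) auto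

lemma def_fun_coords [dintros]: "def_vec V \<Longrightarrow> def_fun (\<lambda>e. coords (V e) i)"
  unfolding coords_def by (intro dintros)

text \<open>The formula may be witnessed in more variables than it reads; the excess is projected
  away.\<close>

lemma def_pred_at_of_trunc:
  assumes "def_pred P" "\<And>e. P (trunc n e) \<longleftrightarrow> P e"
  shows "def_pred_at n P"
proof -
  obtain k where "def_pred_at k P" using assms(1) def_pred_def by blast
  then have "def_pred_at (n + k) P" by (rule def_pred_at_mono) simp
  from def_pred_at_projs[OF this] have "def_pred_at n (\<lambda>e. \<exists>e'. (\<forall>i<n. e' i = e i) \<and> P e')" .
  moreover have "(\<exists>e'. (\<forall>i<n. e' i = e i) \<and> P e') \<longleftrightarrow> P e" for e
  proof
    assume "\<exists>e'. (\<forall>i<n. e' i = e i) \<and> P e'"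
    then obtain e' where e': "\<forall>i<n. e' i = e i" "P e'" by blast
    then have "trunc n e' = trunc n e" by (auto simp: trunc_def fun_eq_iff)
    then show "P e" using assms(2)[of e] assms(2)[of e'] e'(2) by simp
  qed blast
  ultimately show ?thesis by simp
qed

text \<open>The bridge from coordinate lists to formulas. The enumeration \<open>bs\<close> from the
  definition may differ from \<open>basis_list\<close>; passing through the vector itself absorbs
  the change.\<close>

lemma definable_iff_def_pred:
  fixes A :: "'a::euclidean_space set"
  shows "definable S A \<longleftrightarrow> def_pred (\<lambda>e. vec_of e \<in> A)"
proof
  assume "definable S A"
  then obtain bs where bs: "distinct bs" "set bs = (Basis :: 'a set)"
    "(\<lambda>x. map (\<lambda>b. x \<bullet> b) bs) ` A \<in> S (length bs)" unfolding definable_def by blast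
  define v where "v e = (\<Sum>i<length bs. e i *\<^sub>R bs ! i)" for e :: "nat \<Rightarrow> real"
  have bij: "bij_betw ((!) bs) {..<length bs} Basis"
    using bij_betw_nth[OF bs(1) refl bs(2)[symmetric]] .
  have v_inner: "v (\<lambda>i. x \<bullet> bs ! i) = x" for x
  proof -
    have "v (\<lambda>i. x \<bullet> bs ! i) = (\<Sum>b\<in>Basis. (x \<bullet> b) *\<^sub>R b)"
      unfolding v_def using sum.reindex_bij_betw[OF bij, of "\<lambda>b. (x \<bullet> b) *\<^sub>R b"] .
    then show ?thesis by (simp add: euclidean_representation)
  qed
  have inner_v: "v e \<bullet> bs ! j = e j" if j: "j < length bs" for e j
  proof -
    have "bs ! i \<bullet> bs ! j = (if i = j then 1 else 0)" if "i < length bs" for i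
      using that j bs(1,2) nth_mem[of i bs] nth_mem[of j bs] by (simp add: inner_Basis nth_eq_iff_index_eq)
    then have "v e \<bullet> bs ! j = (\<Sum>i<length bs. e i * (if i = j then 1 else 0))"
      unfolding v_def inner_sum_left by (intro sum.cong) auto
    then show ?thesis using j by (simp add: if_distrib[of "\<lambda>x. _ * x"] sum.delta cong: if_cong)
  qed
  have "v e \<in> A \<longleftrightarrow> map e [0..<length bs] \<in> (\<lambda>x. map (\<lambda>b. x \<bullet> b) bs) ` A" for e
  proof
    assume "v e \<in> A"
    moreover have "map e [0..<length bs] = map (\<lambda>b. v e \<bullet> b) bs"
      by (rule nth_equalityI) (simp_all add: inner_v)
    ultimately show "map e [0..<length bs] \<in> (\<lambda>x. map (\<lambda>b. x \<bullet> b) bs) ` A" by blast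
  next
    assume "map e [0..<length bs] \<in> (\<lambda>x. map (\<lambda>b. x \<bullet> b) bs) ` A"
    then obtain x where x: "x \<in> A" "map e [0..<length bs] = map (\<lambda>b. x \<bullet> b) bs" by blast
    have "e i = x \<bullet> bs ! i" if "i < length bs" for i
      using arg_cong[OF x(2), of "\<lambda>l. l ! i"] that by simp
    then have "v e = v (\<lambda>i. x \<bullet> bs ! i)" unfolding v_def by (intro sum.cong) auto
    then show "v e \<in> A" using x(1) v_inner by simp
  qed
  then have "def_pred_at (length bs) (\<lambda>e. v e \<in> A)" unfolding def_pred_at_def using bs(3) by blast
  then have "def_pred (\<lambda>e. v e \<in> A)" unfolding def_pred_def by blast
  \<comment> \<open>Coordinates along \<open>bs\<close> are inner products of the vector, hence
    definable functions of its coordinates along \<open>basis_list\<close>.\<close>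
  moreover have "def_fun (\<lambda>e. vec_of e \<bullet> bs ! i)" for i by (intro dintros)
  ultimately have "def_pred (\<lambda>e. v (\<lambda>i. vec_of e \<bullet> bs ! i) \<in> A)"
    by (rule def_pred_comp[where T = "\<lambda>i e. vec_of e \<bullet> bs ! i"])
  then show "def_pred (\<lambda>e. vec_of e \<in> A)" by (simp only: v_inner)
next
  let ?n = "DIM('a)"
  assume "def_pred (\<lambda>e. vec_of e \<in> A)"
  then have "def_pred_at ?n (\<lambda>e. vec_of e \<in> A)" by (rule def_pred_at_of_trunc) simp
  then obtain B where B: "B \<in> S ?n" "\<And>e. vec_of e \<in> A \<longleftrightarrow> map e [0..<?n] \<in> B"
    unfolding def_pred_at_def by blast
  have co: "map (\<lambda>b. x \<bullet> b) basis_list = map (coords x) [0..<?n]" for x :: 'a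
    by (rule nth_equalityI) (simp_all add: length_basis_list coords_def)
  have "(\<lambda>x. map (\<lambda>b. x \<bullet> b) basis_list) ` A = B"
  proof safe
    fix x assume "x \<in> A"
    then show "map (\<lambda>b. x \<bullet> b) basis_list \<in> B" unfolding co using B(2)[of "coords x"] by simp
  next
    fix l assume l: "l \<in> B"
    then have len: "length l = ?n" using subset_space[OF B(1)] by auto
    define e where "e = trunc ?n (\<lambda>i. l ! i)"
    have l_eq: "l = map e [0..<?n]" by (rule nth_equalityI) (simp_all add: len e_def trunc_def)
    then have "vec_of e \<in> A" using B(2) l by simp
    moreover have "l = map (\<lambda>b. vec_of e \<bullet> b) (basis_list :: 'a list)"
      unfolding co coords_vec_of l_eq by (simp add: trunc_def)
    ultimately show "l \<in> (\<lambda>x. map (\<lambda>b. x \<bullet> b) basis_list) ` A" by blast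
  qed
  then show "definable S A"
    unfolding definable_def using B(1) basis_list[where 'a = 'a] length_basis_list[where 'a = 'a] by metis
qed

lemma definable_mem:
  assumes "definable S A" "def_vec V" shows "def_pred (\<lambda>e. V e \<in> A)"
proof -
  have "def_pred (\<lambda>e. vec_of e \<in> A)" using assms(1) definable_iff_def_pred by blast
  from def_pred_comp[OF this, of "\<lambda>i e. coords (V e) i"]
  have "def_pred (\<lambda>e. vec_of (coords (V e)) \<in> A)" using assms(2) by (auto intro: dintros)
  then show ?thesis by simp
qed

text \<open>The value that all partitions into definable simplices turn out to give; in contrast to
  \<open>euler_char\<close> it involves no partition.\<close>

definition chi :: "'a::euclidean_space set \<Rightarrow> int" where
  "chi A = eucl_integral (DIM('a)) (\<lambda>y. of_bool (vec_of y \<in> A))"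

lemma chi_bij:
  fixes A :: "'a::euclidean_space set" and B :: "'b::euclidean_space set"
  assumes f: "bij_betw f A B"
    and def: "def_pred (\<lambda>e. vec_of e \<in> A \<and> vec_of (\<lambda>i. e (i + DIM('a))) = f (vec_of e))"
  shows "chi A = chi B"
  unfolding chi_def
proof (rule eucl_integral_rel[where R = "\<lambda>x y. vec_of x \<in> A \<and> vec_of y = f (vec_of x)"])
  show "def_pred (\<lambda>e. vec_of (trunc (DIM('a)) e) \<in> A \<and>
      vec_of (trunc (DIM('b)) (\<lambda>i. e (i + DIM('a)))) = f (vec_of (trunc (DIM('a)) e)))"
    using def by simp
  show "\<exists>c\<in>eucl DIM('b). \<forall>y\<in>eucl DIM('b). vec_of x \<in> A \<and> vec_of y = f (vec_of x) \<longleftrightarrow> y = c"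
    if "vec_of x \<in> A" for x
    using that by (intro bexI[of _ "coords (f (vec_of x))"]) (auto simp: vec_of_eq_iff)
  show "\<exists>c\<in>eucl DIM('a). \<forall>x\<in>eucl DIM('a). vec_of x \<in> A \<and> vec_of y = f (vec_of x) \<longleftrightarrow> x = c"
    if "vec_of y \<in> B" for y
  proof -
    have "vec_of y \<in> f ` A" using that f by (simp add: bij_betw_def)
    then obtain a where a: "a \<in> A" "f a = vec_of y" by auto
    have "vec_of x \<in> A \<and> vec_of y = f (vec_of x) \<longleftrightarrow> vec_of x = a" for x
      using a inj_onD[OF bij_betw_imp_inj_on[OF f], of "vec_of x" a] by auto
    then show ?thesis by (intro bexI[of _ "coords a"]) (auto simp: vec_of_eq_iff)
  qed
  show "vec_of y \<in> B" if "vec_of x \<in> A \<and> vec_of y = f (vec_of x)" for x y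
    using that f by (auto simp: bij_betw_def)
qed blast

text \<open>Barycentric coordinates with the weight of the last vertex eliminated. Positivity of all
  weights characterizes the relative interior, and affine independence of the vertices gives
  injectivity.\<close>

lemma simplex_barycentric:
  assumes "int d simplex (T :: 'a::euclidean_space set)"
  obtains c where "rel_interior T = (\<lambda>u. (\<Sum>i<d. u i *\<^sub>R c i) + (1 - (\<Sum>i<d. u i)) *\<^sub>R c d) ` std_simplex d"
    "inj_on (\<lambda>u. (\<Sum>i<d. u i *\<^sub>R c i) + (1 - (\<Sum>i<d. u i)) *\<^sub>R c d) (std_simplex d)"
proof -
  obtain C where C: "\<not> affine_dependent C" "int (card C) = int d + 1" "T = convex hull C"
    using assms unfolding simplex_def by blast
  have fin: "finite C" using C(1) by (rule aff_independent_finite)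
  have card: "card C = Suc d" using C(2) by linarith
  obtain c where "bij_betw c {0..<card C} C" using ex_bij_betw_nat_finite[OF fin] by blast
  then have c: "bij_betw c {..<Suc d} C" by (simp add: card atLeast0LessThan)
  have sum_C: "(\<Sum>x\<in>C. F x) = (\<Sum>i<d. F (c i)) + F (c d)" for F :: "'a \<Rightarrow> 'b::comm_monoid_add"
    using sum.reindex_bij_betw[OF c, of F] by simp
  define g where "g u = (\<Sum>i<d. u i *\<^sub>R c i) + (1 - (\<Sum>i<d. u i)) *\<^sub>R c d" for u :: "nat \<Rightarrow> real"
  define ci where "ci = the_inv_into {..<Suc d} c"
  have ci: "ci (c i) = i" if "i < Suc d" for i
    unfolding ci_def using the_inv_into_f_f[OF bij_betw_imp_inj_on[OF c]] that by simp
  have cC: "c i \<in> C" if "i < Suc d" for i using c that by (auto simp: bij_betw_def)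
  have Cc: "\<exists>i<Suc d. x = c i" if "x \<in> C" for x using c that by (auto simp: bij_betw_def)
  have ri: "rel_interior T = {y. \<exists>w. (\<forall>x\<in>C. 0 < w x) \<and> sum w C = 1 \<and> (\<Sum>x\<in>C. w x *\<^sub>R x) = y}"
    unfolding C(3) by (rule rel_interior_convex_hull_explicit[OF C(1)])
  have "rel_interior T = g ` std_simplex d"
  proof safe
    fix y assume "y \<in> rel_interior T"
    then obtain w where w: "\<forall>x\<in>C. 0 < w x" "sum w C = 1" "(\<Sum>x\<in>C. w x *\<^sub>R x) = y" unfolding ri by blast
    define u where "u = trunc d (\<lambda>i. w (c i))"
    have us: "(\<Sum>i<d. u i) = (\<Sum>i<d. w (c i))" "(\<Sum>i<d. u i *\<^sub>R c i) = (\<Sum>i<d. w (c i) *\<^sub>R c i)"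
      by (auto simp: u_def trunc_def)
    have wd: "w (c d) = 1 - (\<Sum>i<d. u i)" using w(2) sum_C[of w] us(1) by simp
    have "0 < w (c d)" using w(1) cC[of d] by simp
    then have "u \<in> std_simplex d"
      using wd w(1) cC by (auto simp: std_simplex_def u_def trunc_apply)
    moreover have "g u = y" using w(3) sum_C[of "\<lambda>x. w x *\<^sub>R x"] us(2) wd by (simp add: g_def)
    ultimately show "y \<in> g ` std_simplex d" by blast
  next
    fix u assume u: "u \<in> std_simplex d"
    define w where "w x = (if ci x < d then u (ci x) else 1 - (\<Sum>i<d. u i))" for x
    have wc: "w (c i) = u i" if "i < d" for i using ci[of i] that by (simp add: w_def)
    have wd: "w (c d) = 1 - (\<Sum>i<d. u i)" using ci[of d] by (simp add: w_def)
    have "\<forall>x\<in>C. 0 < w x"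
    proof
      fix x assume "x \<in> C"
      then obtain i where "i < Suc d" "x = c i" using Cc by blast
      then show "0 < w x" using wc[of i] wd u by (cases "i = d") (auto simp: std_simplex_def)
    qed
    moreover have "sum w C = 1" unfolding sum_C wd using wc by simp
    moreover have "(\<Sum>x\<in>C. w x *\<^sub>R x) = g u" unfolding sum_C wd g_def using wc by simp
    ultimately show "g u \<in> rel_interior T" unfolding ri by blast
  qed
  moreover have "inj_on g (std_simplex d)"
  proof (rule inj_onI)
    fix u v assume uv: "u \<in> std_simplex d" "v \<in> std_simplex d" "g u = g v"
    define w where "w x = (if ci x < d then u (ci x) - v (ci x) else (\<Sum>i<d. v i) - (\<Sum>i<d. u i))" for x
    have wc: "w (c i) = u i - v i" if "i < d" for i using ci[of i] that by (simp add: w_def)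
    have wd: "w (c d) = (\<Sum>i<d. v i) - (\<Sum>i<d. u i)" using ci[of d] by (simp add: w_def)
    have "sum w C = 0" unfolding sum_C wd using wc by (simp add: sum_subtractf)
    moreover have "(\<Sum>x\<in>C. w x *\<^sub>R x) = 0"
    proof -
      have "(\<Sum>x\<in>C. w x *\<^sub>R x) = g u - g v"
        unfolding sum_C wd g_def using wc by (simp add: scaleR_left_diff_distrib sum_subtractf)
      then show ?thesis using uv(3) by simp
    qed
    ultimately have "\<forall>x\<in>C. w x = 0"
      using C(1) affine_dependent_explicit_finite[OF fin] by blast
    then have "u i = v i" if "i < d" for i using wc[OF that] cC[of i] that by simp
    then show "u = v" using uv(1,2) std_simplex_subset[of d] by (intro eucl_eqI[of u d v]) auto
  qed
  ultimately show thesis using that[of c] unfolding g_def by blast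
qed

text \<open>The barycentric parametrization is affine, hence definable, so the value computed for
  the standard simplex carries over.\<close>

lemma rel_interior_simplex:
  assumes T: "int d simplex (T :: 'a::euclidean_space set)"
  shows "definable S (rel_interior T)" "chi (rel_interior T) = (- 1) ^ d"
proof -
  obtain c where c: "rel_interior T = (\<lambda>u. (\<Sum>i<d. u i *\<^sub>R c i) + (1 - (\<Sum>i<d. u i)) *\<^sub>R c d) ` std_simplex d"
    "inj_on (\<lambda>u. (\<Sum>i<d. u i *\<^sub>R c i) + (1 - (\<Sum>i<d. u i)) *\<^sub>R c d) (std_simplex d)"
    by (rule simplex_barycentric[OF T])
  define g where "g u = (\<Sum>i<d. u i *\<^sub>R c i) + (1 - (\<Sum>i<d. u i)) *\<^sub>R c d" for u :: "nat \<Rightarrow> real"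
  have g: "rel_interior T = g ` std_simplex d" "inj_on g (std_simplex d)" using c unfolding g_def by blast+
  have gd: "def_vec (\<lambda>e. g (Y e))" if "\<And>i. def_fun (\<lambda>e. Y e i)" for Y
    unfolding def_vec_def g_def inner_add_left inner_sum_left inner_scaleR_left
    by (intro allI dintros that)
  have "def_pred (\<lambda>e. trunc d e \<in> std_simplex d \<and> vec_of (\<lambda>i. e (i + d)) = g (trunc d e))"
    by (intro def_pred_conj def_pred_vec_eq gd def_vec_vec_of def_fun_var
        def_fun_trunc[of d "\<lambda>i. i"] def_pred_trunc_mem[OF def_set_std_simplex, of d "\<lambda>i. i"])
  from def_pred_ex_vec[of "\<lambda>e u. u \<in> std_simplex d \<and> vec_of e = g u", OF this]
  have "def_pred (\<lambda>e. \<exists>u\<in>eucl d. u \<in> std_simplex d \<and> vec_of e = g u)" .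
  moreover have "vec_of e \<in> rel_interior T \<longleftrightarrow> (\<exists>u\<in>eucl d. u \<in> std_simplex d \<and> vec_of e = g u)" for e
    unfolding g(1) using std_simplex_subset[of d] by blast
  ultimately show "definable S (rel_interior T)" by (simp add: definable_iff_def_pred)
  have "eucl_integral d (\<lambda>u. of_bool (u \<in> std_simplex d)) = chi (rel_interior T)"
    unfolding chi_def
  proof (rule eucl_integral_rel[where R = "\<lambda>u y. u \<in> std_simplex d \<and> vec_of y = g u"])
    show "def_pred (\<lambda>e. trunc d e \<in> std_simplex d \<and> vec_of (trunc DIM('a) (\<lambda>i. e (i + d))) = g (trunc d e))"
      by (intro dintros def_pred_trunc_mem[OF def_set_std_simplex, of d "\<lambda>i. i"] gd
          def_fun_trunc[of d "\<lambda>i. i"])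
    show "\<exists>c\<in>eucl DIM('a). \<forall>y\<in>eucl DIM('a). u \<in> std_simplex d \<and> vec_of y = g u \<longleftrightarrow> y = c"
      if "u \<in> std_simplex d" for u
      using that by (intro bexI[of _ "coords (g u)"]) (auto simp: vec_of_eq_iff)
    show "\<exists>c\<in>eucl d. \<forall>u\<in>eucl d. u \<in> std_simplex d \<and> vec_of y = g u \<longleftrightarrow> u = c"
      if "vec_of y \<in> rel_interior T" for y
    proof -
      obtain u0 where u0: "u0 \<in> std_simplex d" "vec_of y = g u0" using \<open>vec_of y \<in> _\<close> g(1) by blast
      have "u \<in> std_simplex d \<and> vec_of y = g u \<longleftrightarrow> u = u0" for u
        using u0 g(2) by (metis inj_onD)
      then show ?thesis using u0(1) std_simplex_subset[of d] by blast
    qed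
    show "vec_of y \<in> rel_interior T" if "u \<in> std_simplex d \<and> vec_of y = g u" for u y
      using that g(1) by blast
  qed blast
  then show "chi (rel_interior T) = (- 1) ^ d" by (simp add: eucl_integral_std_simplex)
qed

lemma definable_open_simplex_chi:
  assumes "definable_open_simplex S d (\<sigma> :: 'a::euclidean_space set)"
  shows "definable S \<sigma>" "chi \<sigma> = (- 1) ^ d" "\<sigma> \<noteq> {}"
proof -
  obtain T f g where T: "int d simplex (T :: 'a set)" and h: "homeomorphism (rel_interior T) \<sigma> f g"
    and G: "definable S {(x, f x) | x. x \<in> rel_interior T}"
    using assms unfolding definable_open_simplex_def by blast
  note ri = rel_interior_simplex[OF T]
  have graph: "(x, y) \<in> {(x, f x) | x. x \<in> rel_interior T} \<longleftrightarrow> x \<in> rel_interior T \<and> y = f x" for x y by auto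
  have \<sigma>: "\<sigma> = f ` rel_interior T" using h by (simp add: homeomorphism_def)
  have "def_pred (\<lambda>e. \<exists>u\<in>eucl DIM('a). (vec_of u, vec_of e) \<in> {(x, f x) | x. x \<in> rel_interior T})"
    by (intro dintros definable_mem[OF G])
  moreover have "vec_of e \<in> \<sigma> \<longleftrightarrow> (\<exists>u\<in>eucl DIM('a). (vec_of u, vec_of e) \<in> {(x, f x) | x. x \<in> rel_interior T})" for e
  proof
    assume "vec_of e \<in> \<sigma>"
    then obtain x where "x \<in> rel_interior T" "vec_of e = f x" unfolding \<sigma> by blast
    then show "\<exists>u\<in>eucl DIM('a). (vec_of u, vec_of e) \<in> {(x, f x) | x. x \<in> rel_interior T}"
      by (intro bexI[of _ "coords x"]) auto
  qed (auto simp: \<sigma>)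
  ultimately show "definable S \<sigma>" by (simp only: definable_iff_def_pred)
  have "chi (rel_interior T) = chi \<sigma>"
  proof (rule chi_bij)
    show "bij_betw f (rel_interior T) \<sigma>"
      using h unfolding homeomorphism_def by (intro bij_betw_imageI inj_on_inverseI[of _ g]) auto
    have "def_pred (\<lambda>e. (vec_of e, vec_of (\<lambda>i. e (i + DIM('a)))) \<in> {(x, f x) | x. x \<in> rel_interior T})"
      by (intro definable_mem[OF G] dintros)
    then show "def_pred (\<lambda>e. vec_of e \<in> rel_interior T \<and> vec_of (\<lambda>i. e (i + DIM('a))) = f (vec_of e))"
      unfolding graph .
  qed
  then show "chi \<sigma> = (- 1) ^ d" using ri(2) by simp
  \<comment> \<open>The empty set has value 0, which is not a power of -1; this proves
    nonemptiness.\<close>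
  have "chi (rel_interior T) \<noteq> 0" unfolding ri(2) by simp
  then have "rel_interior T \<noteq> {}" by (auto simp: chi_def eucl_integral_zero)
  then show "\<sigma> \<noteq> {}" unfolding \<sigma> by simp
qed

section \<open>Well-definedness of the Euler characteristic\<close>

lemma chi_partition:
  fixes A :: "'a::euclidean_space set"
  assumes "finite P" "partition_on A P" "\<And>\<sigma>. \<sigma> \<in> P \<Longrightarrow> definable S \<sigma>"
  shows "chi A = (\<Sum>\<sigma>\<in>P. chi \<sigma>)"
proof -
  have P: "\<Union>P = A" "disjoint P" using assms(2) by (auto simp: partition_on_def)
  have "(of_bool (x \<in> A) :: int) = (\<Sum>\<sigma>\<in>P. of_bool (x \<in> \<sigma>))" for x
    using of_bool_Union[OF assms(1) P(2), of x True] by (simp add: P(1))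
  then have "chi A = eucl_integral DIM('a) (\<lambda>y. \<Sum>\<sigma>\<in>P. of_bool (vec_of y \<in> \<sigma>))"
    by (simp add: chi_def)
  also have "\<dots> = (\<Sum>\<sigma>\<in>P. chi \<sigma>)"
    unfolding chi_def
    by (rule eucl_integral_sum)
      (use assms(3) in \<open>auto intro!: def_int_of_bool definable_mem dintros def_fun_trunc[of _ "\<lambda>i. i", simplified] simp del: vec_of_trunc\<close>)
  finally show ?thesis .
qed

text \<open>The definition of an open simplex wants its source in the same Euclidean space. As
  \<open>d \<le> DIM('a)\<close>, the standard simplex can be placed there as the hull of 0 and the
  first \<open>d\<close> basis vectors.\<close>

lemma cell_definable_open_simplex:
  fixes d :: nat
  assumes "cell DIM('a::euclidean_space) d C"
  shows "definable_open_simplex S d (vec_of ` C :: 'a set)"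
proof -
  obtain \<phi> \<psi> where *: "d \<le> DIM('a)" "C \<subseteq> eucl DIM('a)" "homeomorphism (std_simplex d) C \<phi> \<psi>"
    "\<And>i. def_fun (\<lambda>e. \<phi> (trunc d e) i)" using assms unfolding cell_def by blast
  have h: "continuous_on (std_simplex d) \<phi>" "continuous_on C \<psi>" "\<phi> ` std_simplex d = C"
    "\<psi> ` C = std_simplex d" "\<forall>u\<in>std_simplex d. \<psi> (\<phi> u) = u" "\<forall>x\<in>C. \<phi> (\<psi> x) = x"
    using *(3) by (auto simp: homeomorphism_def)
  let ?bs = "basis_list :: 'a list"
  define D where "D = (!) ?bs ` {..<d}"
  have D: "D \<subseteq> Basis" unfolding D_def using *(1) nth_basis_list[where 'a = 'a] by auto
  have inj: "inj_on ((!) ?bs) {..<d}"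
    using *(1) by (intro inj_onI) (simp add: nth_eq_iff_index_eq basis_list length_basis_list)
  have cardD: "card D = d" unfolding D_def using card_image[OF inj] by simp
  define T where "T = convex hull (insert 0 D)"
  have "0 \<notin> D" using D nonzero_Basis by blast
  moreover have "independent D" using D independent_Basis independent_mono by blast
  ultimately have "\<not> affine_dependent (insert 0 D)" by (simp add: affine_dependent_iff_dependent)
  moreover have "int (card (insert 0 D)) = int d + 1"
    using \<open>0 \<notin> D\<close> cardD finite_subset[OF D finite_Basis] by simp
  ultimately have T: "int d simplex T" unfolding simplex_def T_def by blast
  have sub: "std_simplex d \<subseteq> eucl DIM('a)" using *(1) std_simplex_subset[of d] by (force simp: eucl_def)
  have ri: "rel_interior T = {x. (\<forall>i\<in>D. 0 < x \<bullet> i) \<and> (\<Sum>i\<in>D. x \<bullet> i) < 1 \<and> (\<forall>i\<in>Basis. i \<notin> D \<longrightarrow> x \<bullet> i = 0)}"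
    unfolding T_def by (rule rel_interior_substd_simplex[OF D])
  have ri_iff: "x \<in> rel_interior T \<longleftrightarrow> coords x \<in> std_simplex d" for x :: 'a
  proof -
    have co: "coords x i = x \<bullet> ?bs ! i" if "i < d" for i using that *(1) by (simp add: coords_def)
    have sumD: "(\<Sum>b\<in>D. x \<bullet> b) = (\<Sum>i<d. coords x i)"
      unfolding D_def sum.reindex[OF inj] using co by simp
    have "(\<forall>b\<in>D. 0 < x \<bullet> b) \<longleftrightarrow> (\<forall>i<d. 0 < coords x i)" unfolding D_def using co by auto
    moreover have "(\<forall>b\<in>Basis. b \<notin> D \<longrightarrow> x \<bullet> b = 0) \<longleftrightarrow> coords x \<in> eucl d"
    proof
      assume L: "\<forall>b\<in>Basis. b \<notin> D \<longrightarrow> x \<bullet> b = 0"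
      have "coords x i = 0" if "d \<le> i" for i
      proof (cases "i < DIM('a)")
        case True
        have "?bs ! i \<notin> D"
          unfolding D_def using that True *(1) by (auto simp: nth_eq_iff_index_eq basis_list length_basis_list)
        then show ?thesis using L nth_basis_list[OF True] True by (simp add: coords_def)
      qed (simp add: coords_def)
      then show "coords x \<in> eucl d" by (simp add: eucl_def)
    next
      assume R: "coords x \<in> eucl d"
      show "\<forall>b\<in>Basis. b \<notin> D \<longrightarrow> x \<bullet> b = 0"
      proof (intro ballI impI)
        fix b :: 'a assume b: "b \<in> Basis" "b \<notin> D"
        then obtain i where i: "i < DIM('a)" "b = ?bs ! i"
          using basis_list(2)[where 'a = 'a] length_basis_list[where 'a = 'a] by (metis in_set_conv_nth)
        then have "d \<le> i" using b(2) unfolding D_def by (meson imageI lessThan_iff not_le)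
        then have "coords x i = 0" using R by (simp add: eucl_def)
        then show "x \<bullet> b = 0" using i by (simp add: coords_def)
      qed
    qed
    ultimately show ?thesis unfolding ri mem_Collect_eq sumD by (auto simp: std_simplex_def)
  qed
  have C_co: "coords (vec_of x :: 'a) = x" if "x \<in> C" for x using coords_vec_of_eucl[where 'a = 'a] that *(2) by blast
  have S_co: "coords (vec_of u :: 'a) = u" if "u \<in> std_simplex d" for u
    using coords_vec_of_eucl[where 'a = 'a] that sub by blast
  let ?f = "\<lambda>x::'a. vec_of (\<phi> (coords x)) :: 'a" and ?g = "\<lambda>y::'a. vec_of (\<psi> (coords y)) :: 'a"
  have "homeomorphism (rel_interior T) (vec_of ` C) ?f ?g"
  proof (rule homeomorphismI)
    show "continuous_on (rel_interior T) ?f"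
      by (intro continuous_on_vec_of continuous_on_compose2[OF h(1) continuous_on_coords])
        (auto simp: ri_iff)
    show "continuous_on (vec_of ` C) ?g"
      by (intro continuous_on_vec_of continuous_on_compose2[OF h(2) continuous_on_coords])
        (auto simp: C_co)
    show "?f ` rel_interior T \<subseteq> vec_of ` C" using h(3) by (auto simp: ri_iff)
    show "?g ` (vec_of ` C) \<subseteq> rel_interior T"
    proof safe
      fix x assume x: "x \<in> C"
      then have "\<psi> x \<in> std_simplex d" using h(4) by blast
      then show "?g (vec_of x) \<in> rel_interior T" using x by (simp add: ri_iff C_co S_co)
    qed
    show "?g (?f x) = x" if "x \<in> rel_interior T" for x
    proof -
      have x: "coords x \<in> std_simplex d" using that by (simp add: ri_iff)
      then have "\<phi> (coords x) \<in> C" using h(3) by blast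
      then show ?thesis using x h(5) by (simp add: C_co)
    qed
    show "?f (?g y) = y" if "y \<in> vec_of ` C" for y
    proof -
      obtain x where x: "x \<in> C" "y = vec_of x" using \<open>y \<in> _\<close> by blast
      then have "\<psi> x \<in> std_simplex d" using h(4) by blast
      then show ?thesis using x h(6) by (simp add: C_co S_co)
    qed
  qed
  moreover have "definable S {(x, ?f x) | x. x \<in> rel_interior T}"
  proof -
    \<comment> \<open>\<open>trunc d\<close> changes nothing on the simplex and brings the map into
      the form in which \<open>\<phi>\<close> is known to be definable.\<close>
    have "def_pred (\<lambda>e. fst (vec_of e :: 'a \<times> 'a) \<in> rel_interior T \<and>
        snd (vec_of e :: 'a \<times> 'a) = vec_of (\<phi> (trunc d (coords (fst (vec_of e :: 'a \<times> 'a))))))"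
    proof (intro dintros definable_mem[OF rel_interior_simplex(1)[OF T]])
      fix i
      have "def_fun (\<lambda>e. coords (fst (vec_of e :: 'a \<times> 'a)) j)" for j by (intro dintros)
      from def_fun_comp[where T = "\<lambda>j e. coords (fst (vec_of e :: 'a \<times> 'a)) j", OF *(4)[of i] this]
      show "def_fun (\<lambda>e. \<phi> (trunc d (coords (fst (vec_of e :: 'a \<times> 'a)))) i)" .
    qed
    moreover have "(z \<in> {(x, ?f x) | x. x \<in> rel_interior T}) \<longleftrightarrow>
        fst z \<in> rel_interior T \<and> snd z = vec_of (\<phi> (trunc d (coords (fst z))))" for z
    proof -
      have "trunc d (coords x) = coords x" if "x \<in> rel_interior T" for x
        using that std_simplex_subset[of d] by (auto simp: ri_iff)
      then show ?thesis by (cases z) auto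
    qed
    ultimately show ?thesis by (simp only: definable_iff_def_pred)
  qed
  ultimately show ?thesis unfolding definable_open_simplex_def using T by blast
qed

text \<open>Cells provide one admissible partition, so the description has a candidate; every
  admissible partition computes \<open>chi A\<close>, so the candidate is unique.\<close>

theorem euler_char_eq_chi:
  fixes A :: "'a::euclidean_space set"
  assumes "definable S A" shows "euler_char S A = chi A"
  unfolding euler_char_def
proof (rule the_equality)
  define B where "B = {y \<in> eucl DIM('a). vec_of y \<in> A}"
  have "def_set DIM('a) B"
    unfolding B_def by (rule def_setI) (use assms in \<open>simp add: definable_iff_def_pred\<close>)
  from cell_decomposition[OF this] obtain \<C> where \<C>0: "finite \<C>" "disjoint \<C>" "\<Union>\<C> = B"
    "\<forall>C\<in>\<C>. \<exists>d. cell DIM('a) d C" unfolding decomposable_def by blast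
  note \<C> = \<C>0[unfolded B_def]
  let ?v = "vec_of :: (nat \<Rightarrow> real) \<Rightarrow> 'a"
  define P where "P = (`) ?v ` \<C>"
  have "\<exists>d. definable_open_simplex S d \<sigma>" if "\<sigma> \<in> P" for \<sigma>
    using that \<C>(4) cell_definable_open_simplex[where 'a = 'a] unfolding P_def by blast
  then obtain d where d: "\<And>\<sigma>. \<sigma> \<in> P \<Longrightarrow> definable_open_simplex S (d \<sigma>) \<sigma>" by metis
  have finP: "finite P" using \<C>(1) by (simp add: P_def)
  have part: "partition_on A P"
    unfolding partition_on_def
  proof (intro conjI)
    have "inj_on ?v (eucl DIM('a))" by (intro inj_on_inverseI[of _ coords]) (rule coords_vec_of_eucl)
    then have "inj_on ?v (\<Union>\<C>)" unfolding \<C>(3) by (rule inj_on_subset) blast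
    from disjoint_image[OF this \<C>(2)] show "disjoint P" unfolding P_def .
    have "\<Union>P = ?v ` \<Union>\<C>" unfolding P_def by blast
    also have "\<dots> = A"
    proof safe
      fix x assume "x \<in> A"
      then show "x \<in> ?v ` \<Union>\<C>" unfolding \<C>(3) by (intro image_eqI[of _ _ "coords x"]) auto
    qed (use \<C>(3) in blast)
    finally show "\<Union>P = A" .
    show "{} \<notin> P" using d definable_open_simplex_chi(3) by blast
  qed
  have "chi A = (\<Sum>\<sigma>\<in>P. chi \<sigma>)" using chi_partition[OF finP part] d definable_open_simplex_chi(1) by blast
  also have "\<dots> = (\<Sum>\<sigma>\<in>P. (- 1) ^ d \<sigma>)" by (rule sum.cong[OF refl]) (use d definable_open_simplex_chi(2) in blast)
  finally show "\<exists>P d. finite P \<and> partition_on A P \<and> (\<forall>\<sigma>\<in>P. definable_open_simplex S (d \<sigma>) \<sigma>) \<and>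
      chi A = (\<Sum>\<sigma>\<in>P. (- 1) ^ d \<sigma>)"
    using finP part d by blast
next
  fix k :: int assume "\<exists>P d. finite P \<and> partition_on A P \<and> (\<forall>\<sigma>\<in>P. definable_open_simplex S (d \<sigma>) \<sigma>) \<and>
      k = (\<Sum>\<sigma>\<in>P. (- 1) ^ d \<sigma>)"
  then obtain P d where P: "finite P" "partition_on A P" "\<forall>\<sigma>\<in>P. definable_open_simplex S (d \<sigma>) \<sigma>"
    "k = (\<Sum>\<sigma>\<in>P. (- 1) ^ d \<sigma>)" by blast
  have "chi A = (\<Sum>\<sigma>\<in>P. chi \<sigma>)" using chi_partition[OF P(1,2)] P(3) definable_open_simplex_chi(1) by blast
  also have "\<dots> = k"
    unfolding P(4) by (rule sum.cong[OF refl]) (use P(3) definable_open_simplex_chi(2) in blast)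
  finally show "k = chi A" by simp
qed

text \<open>The indicator of \<open>X\<close> removes the values of \<open>h\<close> outside
  \<open>X\<close>, on which nothing is assumed.\<close>

theorem euler_integral_eq:
  fixes X :: "'a::euclidean_space set"
  assumes "euler_integrable S X h"
  shows "euler_integral S X h = eucl_integral DIM('a) (\<lambda>y. of_bool (vec_of y \<in> X) * h (vec_of y))"
proof -
  have fin: "finite (h ` X)" and def: "\<And>c. definable S {x \<in> X. h x = c}"
    using assms by (auto simp: euler_integrable_def)
  have "of_bool (x \<in> X) * h x = (\<Sum>c\<in>h ` X. c * of_bool (x \<in> {x \<in> X. h x = c}))" for x
  proof (cases "x \<in> X")
    case True
    then have "(\<Sum>c\<in>h ` X. c * of_bool (x \<in> {x \<in> X. h x = c})) = (\<Sum>c\<in>h ` X. if c = h x then c else 0)"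
      by (intro sum.cong) auto
    then show ?thesis using True fin by (simp add: sum.delta)
  qed simp
  then have "eucl_integral DIM('a) (\<lambda>y. of_bool (vec_of y \<in> X) * h (vec_of y)) =
      eucl_integral DIM('a) (\<lambda>y. \<Sum>c\<in>h ` X. c * of_bool (vec_of y \<in> {x \<in> X. h x = c}))"
    by (simp only:)
  also have "\<dots> = (\<Sum>c\<in>h ` X. eucl_integral DIM('a) (\<lambda>y. c * of_bool (vec_of y \<in> {x \<in> X. h x = c})))"
    by (rule eucl_integral_sum)
      (intro def_int_mult def_int_const def_int_of_bool definable_mem[OF def] def_vec_vec_of
        def_fun_trunc[of _ "\<lambda>i. i"])
  also have "\<dots> = (\<Sum>c\<in>h ` X. c * chi {x \<in> X. h x = c})"
    unfolding chi_def
    by (intro sum.cong refl eucl_integral_cmult)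
      (intro def_int_of_bool definable_mem[OF def] def_vec_vec_of def_fun_trunc[of _ "\<lambda>i. i"])
  also have "\<dots> = euler_integral S X h"
    unfolding euler_integral_def using euler_char_eq_chi[OF def] by simp
  finally show ?thesis by simp
qed

end

section \<open>Inversion of the Radon transform\<close>

context o_minimal_field_expansion
begin

text \<open>Slicing by the first coordinate: over the open interval between the two square roots of
  \<open>r\<close> lie spheres of one dimension less, over its ends single points, in total
  \<open>- ?s + 2\<close>. In dimension 0 a sphere of positive radius is empty, in accordance with
  \<open>1 - (- 1) ^ 0 = 0\<close>.\<close>

lemma eucl_integral_sphere:
  "eucl_integral m (\<lambda>x. of_bool ((\<Sum>i<m. (x i)\<^sup>2) = r)) =
    (if r < 0 then 0 else if r = 0 then 1 else 1 - (- 1) ^ m)"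
proof (induction m arbitrary: r)
  case (Suc m)
  let ?s = "1 - (- 1) ^ m :: int"
  have inner: "eucl_integral m (\<lambda>x. of_bool ((\<Sum>i<Suc m. ((a ## x) i)\<^sup>2) = r)) =
      (if r - a\<^sup>2 < 0 then 0 else if r - a\<^sup>2 = 0 then 1 else ?s)" for a
  proof -
    have "(\<Sum>i<Suc m. ((a ## x) i)\<^sup>2) = r \<longleftrightarrow> (\<Sum>i<m. (x i)\<^sup>2) = r - a\<^sup>2" for x
      by (auto simp: sum.lessThan_Suc_shift simp del: sum.lessThan_Suc)
    then show ?thesis using Suc.IH[of "r - a\<^sup>2"] by simp
  qed
  consider "r < 0" | "r = 0" | "0 < r" by linarith
  then show ?case
  proof cases
    case 1
    then have "r - a\<^sup>2 < 0" for a using zero_le_power2[of a] by linarith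
    then show ?thesis using 1 line_integral_const[of 0] inner by simp
  next
    case 2
    have "(if r - a\<^sup>2 < 0 then 0 else if r - a\<^sup>2 = 0 then 1 else ?s) = of_bool (a = 0)" for a
      using 2 by (cases "a = 0") (auto simp: not_less)
    then show ?thesis using 2 line_integral_point[of 0] inner by simp
  next
    case 3
    define q where "q = sqrt r"
    have q: "0 < q" "r = q\<^sup>2" using 3 by (auto simp: q_def)
    have I: "open {- q<..<q}" "is_interval {- q<..<q}" "{- q<..<q} \<noteq> {}"
      using q(1) by (auto simp: is_interval_1)
    have val: "(if r - a\<^sup>2 < 0 then 0 else if r - a\<^sup>2 = 0 then 1 else ?s) =
        ?s * of_bool (a \<in> {- q<..<q}) + (of_bool (a = q) + of_bool (a = - q))" for a
    proof -
      have "r - a\<^sup>2 = (q - a) * (q + a)" using q(2) by (simp add: power2_eq_square algebra_simps)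
      then show ?thesis
        using q(1) by (cases "a = q"; cases "a = - q"; cases "a \<in> {- q<..<q}")
          (auto simp: mult_less_0_iff zero_less_mult_iff)
    qed
    have t: "tame (\<lambda>a. of_bool (a = p))" for p :: real
      by (rule def_int_tame) (intro dintros)
    have t1: "tame (\<lambda>a. ?s * of_bool (a \<in> {- q<..<q}))"
      by (rule def_int_tame) (unfold greaterThanLessThan_iff, intro dintros)
    have t2: "tame (\<lambda>a. of_bool (a = q) + of_bool (a = - q))"
      by (rule def_int_tame) (intro dintros)
    have "line_integral (\<lambda>a. ?s * of_bool (a \<in> {- q<..<q}) + (of_bool (a = q) + of_bool (a = - q))) =
        - ?s + (1 + 1)"
      unfolding line_integral_add[OF t1 t2] line_integral_add[OF t t]
        line_integral_cmult[OF tame_indicator_interval[OF I(2)]]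
        line_integral_open_interval[OF I] line_integral_point by simp
    then show ?thesis using 3 inner val by simp
  qed
qed simp

text \<open>Over the open interval (-1, 0) and over the point 0 lie spheres with the same value
  \<open>?s\<close>. They enter with opposite signs and cancel, and the pole over -1 is
  left.\<close>

lemma eucl_integral_hemisphere:
  "eucl_integral (Suc m) (\<lambda>x. of_bool ((\<Sum>i<Suc m. (x i)\<^sup>2) = 1 \<and> x 0 \<le> 0)) = 1"
proof -
  let ?s = "1 - (- 1) ^ m :: int"
  have I: "open {- 1<..<0::real}" "is_interval {- 1<..<0::real}" "{- 1<..<0::real} \<noteq> {}"
    by (auto simp: is_interval_1)
  have inner: "eucl_integral m (\<lambda>x. of_bool ((\<Sum>i<Suc m. ((a ## x) i)\<^sup>2) = 1 \<and> (a ## x) 0 \<le> 0)) =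
      ?s * (of_bool (a \<in> {- 1<..<0}) + of_bool (a = 0)) + of_bool (a = - 1)" for a
  proof (cases "a \<le> 0")
    case True
    have "(\<Sum>i<Suc m. ((a ## x) i)\<^sup>2) = 1 \<and> (a ## x) 0 \<le> 0 \<longleftrightarrow> (\<Sum>i<m. (x i)\<^sup>2) = 1 - a\<^sup>2" for x
      using True by (auto simp: sum.lessThan_Suc_shift simp del: sum.lessThan_Suc)
    then have "eucl_integral m (\<lambda>x. of_bool ((\<Sum>i<Suc m. ((a ## x) i)\<^sup>2) = 1 \<and> (a ## x) 0 \<le> 0)) =
        (if 1 - a\<^sup>2 < 0 then 0 else if 1 - a\<^sup>2 = 0 then 1 else ?s)"
      using eucl_integral_sphere[of m "1 - a\<^sup>2"] by simp
    moreover have "1 - a\<^sup>2 = (1 - a) * (1 + a)" by (simp add: power2_eq_square algebra_simps)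
    ultimately show ?thesis
      using True by (cases "a = 0"; cases "a = - 1"; cases "a \<in> {- 1<..<0}")
        (auto simp: mult_less_0_iff zero_less_mult_iff)
  next
    case False
    then show ?thesis by (simp add: eucl_integral_zero)
  qed
  have t: "tame (\<lambda>a. of_bool (a = p))" for p :: real
    by (rule def_int_tame) (intro dintros)
  have t1: "tame (\<lambda>a. of_bool (a \<in> {- 1<..<0}) + of_bool (a = 0))"
    by (rule def_int_tame) (unfold greaterThanLessThan_iff, intro dintros)
  have t2: "tame (\<lambda>a. ?s * (of_bool (a \<in> {- 1<..<0}) + of_bool (a = 0)))"
    by (rule def_int_tame) (unfold greaterThanLessThan_iff, intro dintros)
  have "line_integral (\<lambda>a. ?s * (of_bool (a \<in> {- 1<..<0}) + of_bool (a = 0)) + of_bool (a = - 1)) = 1"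
    unfolding line_integral_add[OF t2 t] line_integral_cmult[OF t1]
      line_integral_add[OF tame_indicator_interval[OF I(2)] t] line_integral_open_interval[OF I]
      line_integral_point by simp
  then show ?thesis using inner by simp
qed

section \<open>Euler characteristics of the sphere and of hemispheres\<close>

lemma inner_vec_of_self: "(vec_of u :: 'a::euclidean_space) \<bullet> vec_of u = (\<Sum>i<DIM('a). (u i)\<^sup>2)"
proof -
  have "(vec_of u :: 'a) \<bullet> vec_of u = (\<Sum>i<DIM('a). u i * ((vec_of u :: 'a) \<bullet> basis_list ! i))"
    by (subst (2) vec_of_def) (simp add: inner_sum_right)
  then show ?thesis by (simp add: inner_vec_of power2_eq_square)
qed

lemma mem_sphere_iff_inner: "x \<in> sphere 0 1 \<longleftrightarrow> x \<bullet> x = (1::real)"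
  by (simp add: norm_eq_sqrt_inner)

lemma chi_sphere: "chi (sphere (0 :: 'a::euclidean_space) 1) = 1 - (- 1) ^ DIM('a)"
  unfolding chi_def mem_sphere_iff_inner inner_vec_of_self by (simp add: eucl_integral_sphere)

text \<open>An orthogonal map takes \<open>v\<close> to a positive multiple of the first basis
  vector. Being linear it is definable, so the Euler characteristic is unchanged.\<close>

lemma chi_hemisphere:
  fixes v :: "real ^ 'n"
  assumes "v \<noteq> 0" shows "chi {\<xi> \<in> sphere 0 1. v \<bullet> \<xi> \<le> 0} = 1"
proof -
  define b where "b = (basis_list ! 0 :: real ^ 'n)"
  have b: "norm b = 1" unfolding b_def by (rule norm_Basis[OF nth_basis_list]) simp
  obtain f where f: "orthogonal_transformation f" "f v = norm v *\<^sub>R b"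
    using orthogonal_transformation_exists[of v "norm v *\<^sub>R b"] b by auto
  have lin: "linear f" and inner: "\<And>x y. f x \<bullet> f y = x \<bullet> y"
    using f(1) by (auto simp: orthogonal_transformation_def)
  have iff: "b \<bullet> f \<xi> \<le> 0 \<longleftrightarrow> v \<bullet> \<xi> \<le> 0" for \<xi>
    using inner[of v \<xi>] assms unfolding f(2) by (metis inner_scaleR_left mult_le_0_iff norm_not_less_zero zero_less_norm_iff not_le)
  have nrm: "f \<xi> \<in> sphere 0 1 \<longleftrightarrow> \<xi> \<in> sphere 0 1" for \<xi>
    unfolding mem_sphere_iff_inner inner ..
  have "chi {\<xi> \<in> sphere 0 1. v \<bullet> \<xi> \<le> 0} = chi {\<xi> \<in> sphere 0 1. b \<bullet> \<xi> \<le> 0}"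
  proof (rule chi_bij)
    have "bij f" by (rule orthogonal_transformation_bij[OF f(1)])
    show "bij_betw f {\<xi> \<in> sphere 0 1. v \<bullet> \<xi> \<le> 0} {\<xi> \<in> sphere 0 1. b \<bullet> \<xi> \<le> 0}"
    proof (rule bij_betw_imageI)
      show "inj_on f {\<xi> \<in> sphere 0 1. v \<bullet> \<xi> \<le> 0}"
        using \<open>bij f\<close> by (meson bij_is_inj inj_on_subset subset_UNIV)
      show "f ` {\<xi> \<in> sphere 0 1. v \<bullet> \<xi> \<le> 0} = {\<xi> \<in> sphere 0 1. b \<bullet> \<xi> \<le> 0}"
      proof (intro equalityI subsetI)
        fix \<eta> assume \<eta>: "\<eta> \<in> {\<xi> \<in> sphere 0 1. b \<bullet> \<xi> \<le> 0}"
        obtain \<xi> where "\<eta> = f \<xi>" using \<open>bij f\<close> by (meson bij_pointE)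
        then show "\<eta> \<in> f ` {\<xi> \<in> sphere 0 1. v \<bullet> \<xi> \<le> 0}" using \<eta> iff nrm by blast
      qed (use iff nrm in blast)
    qed
    show "def_pred (\<lambda>e. vec_of e \<in> {\<xi> \<in> sphere 0 1. v \<bullet> \<xi> \<le> 0} \<and>
        vec_of (\<lambda>i. e (i + DIM(real ^ 'n))) = f (vec_of e))"
      unfolding mem_Collect_eq mem_sphere_iff_inner by (intro dintros def_vec_linear[OF lin])
  qed
  also have "\<dots> = 1"
  proof -
    obtain m where m: "DIM(real ^ 'n) = Suc m" using DIM_positive[where 'a = "real ^ 'n"] gr0_conv_Suc by blast
    have "b \<bullet> vec_of u = u 0" for u
      unfolding b_def using inner_vec_of[of 0 u, where 'a = "real ^ 'n"] by (simp add: inner_commute)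
    then have "chi {\<xi> \<in> sphere 0 1. b \<bullet> \<xi> \<le> 0} =
        eucl_integral (Suc m) (\<lambda>x. of_bool ((\<Sum>i<Suc m. (x i)\<^sup>2) = 1 \<and> x 0 \<le> 0))"
      unfolding chi_def mem_Collect_eq mem_sphere_iff_inner inner_vec_of_self m by simp
    then show ?thesis using eucl_integral_hemisphere by simp
  qed
  finally show ?thesis .
qed

section \<open>Constructible functions and their integrals\<close>

lemma def_int_of_levels:
  assumes "finite (range h)" "\<And>c. definable S {x. h x = c}" "def_vec V"
  shows "def_int (\<lambda>e. h (V e))"
  unfolding def_int_def
proof (intro conjI allI)
  have "range (\<lambda>e. h (V e)) \<subseteq> range h" by auto
  then show "finite (range (\<lambda>e. h (V e)))" using assms(1) by (rule finite_subset)
  show "def_pred (\<lambda>e. h (V e) = c)" for c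
    using definable_mem[OF assms(2)[of c] assms(3)] by simp
qed

lemma finite_range_vec_of:
  fixes g :: "'a::euclidean_space \<Rightarrow> int"
  assumes "def_int (\<lambda>e. g (vec_of e))" shows "finite (range g)"
proof -
  have "g x \<in> range (\<lambda>e. g (vec_of e))" for x
    using rangeI[of "\<lambda>e. g (vec_of e)" "coords x"] by simp
  then have "range g \<subseteq> range (\<lambda>e. g (vec_of e))" by blast
  then show ?thesis by (rule finite_subset) (use assms in \<open>simp add: def_int_def\<close>)
qed

lemma definable_levels:
  fixes g :: "'a::euclidean_space \<Rightarrow> int"
  assumes "def_int (\<lambda>e. g (vec_of e))" "definable S X"
  shows "definable S {x \<in> X. g x = c}"
  using assms unfolding definable_iff_def_pred mem_Collect_eq def_int_def by (intro def_pred_conj) auto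

lemma restrict_in_CF:
  fixes g :: "'a::euclidean_space \<Rightarrow> int"
  assumes "def_int (\<lambda>e. g (vec_of e))" "definable S X"
  shows "restrict g X \<in> CF S X"
  unfolding CF_def
proof (intro CollectI conjI allI)
  have eq: "{x \<in> X. restrict g X x = c} = {x \<in> X. g x = c}" for c by auto
  show "definable S {x \<in> X. restrict g X x = c}" for c
    unfolding eq by (rule definable_levels[OF assms])
  have "range (\<lambda>c. {x \<in> X. g x = c}) \<subseteq> insert {} ((\<lambda>c. {x \<in> X. g x = c}) ` range g)" by auto
  then have "finite (range (\<lambda>c. {x \<in> X. g x = c}))"
    by (rule finite_subset) (use finite_range_vec_of[OF assms(1)] in simp)
  then show "locally_finite_in (top_of_set X) (range (\<lambda>c. {x \<in> X. restrict g X x = c}))"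
    unfolding eq by (intro finite_imp_locally_finite_in) auto
qed simp

text \<open>Integrands are restricted to \<open>X\<close>, while formulas range over the whole
  space; \<open>g\<close> is the extension for which the formulas are written.\<close>

lemma euler_integral_on:
  fixes g :: "'a::euclidean_space \<Rightarrow> int"
  assumes g: "def_int (\<lambda>e. g (vec_of e))" "definable S X" and f: "\<And>x. x \<in> X \<Longrightarrow> f x = g x"
  shows "euler_integrable S X f"
    "euler_integral S X f = eucl_integral DIM('a) (\<lambda>u. of_bool (vec_of u \<in> X) * g (vec_of u))"
proof -
  have eq: "{x \<in> X. f x = c} = {x \<in> X. g x = c}" for c using f by auto
  have "finite (f ` X)"
    by (rule finite_subset[OF _ finite_range_vec_of[OF g(1)]]) (use f in auto)
  then show int: "euler_integrable S X f"
    unfolding euler_integrable_def eq using definable_levels[OF g] by blast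
  have "(of_bool (x \<in> X) * f x) = of_bool (x \<in> X) * g x" for x using f by auto
  then show "euler_integral S X f = eucl_integral DIM('a) (\<lambda>u. of_bool (vec_of u \<in> X) * g (vec_of u))"
    unfolding euler_integral_eq[OF int] by (simp only:)
qed

lemma definable_UNIV: "definable S (UNIV :: 'a::euclidean_space set)"
  unfolding definable_iff_def_pred by (simp add: def_pred_const)

text \<open>Local finiteness alone admits infinitely many values. On the compact support finitely
  many neighborhoods suffice, each meeting finitely many levels, and elsewhere the value is
  0.\<close>

lemma CFc_UNIV:
  assumes h: "h \<in> CFc S (UNIV :: 'a::euclidean_space set)"
  shows "finite (range h)" "\<And>c. definable S {x. h x = c}" "bounded {x. h x \<noteq> 0}"
proof -
  let ?F = "closure {x. h x \<noteq> 0}" and ?A = "range (\<lambda>c. {x. h x = c})"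
  have cF: "compact ?F" and lf: "locally_finite_in euclidean ?A" and "\<And>c. definable S {x. h x = c}"
    using h by (auto simp: CFc_def CF_def)
  then show "\<And>c. definable S {x. h x = c}" by blast
  show "bounded {x. h x \<noteq> 0}"
    by (rule bounded_subset[OF compact_imp_bounded[OF cF] closure_subset])
  have "\<forall>x. \<exists>V. open V \<and> x \<in> V \<and> finite {U \<in> ?A. U \<inter> V \<noteq> {}}"
    using lf unfolding locally_finite_in_def by auto
  from choice[OF this] obtain V where V0: "\<forall>x. open (V x) \<and> x \<in> V x \<and> finite {U \<in> ?A. U \<inter> V x \<noteq> {}}"
    by (elim exE)
  note V = V0[THEN spec, THEN conjunct1] V0[THEN spec, THEN conjunct2, THEN conjunct1]
    V0[THEN spec, THEN conjunct2, THEN conjunct2]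
  obtain D where D: "D \<subseteq> ?F" "finite D" "?F \<subseteq> (\<Union>x\<in>D. V x)"
  proof (rule compactE_image[OF cF, of ?F V])
    show "?F \<subseteq> (\<Union>x\<in>?F. V x)" using V(2) by blast
  qed (rule V(1))
  have "{U \<in> ?A. U \<inter> ?F \<noteq> {}} \<subseteq> (\<Union>x\<in>D. {U \<in> ?A. U \<inter> V x \<noteq> {}})"
  proof
    fix U assume U: "U \<in> {U \<in> ?A. U \<inter> ?F \<noteq> {}}"
    then obtain z where z: "z \<in> U" "z \<in> ?F" by blast
    then obtain x where "x \<in> D" "z \<in> V x" using D(3) by blast
    then show "U \<in> (\<Union>x\<in>D. {U \<in> ?A. U \<inter> V x \<noteq> {}})" using U z(1) by blast
  qed
  then have finA: "finite {U \<in> ?A. U \<inter> ?F \<noteq> {}}" by (rule finite_subset) (use D(2) V(3) in blast)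
  have "(\<lambda>c. {x. h x = c}) ` (h ` ?F) \<subseteq> {U \<in> ?A. U \<inter> ?F \<noteq> {}}" by auto
  then have "finite ((\<lambda>c. {x. h x = c}) ` (h ` ?F))" using finA by (rule finite_subset)
  \<comment> \<open>Levels of attained values are nonempty, so different values have different
    levels, and finitely many levels mean finitely many values.\<close>
  moreover have "inj_on (\<lambda>c. {x. h x = c}) (h ` ?F)" by (rule inj_onI) auto
  ultimately have "finite (h ` ?F)" by (rule finite_imageD)
  moreover have "range h \<subseteq> insert 0 (h ` ?F)"
  proof safe
    fix x assume "h x \<notin> h ` ?F"
    then have "x \<notin> ?F" by blast
    then show "h x = 0" using closure_subset[of "{x. h x \<noteq> 0}"] by blast
  qed
  ultimately show "finite (range h)" using finite_subset by blast
qed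

text \<open>Projection to the direction is a bijection because
  \<open>snd y = x' \<bullet> fst y\<close> determines the second component; its inverse has a
  polynomial graph.\<close>

lemma chi_kernel_composition:
  fixes x x' :: "real ^ 'n"
  shows "chi {y. y \<in> sphere 0 1 \<times> UNIV \<and> snd y = x' \<bullet> fst y \<and> x \<bullet> fst y \<le> snd y} =
    1 - (- 1) ^ CARD('n) * of_bool (x = x')"
proof -
  let ?H = "{\<xi>::real ^ 'n. \<xi> \<in> sphere 0 1 \<and> (x - x') \<bullet> \<xi> \<le> 0}"
  have "chi ?H = chi {y. y \<in> sphere 0 1 \<times> UNIV \<and> snd y = x' \<bullet> fst y \<and> x \<bullet> fst y \<le> snd y}"
  proof (rule chi_bij)
    show "bij_betw (\<lambda>\<xi>. (\<xi>, x' \<bullet> \<xi>)) ?H {y. y \<in> sphere 0 1 \<times> UNIV \<and> snd y = x' \<bullet> fst y \<and> x \<bullet> fst y \<le> snd y}"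
      by (rule bij_betw_byWitness[where f' = fst]) (auto simp: inner_diff_left)
    show "def_pred (\<lambda>e. vec_of e \<in> ?H \<and>
        vec_of (\<lambda>i. e (i + DIM(real ^ 'n))) = (vec_of e :: real ^ 'n, x' \<bullet> (vec_of e :: real ^ 'n)))"
      unfolding mem_Collect_eq mem_sphere_iff_inner by (intro dintros iffD2[OF def_vec_real])
  qed
  moreover have "chi ?H = 1 - (- 1) ^ CARD('n) * of_bool (x = x')"
  proof (cases "x = x'")
    case True
    then have "?H = sphere 0 1" by auto
    then show ?thesis using True chi_sphere[where 'a = "real ^ 'n"] by simp
  next
    case False
    then show ?thesis using chi_hemisphere[of "x - x'"] by simp
  qed
  ultimately show ?thesis by simp
qed

section \<open>The two kernels and the inversion formula\<close>

context
  fixes Y :: "((real ^ 'n) \<times> real) set"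
    and K :: "(real ^ 'n) \<times> ((real ^ 'n) \<times> real) \<Rightarrow> int"
    and K' :: "((real ^ 'n) \<times> real) \<times> (real ^ 'n) \<Rightarrow> int"
  assumes Y: "Y = sphere 0 1 \<times> UNIV"
    and K: "K = restrict (indicator {(x, (\<xi>, t)). x \<bullet> \<xi> \<le> t}) (UNIV \<times> Y)"
    and K': "K' = restrict (\<lambda>z. of_bool (snd (fst z) = snd z \<bullet> fst (fst z))) (Y \<times> UNIV)"
begin

lemma mem_Y: "y \<in> Y \<longleftrightarrow> fst y \<bullet> fst y = 1"
  unfolding Y mem_Times_iff mem_sphere_iff_inner by simp

lemma def_fun_snd_real:
  fixes V :: "(nat \<Rightarrow> real) \<Rightarrow> 'a::euclidean_space \<times> real"
  assumes "def_vec V" shows "def_fun (\<lambda>e. snd (V e))"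
  using def_vec_snd[OF assms] by (simp only: def_vec_real)

lemma definable_Y: "definable S Y"
  unfolding definable_iff_def_pred mem_Y by (intro dintros)

lemma K_in_CF: "K \<in> CF S (UNIV \<times> Y)"
proof -
  have "K = restrict (\<lambda>z. of_bool (fst z \<bullet> fst (snd z) \<le> snd (snd z))) (UNIV \<times> Y)"
    unfolding K by (rule restrict_ext) (auto simp: indicator_def)
  moreover have "restrict (\<lambda>z. of_bool (fst z \<bullet> fst (snd z) \<le> snd (snd z))) (UNIV \<times> Y) \<in> CF S (UNIV \<times> Y)"
  proof (rule restrict_in_CF)
    show "def_int (\<lambda>e. of_bool (fst (vec_of e :: (real ^ 'n) \<times> (real ^ 'n) \<times> real) \<bullet> fst (snd (vec_of e)) \<le> snd (snd (vec_of e))))"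
      by (intro dintros def_fun_snd_real)
    show "definable S (UNIV \<times> Y)"
      unfolding definable_iff_def_pred mem_Times_iff mem_Y
      by (intro def_pred_conj def_pred_eq dintros) (simp_all add: def_pred_const)
  qed
  ultimately show ?thesis by simp
qed

lemma K'_in_CF: "K' \<in> CF S (Y \<times> UNIV)"
  unfolding K'
proof (rule restrict_in_CF)
  show "def_int (\<lambda>e. of_bool (snd (fst (vec_of e :: ((real ^ 'n) \<times> real) \<times> (real ^ 'n))) =
      snd (vec_of e :: ((real ^ 'n) \<times> real) \<times> (real ^ 'n)) \<bullet> fst (fst (vec_of e))))"
    by (intro dintros def_fun_snd_real)
  show "definable S (Y \<times> UNIV)"
    unfolding definable_iff_def_pred mem_Times_iff mem_Y
      by (intro def_pred_conj def_pred_eq dintros) (simp_all add: def_pred_const)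
qed

context
  fixes h :: "real ^ 'n \<Rightarrow> int"
  assumes h: "h \<in> CFc S UNIV"
begin

lemma def_int_h: "def_vec V \<Longrightarrow> def_int (\<lambda>e. h (V e))"
  by (rule def_int_of_levels[OF CFc_UNIV(1,2)[OF h]])

text \<open>The transform as an iterated integral, defined on the whole space and not only on
  \<open>Y\<close>, so that the formula calculus applies to it.\<close>

definition sublevel :: "(real ^ 'n) \<times> real \<Rightarrow> int" where
  "sublevel y = eucl_integral DIM(real ^ 'n) (\<lambda>u. h (vec_of u) * of_bool (vec_of u \<bullet> fst y \<le> snd y))"

lemma def_int_sublevel: "def_int (\<lambda>e. sublevel (vec_of e))"
  unfolding sublevel_def
  by (intro def_int_eucl_integral def_int_mult def_int_h def_int_of_bool def_pred_le def_fun_inner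
      def_vec_vec_of def_vec_fst def_fun_snd_real def_fun_trunc[of _ "\<lambda>i. i"] def_fun_var)

lemma radon_integrand:
  assumes "y \<in> Y"
  shows "euler_integrable S UNIV (\<lambda>x. h x * K (x, y))"
    "euler_integral S UNIV (\<lambda>x. h x * K (x, y)) = sublevel y"
proof -
  have g: "def_int (\<lambda>e. h (vec_of e) * of_bool (vec_of e \<bullet> fst y \<le> snd y))"
    by (intro def_int_mult def_int_h def_int_of_bool def_pred_le def_fun_inner def_vec_vec_of
        def_vec_const def_fun_const def_fun_var)
  have eq: "h x * K (x, y) = h x * of_bool (x \<bullet> fst y \<le> snd y)" for x
    using assms by (cases y) (simp add: K indicator_def)
  show "euler_integrable S UNIV (\<lambda>x. h x * K (x, y))"
    by (rule euler_integral_on(1)[where g = "\<lambda>x. h x * of_bool (x \<bullet> fst y \<le> snd y)", OF g definable_UNIV eq])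
  show "euler_integral S UNIV (\<lambda>x. h x * K (x, y)) = sublevel y"
    using euler_integral_on(2)[where g = "\<lambda>x. h x * of_bool (x \<bullet> fst y \<le> snd y)", OF g definable_UNIV eq] by (simp add: sublevel_def)
qed

lemma radon_eq_sublevel: "radon S UNIV Y K h = restrict sublevel Y"
  unfolding radon_def by (rule restrict_ext) (rule radon_integrand(2))

lemma euler_integral_h: "euler_integral S UNIV h = eucl_integral DIM(real ^ 'n) (\<lambda>u. h (vec_of u))"
  using euler_integral_on(2)[OF _ definable_UNIV, of h h] def_int_h[of vec_of]
  by (simp add: def_vec_vec_of def_fun_var)

text \<open>After the exchange of integrals \<open>h (vec_of u)\<close> leaves the inner one, which
  \<open>chi_kernel_composition\<close> evaluates. It is 1 except at \<open>u = coords x\<close>,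
  where \<open>(- 1) ^ CARD('n)\<close> is subtracted; as a point has integral 1, this exception
  contributes a multiple of \<open>h x\<close>.\<close>

lemma inversion_integrand:
  shows "euler_integrable S Y (\<lambda>y. radon S UNIV Y K h y * K' (y, x))"
    "euler_integral S Y (\<lambda>y. radon S UNIV Y K h y * K' (y, x)) =
      euler_integral S UNIV h - (- 1) ^ CARD('n) * h x"
proof -
  let ?M = "DIM((real ^ 'n) \<times> real)" and ?N = "DIM(real ^ 'n)"
    and ?v = "vec_of :: (nat \<Rightarrow> real) \<Rightarrow> (real ^ 'n) \<times> real"
  have g: "def_int (\<lambda>e. sublevel (?v e) * of_bool (snd (?v e) = x \<bullet> fst (?v e)))"
    by (intro def_int_mult def_int_sublevel def_int_of_bool def_pred_eq def_fun_inner def_vec_vec_of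
        def_vec_fst def_fun_snd_real def_vec_const def_fun_var)
  have eq: "radon S UNIV Y K h y * K' (y, x) = sublevel y * of_bool (snd y = x \<bullet> fst y)" if "y \<in> Y" for y
    using that by (simp add: radon_eq_sublevel K')
  show "euler_integrable S Y (\<lambda>y. radon S UNIV Y K h y * K' (y, x))"
    by (rule euler_integral_on(1)[where g = "\<lambda>y. sublevel y * of_bool (snd y = x \<bullet> fst y)", OF g definable_Y eq])
  define q where "q z y \<longleftrightarrow> y \<in> Y \<and> snd y = x \<bullet> fst y \<and> z \<bullet> fst y \<le> snd y" for z y
  have dq: "def_pred (\<lambda>e. q (V e) (W e))" if "def_vec V" "def_vec W" for V W
    unfolding q_def mem_Y by (intro dintros def_fun_snd_real that)
  have d1: "def_int (\<lambda>e. h (vec_of (trunc ?N e)) * of_bool (vec_of (trunc ?N e) \<bullet> \<xi> \<le> t))" for \<xi> t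
    by (intro def_int_mult def_int_h def_int_of_bool def_pred_le def_fun_inner def_vec_vec_of
        def_vec_const def_fun_const def_fun_trunc[of _ "\<lambda>i. i"])
  have "euler_integral S Y (\<lambda>y. radon S UNIV Y K h y * K' (y, x)) =
      eucl_integral ?M (\<lambda>v. of_bool (?v v \<in> Y) * (sublevel (?v v) * of_bool (snd (?v v) = x \<bullet> fst (?v v))))"
    by (rule euler_integral_on(2)[where g = "\<lambda>y. sublevel y * of_bool (snd y = x \<bullet> fst y)", OF g definable_Y eq])
  also have "\<dots> = eucl_integral ?M (\<lambda>v. eucl_integral ?N (\<lambda>u. h (vec_of u) * of_bool (q (vec_of u) (vec_of v))))"
  proof -
    have "of_bool (y \<in> Y) * (sublevel y * of_bool (snd y = x \<bullet> fst y)) =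
        eucl_integral ?N (\<lambda>u. h (vec_of u) * of_bool (q (vec_of u) y))" for y
    proof -
      have "of_bool (y \<in> Y) * (sublevel y * of_bool (snd y = x \<bullet> fst y)) =
          of_bool (y \<in> Y \<and> snd y = x \<bullet> fst y) * sublevel y" by simp
      also have "\<dots> = eucl_integral ?N (\<lambda>u. of_bool (y \<in> Y \<and> snd y = x \<bullet> fst y) *
          (h (vec_of u) * of_bool (vec_of u \<bullet> fst y \<le> snd y)))"
        unfolding sublevel_def by (rule eucl_integral_cmult[OF d1, symmetric])
      also have "\<dots> = eucl_integral ?N (\<lambda>u. h (vec_of u) * of_bool (q (vec_of u) y))"
        by (rule eucl_integral_cong) (simp add: q_def)
      finally show ?thesis .
    qed
    then show ?thesis by (simp only:)
  qed
  also have "\<dots> = eucl_integral ?N (\<lambda>u. eucl_integral ?M (\<lambda>v. h (vec_of u) * of_bool (q (vec_of u) (vec_of v))))"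
    by (rule eucl_integral_swap)
      (intro def_int_mult def_int_h def_int_of_bool dq def_vec_vec_of def_fun_trunc[of _ "\<lambda>i. i"] def_fun_trunc)
  also have "\<dots> = eucl_integral ?N (\<lambda>u. h (vec_of u) + (- ((- 1) ^ CARD('n)) * h x) * of_bool (u = coords x))"
  proof (rule eucl_integral_cong)
    fix u assume u: "u \<in> eucl ?N"
    have "eucl_integral ?M (\<lambda>v. h (vec_of u) * of_bool (q (vec_of u) (vec_of v))) =
        h (vec_of u) * eucl_integral ?M (\<lambda>v. of_bool (q (vec_of u) (vec_of v)))"
      by (rule eucl_integral_cmult)
        (intro def_int_of_bool dq def_vec_const def_vec_vec_of def_fun_trunc[of _ "\<lambda>i. i"])
    also have "eucl_integral ?M (\<lambda>v. of_bool (q (vec_of u) (vec_of v))) = 1 - (- 1) ^ CARD('n) * of_bool (vec_of u = x)"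
      using chi_kernel_composition[of x "vec_of u"] unfolding chi_def q_def Y mem_Collect_eq .
    also have "h (vec_of u) * (1 - (- 1) ^ CARD('n) * of_bool (vec_of u = x)) =
        h (vec_of u) + (- ((- 1) ^ CARD('n)) * h x) * of_bool (u = coords x)"
      using vec_of_eq_iff[OF u, of x] by (cases "u = coords x") (auto simp: algebra_simps)
    finally show "eucl_integral ?M (\<lambda>v. h (vec_of u) * of_bool (q (vec_of u) (vec_of v))) =
        h (vec_of u) + (- ((- 1) ^ CARD('n)) * h x) * of_bool (u = coords x)" .
  qed
  also have "\<dots> = eucl_integral ?N (\<lambda>u. h (vec_of u)) + (- ((- 1) ^ CARD('n)) * h x) * 1"
  proof -
    have dh: "def_int (\<lambda>e. h (vec_of (trunc ?N e)))"
      by (intro def_int_h def_vec_vec_of def_fun_trunc[of _ "\<lambda>i. i"])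
    have eq: "trunc ?N e = coords x \<longleftrightarrow> (vec_of e = x)" for e
      using vec_of_eq_iff[OF trunc_in_eucl[of ?N e], of x] unfolding vec_of_trunc by blast
    have dp: "def_int (\<lambda>e. of_bool (trunc ?N e = coords x))"
      unfolding eq by (intro dintros)
    show ?thesis
      unfolding eucl_integral_add[OF dh def_int_mult[OF def_int_const dp]]
        eucl_integral_cmult[OF dp] eucl_integral_point[OF coords_in_eucl[of x]] by (rule refl)
  qed
  finally show "euler_integral S Y (\<lambda>y. radon S UNIV Y K h y * K' (y, x)) =
      euler_integral S UNIV h - (- 1) ^ CARD('n) * h x"
    by (simp add: euler_integral_h)
qed

lemma radon_defined_K: "radon_defined S UNIV Y K h"
  unfolding radon_defined_def using radon_integrand(1) by blast

lemma radon_in_CF: "radon S UNIV Y K h \<in> CF S Y"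
  unfolding radon_eq_sublevel by (rule restrict_in_CF[OF def_int_sublevel definable_Y])

lemma radon_defined_K': "radon_defined S Y UNIV K' (radon S UNIV Y K h)"
  unfolding radon_defined_def using inversion_integrand(1) by blast

lemma radon_inversion:
  "radon S Y UNIV K' (radon S UNIV Y K h) = (\<lambda>x. euler_integral S UNIV h - (- 1) ^ CARD('n) * h x)"
  unfolding radon_def[of S Y UNIV K'] inversion_integrand(2) by (simp add: restrict_def)

end

text \<open>Supports are bounded and the space is not, so both functions vanish at some point. There
  the inverted transforms are the total integrals, which therefore agree and can be cancelled
  everywhere else.\<close>

lemma radon_inj: "inj_on (radon S UNIV Y K) (CFc S UNIV)"
proof (rule inj_onI)
  fix f g assume f: "f \<in> CFc S UNIV" and g: "g \<in> CFc S UNIV" and eq: "radon S UNIV Y K f = radon S UNIV Y K g"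
  let ?s = "(- 1) ^ CARD('n) :: int"
  have *: "euler_integral S UNIV f - ?s * f x = euler_integral S UNIV g - ?s * g x" for x
    using fun_cong[OF radon_inversion[OF f], of x] fun_cong[OF radon_inversion[OF g], of x] eq by simp
  have "bounded ({x. f x \<noteq> 0} \<union> {x. g x \<noteq> 0})"
    using CFc_UNIV(3)[OF f] CFc_UNIV(3)[OF g] by simp
  then have "{x. f x \<noteq> 0} \<union> {x. g x \<noteq> 0} \<noteq> UNIV" using not_bounded_UNIV by metis
  then obtain x0 where "f x0 = 0" "g x0 = 0" by blast
  then have "euler_integral S UNIV f = euler_integral S UNIV g" using *[of x0] by simp
  then have "f x = g x" for x using *[of x] by simp
  then show "f = g" by (rule ext)
qed

end

end

theorem theorem5:
  fixes S :: "nat \<Rightarrow> real list set set"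
    and X :: "(real ^ 'n) set"
    and Y :: "((real ^ 'n) \<times> real) set"
    and K :: "(real ^ 'n) \<times> ((real ^ 'n) \<times> real) \<Rightarrow> int"
  assumes "o_minimal_field_expansion S"
    and "X = UNIV"
    and "Y = sphere 0 1 \<times> UNIV"
    and "K = restrict (indicator {(x, (\<xi>, t)). x \<bullet> \<xi> \<le> t}) (X \<times> Y)"
  shows "K \<in> CF S (X \<times> Y)
    \<and> (\<forall>h\<in>CFc S X. radon_defined S X Y K h \<and> radon S X Y K h \<in> CF S Y)
    \<and> (\<exists>K'\<in>CF S (Y \<times> X). \<exists>(lam :: int) (mu :: int). lam \<noteq> mu \<and>
         (\<forall>h\<in>CFc S X. radon_defined S Y X K' (radon S X Y K h) \<and>
            radon S Y X K' (radon S X Y K h) =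
              (\<lambda>x\<in>X. (mu - lam) * h x + lam * euler_integral S X h * indicator X x)))
    \<and> inj_on (radon S X Y K) (CFc S X)"
proof -
  interpret o_minimal_field_expansion S by (rule assms(1))
  note X = assms(2) and Y = assms(3) and K = assms(4)[unfolded assms(2)]
  define K' :: "((real ^ 'n) \<times> real) \<times> (real ^ 'n) \<Rightarrow> int" where
    "K' = restrict (\<lambda>z. of_bool (snd (fst z) = snd z \<bullet> fst (fst z))) (Y \<times> UNIV)"
  note YK = Y K K'_def
  \<comment> \<open>The Euler characteristic of the unit sphere. It differs from 1, the value for a
    hemisphere, by a sign, so the coefficient of \<open>h\<close> is 1 or -1.\<close>
  let ?mu = "1 - (- 1) ^ CARD('n) :: int"
  have inv: "radon_defined S Y UNIV K' (radon S UNIV Y K h) \<and>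
      radon S Y UNIV K' (radon S UNIV Y K h) =
        (\<lambda>x\<in>UNIV. (?mu - 1) * h x + 1 * euler_integral S UNIV h * indicator UNIV x)"
    if "h \<in> CFc S UNIV" for h
    using radon_defined_K'[OF YK that] radon_inversion[OF YK that] by auto
  show ?thesis
    unfolding X
  proof (intro conjI ballI)
    show "K \<in> CF S (UNIV \<times> Y)" by (rule K_in_CF[OF YK])
    show "radon_defined S UNIV Y K h" "radon S UNIV Y K h \<in> CF S Y" if "h \<in> CFc S UNIV" for h
      using radon_defined_K[OF YK that] radon_in_CF[OF YK that] by blast+
    show "\<exists>K'\<in>CF S (Y \<times> UNIV). \<exists>(lam :: int) (mu :: int). lam \<noteq> mu \<and>
         (\<forall>h\<in>CFc S UNIV. radon_defined S Y UNIV K' (radon S UNIV Y K h) \<and>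
            radon S Y UNIV K' (radon S UNIV Y K h) =
              (\<lambda>x\<in>UNIV. (mu - lam) * h x + lam * euler_integral S UNIV h * indicator UNIV x))"
    proof (rule bexI[OF _ K'_in_CF[OF YK]], rule exI[of _ 1], rule exI[of _ ?mu], intro conjI ballI)
      show "1 \<noteq> ?mu" by simp
    qed (use inv in blast)+
    show "inj_on (radon S UNIV Y K) (CFc S UNIV)" by (rule radon_inj[OF YK])
  qed
qed

end
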